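(* Let $1<k\le n$ and let $\|\cdot\|_{(k)}$ be the Ky-Fan $k$-norm on $\mathbb{M}_n(\mathbb{C})$. Suppose $T\colon \mathbb{M}_n(\mathbb{C})\to\mathbb{M}_n(\mathbb{C})$ is a bijective ($\mathbb{C}$-)linear map which preserves parallel pairs with respect to $\|\cdot\|_{(k)}$, i.e., for all $A,B\in\mathbb{M}_n(\mathbb{C})$, if $A$ is parallel to $B$ then $T(A)$ is parallel to $T(B)$. Then $T$ is a scalar multiple of a linear isometry of $(\mathbb{M}_n(\mathbb{C}),\|\cdot\|_{(k)})$. More precisely, there exist $\gamma>0$ and unitary $U,V\in\mathbb{M}_n(\mathbb{C})$ such that either $T(X)=\gamma UXV$ for all $X$, or $T(X)=\gamma UX^tV$ for all $X$.
   Context: $\mathbb{M}_n(\mathbb{C})$ is the space of $n\times n$ complex matrices and $X^t$ is the transpose of $X$. For $A\in\mathbb{M}_n(\mathbb{C})$, $s_1(A)\ge\cdots\ge s_n(A)$ are its singular values, and the Ky-Fan $k$-norm is $\|A\|_{(k)}=s_1(A)+\cdots+s_k(A)$. In a complex normed space, $x$ is parallel to $y$ if $\|x+\mu y\|=\|x\|+\|y\|$ for some $\mu\in\mathbb{C}$ with $|\mu|=1$. *)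

theory Defs
  imports
    "HOL-Analysis.Analysis"
    "HOL-Computational_Algebra.Computational_Algebra"
begin

text \<open>
  The operation \<open>*s\<close> is scalar multiplication on \<open>'a ^ 'n\<close>, not on matrices, and \<open>*\<^sub>R\<close> is only real;
  hence an explicit complex scalar multiplication on \<open>complex ^ 'n ^ 'm\<close>.
\<close>

definition cmat_scale :: "complex \<Rightarrow> complex ^ 'n ^ 'm \<Rightarrow> complex ^ 'n ^ 'm"
  where "cmat_scale c A = map_matrix (\<lambda>a. c * a) A"

lemma vector_space_cmat_scale: "vector_space cmat_scale"
  by unfold_locales (simp_all add: cmat_scale_def vec_eq_iff algebra_simps)

definition conj_transpose :: "complex ^ 'n ^ 'm \<Rightarrow> complex ^ 'm ^ 'n"
  where "conj_transpose A = map_matrix cnj (transpose A)"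

definition unitary_matrix :: "complex ^ 'n ^ 'n \<Rightarrow> bool"
  where "unitary_matrix U \<longleftrightarrow>
    conj_transpose U ** U = mat 1 \<and> U ** conj_transpose U = mat 1"

definition charpoly :: "complex ^ 'n ^ 'n \<Rightarrow> complex poly"
  where "charpoly A = det (mat [:0, 1:] - map_matrix (\<lambda>a. [:a:]) A)"

text \<open>
  The singular values are the square roots of the eigenvalues of \<open>A\<^sup>* A\<close>, counted with algebraic
  multiplicity and listed in decreasing order; the list has length \<open>CARD('n)\<close>. The eigenvalues
  are nonnegative reals, so that \<open>Re\<close> loses nothing.
\<close>

definition singular_values :: "complex ^ 'n ^ 'n \<Rightarrow> real list"
  where "singular_values A =
    rev (sorted_list_of_multiset
      (image_mset (\<lambda>z. sqrt (Re z)) (proots (charpoly (conj_transpose A ** A)))))"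

text \<open>List indices start at 0, so \<open>singular_values A ! i\<close> is \<open>s\<^bsub>i+1\<^esub>(A)\<close>.\<close>

definition ky_fan_norm :: "nat \<Rightarrow> complex ^ 'n ^ 'n \<Rightarrow> real"
  where "ky_fan_norm k A = (\<Sum>i<k. singular_values A ! i)"

text \<open>\<open>N\<close> is the norm with respect to which parallelism is meant.\<close>

definition parallel_wrt ::
    "(complex ^ 'n ^ 'n \<Rightarrow> real) \<Rightarrow> complex ^ 'n ^ 'n \<Rightarrow> complex ^ 'n ^ 'n \<Rightarrow> bool"
  where "parallel_wrt N A B \<longleftrightarrow>
    (\<exists>\<mu>. cmod \<mu> = 1 \<and> N (A + cmat_scale \<mu> B) = N A + N B)"

end

theory Submission
  imports Defs
begin

text \<open>
  The Ky Fan norm of \<open>X\<close> is the maximum of \<open>Re tr (F\<^sup>\<dagger> X)\<close> over the partial isometries \<open>F\<close> of rank \<open>k\<close>,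
  so \<open>A\<close> and \<open>B\<close> are parallel iff one \<open>F\<close> norms both \<open>A\<close> and a rotation of \<open>B\<close>. If \<open>F\<close> norms \<open>A\<close>
  and \<open>T A\<close> is normed by a single \<open>F'\<close> (which holds for a dense set of matrices \<open>A\<close>), then \<open>T\<close> maps
  the matrices normed by \<open>F\<close> to rotations of matrices normed by \<open>F'\<close>, and the rotation turns out
  not to depend on the matrix. By continuity, the norm is therefore additive on \<open>T R\<close> and \<open>z T R'\<close>
  whenever \<open>R\<close> and \<open>R'\<close> are orthogonal matrices of rank one and \<open>|z| = 1\<close>. Additivity for all these
  \<open>z\<close> forces \<open>T R\<close> and \<open>T R'\<close> to be orthogonal as well. Hence, up to unitary factors, \<open>T\<close> maps each
  matrix unit to a multiple of a matrix unit, and the multiples have the same modulus.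
\<close>

text \<open>The unimodular factor in a parallel pair depends on the pair, and parallelism is not
  transitive, so little follows from two matrices at a time. For this reason the argument treats all
  matrices normed by one \<open>F\<close> together. If \<open>T A\<close> were normed by several
  partial isometries, different members of that set could be paired with different ones. Matrices
  with distinct positive singular values have a single one; they are dense, and so are their
  preimages, because \<open>T\<close> is a homeomorphism. The limit reaches every \<open>F\<close>
  because \<open>F\<close>, regarded as a matrix, is normed by \<open>F\<close> alone: when
  \<open>A\<close> tends to \<open>F\<close>, so do the partial isometries norming \<open>A\<close>.

  The bound \<open>1 < k\<close> matters in two ways. Two orthogonal matrices of rank one are normed
  by a common \<open>F\<close> only if its rank is at least two. And blocks of size at least two are
  not all proportional, which is what rules out varying phases.\<close>

no_notation fps_nth (infixl \<open>$\<close> 75)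

notation conj_transpose (\<open>(_\<^sup>\<dagger>)\<close> [1000] 999)

subsection \<open>Complex matrices\<close>

lemma adj_nth [simp]: "(A\<^sup>\<dagger>) $ i $ j = cnj (A $ j $ i)"
  by (simp add: conj_transpose_def transpose_def)

lemma cmat_scale_nth [simp]: "cmat_scale c A $ i $ j = c * A $ i $ j"
  by (simp add: cmat_scale_def)

lemma matrix_mult_nth: "(A ** B) $ i $ j = (\<Sum>l\<in>UNIV. A $ i $ l * B $ l $ j)"
  by (simp add: matrix_matrix_mult_def)

lemma adj_adj [simp]: "(A\<^sup>\<dagger>)\<^sup>\<dagger> = A"
  and adj_add [simp]: "(A + B)\<^sup>\<dagger> = A\<^sup>\<dagger> + B\<^sup>\<dagger>"
  and adj_zero [simp]: "0\<^sup>\<dagger> = 0"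
  and adj_scale [simp]: "(cmat_scale c A)\<^sup>\<dagger> = cmat_scale (cnj c) (A\<^sup>\<dagger>)"
  and adj_one [simp]: "(mat 1)\<^sup>\<dagger> = mat 1"
  by (simp_all add: vec_eq_iff mat_def)

lemma adj_mult [simp]: "(A ** B)\<^sup>\<dagger> = B\<^sup>\<dagger> ** A\<^sup>\<dagger>"
  by (simp add: vec_eq_iff matrix_mult_nth mult.commute)

lemma scale_mult_left [simp]: "cmat_scale c A ** B = cmat_scale c (A ** B)"
  and scale_mult_right [simp]: "A ** cmat_scale c B = cmat_scale c (A ** B)"
  by (simp_all add: vec_eq_iff matrix_mult_nth sum_distrib_left mult_ac)

lemma scale_scale [simp]: "cmat_scale c (cmat_scale d A) = cmat_scale (c * d) A"
  and scale_one [simp]: "cmat_scale 1 A = A"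
  and scale_zero [simp]: "cmat_scale 0 A = 0"
  and scale_zero_right [simp]: "cmat_scale c 0 = 0"
  and scale_add: "cmat_scale c (A + B) = cmat_scale c A + cmat_scale c B"
  and scale_add_left: "cmat_scale (c + d) A = cmat_scale c A + cmat_scale d A"
  by (simp_all add: vec_eq_iff algebra_simps)

lemma scaleR_matrix_eq: "r *\<^sub>R A = cmat_scale (complex_of_real r) A"
  by (simp add: vec_eq_iff complex_eq_iff)

lemma scale_minus_one: "cmat_scale (- 1) A = - A"
  by (simp add: vec_eq_iff)

lemma scale_eq_0_iff [simp]: "cmat_scale c A = 0 \<longleftrightarrow> c = 0 \<or> A = 0"
  by (auto simp: vec_eq_iff)

lemma matrix_mult_add_left: "(A + B) ** C = A ** C + B ** (C :: complex ^ 'n ^ 'm)"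
  and matrix_mult_add_right: "D ** (E + F) = D ** E + D ** (F :: complex ^ 'n ^ 'm)"
  by (simp_all add: vec_eq_iff matrix_mult_nth sum.distrib algebra_simps)

lemma matrix_mult_zero [simp]: "(0 :: complex ^ 'n ^ 'm) ** A = 0" "A ** (0 :: complex ^ 'n ^ 'm) = 0"
  by (simp_all add: vec_eq_iff matrix_mult_nth)

lemma trace_scale: "trace (cmat_scale c A) = c * trace A"
  by (simp add: trace_def sum_distrib_left)

text \<open>This makes \<open>inner F X\<close> the duality pairing that computes the Ky Fan norm
  and \<open>norm\<close> the Frobenius norm, so that Cauchy-Schwarz and its equality case apply to
  partial isometries.\<close>

lemma inner_matrix: "inner A B = Re (trace (A\<^sup>\<dagger> ** B))" for A B :: "complex ^ 'n ^ 'm"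
proof -
  have "inner A B = (\<Sum>i\<in>UNIV. \<Sum>j\<in>UNIV. Re (cnj (A $ i $ j) * B $ i $ j))"
    by (simp add: inner_vec_def inner_complex_def)
  also have "\<dots> = (\<Sum>j\<in>UNIV. \<Sum>i\<in>UNIV. Re (cnj (A $ i $ j) * B $ i $ j))"
    by (rule sum.swap)
  also have "\<dots> = Re (trace (A\<^sup>\<dagger> ** B))"
    by (simp add: trace_def matrix_mult_nth)
  finally show ?thesis .
qed

lemma inner_mult_left: "inner (A ** X) B = inner X (A\<^sup>\<dagger> ** B)"
  for A :: "complex ^ 'm ^ 'n" and X :: "complex ^ 'k ^ 'm"
  by (simp add: inner_matrix matrix_mul_assoc)

lemma inner_mult_right: "inner (X ** A) B = inner X (B ** A\<^sup>\<dagger>)"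
  for A :: "complex ^ 'm ^ 'n" and X :: "complex ^ 'n ^ 'k"
proof -
  have "trace ((A\<^sup>\<dagger> ** X\<^sup>\<dagger>) ** B) = trace (X\<^sup>\<dagger> ** (B ** A\<^sup>\<dagger>))"
    by (metis matrix_mul_assoc trace_mul_sym)
  then show ?thesis
    by (simp add: inner_matrix)
qed

definition cdot :: "complex ^ 'n \<Rightarrow> complex ^ 'n \<Rightarrow> complex"
  where "cdot v w = (\<Sum>i\<in>UNIV. cnj (v $ i) * w $ i)"

lemma Re_cdot: "Re (cdot v w) = inner v w"
  by (simp add: cdot_def inner_vec_def inner_complex_def)

lemma cnj_cdot: "cnj (cdot v w) = cdot w v"
  by (simp add: cdot_def mult.commute)

lemma cdot_self: "cdot v v = complex_of_real ((norm v)\<^sup>2)"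
proof (rule complex_eqI)
  show "Re (cdot v v) = Re (complex_of_real ((norm v)\<^sup>2))"
    by (simp add: Re_cdot power2_norm_eq_inner)
  have "cnj (cdot v v) = cdot v v"
    by (rule cnj_cdot)
  then show "Im (cdot v v) = Im (complex_of_real ((norm v)\<^sup>2))"
    by (metis Im_complex_of_real complex_is_Real_iff Reals_cnj_iff)
qed

lemma cdot_add_left: "cdot (w + u) v = cdot w v + cdot u v"
  and cdot_diff_left: "cdot (w - u) v = cdot w v - cdot u v"
  and cdot_smult_right: "cdot v (c *s w) = c * cdot v w"
  and cdot_smult_left: "cdot (c *s v) w = cnj c * cdot v w"
  and cdot_zero_right [simp]: "cdot v 0 = 0"
  and cdot_zero_left [simp]: "cdot 0 v = 0"
  by (simp_all add: cdot_def sum.distrib sum_subtractf sum_distrib_left algebra_simps)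

lemma cdot_axis_left: "cdot (axis i 1) v = v $ i"
  by (simp add: cdot_def axis_def if_distrib [of cnj] if_distrib [of "\<lambda>x. x * _"] cong: if_cong)

lemma cdot_adj: "cdot v (A *v w) = cdot (A\<^sup>\<dagger> *v v) w"
proof -
  have "cdot v (A *v w) = (\<Sum>i\<in>UNIV. \<Sum>j\<in>UNIV. cnj (v $ i) * (A $ i $ j * w $ j))"
    by (simp add: cdot_def matrix_vector_mult_def sum_distrib_left)
  also have "\<dots> = (\<Sum>j\<in>UNIV. \<Sum>i\<in>UNIV. cnj (v $ i) * (A $ i $ j * w $ j))"
    by (rule sum.swap)
  also have "\<dots> = cdot (A\<^sup>\<dagger> *v v) w"
    by (simp add: cdot_def matrix_vector_mult_def sum_distrib_left sum_distrib_right mult_ac)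
  finally show ?thesis .
qed

lemma mult_axis_nth [simp]: "((A :: complex ^ 'n ^ 'm) *v axis j 1) $ i = A $ i $ j"
  by (simp add: matrix_vector_mult_def axis_def if_distrib [of "\<lambda>x. _ * x"] cong: if_cong)

lemma adj_mult_cdot: "(A\<^sup>\<dagger> ** B) $ i $ j = cdot (A *v axis i 1) (B *v axis j 1)"
  by (simp add: matrix_mult_nth cdot_def)

subsection \<open>Unitary matrices\<close>

lemma unitary_left: "unitary_matrix U \<Longrightarrow> U\<^sup>\<dagger> ** U = mat 1"
  and unitary_right: "unitary_matrix U \<Longrightarrow> U ** U\<^sup>\<dagger> = mat 1"
  by (simp_all add: unitary_matrix_def)

lemma unitaryI: "U\<^sup>\<dagger> ** U = mat 1 \<Longrightarrow> unitary_matrix U"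
  by (simp add: unitary_matrix_def matrix_left_right_inverse1)

lemma unitary_one [simp]: "unitary_matrix (mat 1)"
  by (simp add: unitary_matrix_def)

lemma unitary_adj [simp]: "unitary_matrix (U\<^sup>\<dagger>) \<longleftrightarrow> unitary_matrix U"
  by (auto simp: unitary_matrix_def)

lemma unitary_cancel:
  assumes "unitary_matrix U"
  shows "U ** (U\<^sup>\<dagger> ** A) = A" "U\<^sup>\<dagger> ** (U ** A) = A" "(B ** U) ** U\<^sup>\<dagger> = B" "(B ** U\<^sup>\<dagger>) ** U = B"
    and "U *v (U\<^sup>\<dagger> *v v) = v" "U\<^sup>\<dagger> *v (U *v v) = v"
  using unitary_left[OF assms] unitary_right[OF assms]
  by (simp_all add: matrix_mul_assoc matrix_vector_mul_assoc)
     (simp_all add: matrix_mul_assoc[symmetric])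

lemma unitary_mult [simp]:
  assumes "unitary_matrix U" "unitary_matrix V"
  shows "unitary_matrix (U ** V)"
proof (rule unitaryI)
  have "(U ** V)\<^sup>\<dagger> ** (U ** V) = V\<^sup>\<dagger> ** (U\<^sup>\<dagger> ** (U ** V))"
    by (simp add: matrix_mul_assoc)
  then show "(U ** V)\<^sup>\<dagger> ** (U ** V) = mat 1"
    using assms by (simp add: unitary_cancel unitary_left)
qed

lemma unitary_cdot: "unitary_matrix U \<Longrightarrow> cdot (U *v v) (U *v w) = cdot v w"
  by (simp add: cdot_adj unitary_cancel)

lemma unitary_norm: "unitary_matrix U \<Longrightarrow> norm (U *v v) = norm v"
  by (metis Re_cdot norm_eq_sqrt_inner unitary_cdot)

lemma unitary_inner:
  assumes "unitary_matrix U" "unitary_matrix V"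
  shows "inner (U ** A ** V) B = inner A (U\<^sup>\<dagger> ** B ** V\<^sup>\<dagger>)"
  by (simp add: inner_mult_right[of "U ** A" V] inner_mult_left[of U A] matrix_mul_assoc)

lemma unitary_conj_inverse:
  assumes "unitary_matrix U" "unitary_matrix V"
  shows "U\<^sup>\<dagger> ** (U ** A ** V) ** V\<^sup>\<dagger> = A" "U ** (U\<^sup>\<dagger> ** A ** V\<^sup>\<dagger>) ** V = A"
  by (metis assms matrix_mul_assoc unitary_cancel)+

subsection \<open>Positive semidefinite matrices\<close>

text \<open>Only the quadratic form is constrained, since this is what the variational argument
  delivers; over the complex numbers a real form already forces Hermitian symmetry
  (\<open>psd_adj_nth\<close>).\<close>

definition psd :: "complex ^ 'n ^ 'n \<Rightarrow> bool"
  where "psd M \<longleftrightarrow> (\<forall>v. Im (cdot v (M *v v)) = 0 \<and> 0 \<le> Re (cdot v (M *v v)))"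

lemma cdot_quadratic_pair:
  assumes "i \<noteq> j"
  shows "cdot (a *s axis i 1 + b *s axis j 1) (M *v (a *s axis i 1 + b *s axis j 1)) =
    cnj a * a * M $ i $ i + cnj a * b * M $ i $ j + cnj b * a * M $ j $ i + cnj b * b * M $ j $ j"
  by (simp add: cdot_add_left cdot_smult_left cdot_axis_left matrix_vector_right_distrib
      vec.scale algebra_simps)

lemma psd_diag:
  assumes "psd M"
  shows "Im (M $ i $ i) = 0" "0 \<le> Re (M $ i $ i)"
  using assms unfolding psd_def by (metis cdot_axis_left mult_axis_nth)+

lemma psd_adj_nth:
  assumes "psd M"
  shows "M $ j $ i = cnj (M $ i $ j)"
proof (cases "i = j")
  case True
  then show ?thesis
    using psd_diag[OF assms, of i] by (simp add: complex_eq_iff)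
next
  case False
  have *: "Im (cnj a * a * M $ i $ i + cnj a * b * M $ i $ j + cnj b * a * M $ j $ i + cnj b * b * M $ j $ j) = 0"
    for a b
    using assms unfolding psd_def cdot_quadratic_pair[OF False, of a b M, symmetric] by blast
  show ?thesis
    \<comment> \<open>The choice \<open>1, 1\<close> makes the imaginary parts of the two entries
      opposite; \<open>1, \<i>\<close> makes their real parts equal.\<close>
    using *[of 1 1] *[of 1 \<i>] psd_diag[OF assms, of i] psd_diag[OF assms, of j]
    by (simp add: complex_eq_iff)
qed

lemma psd_adj: "psd M \<Longrightarrow> M\<^sup>\<dagger> = M"
  by (auto simp: vec_eq_iff intro: psd_adj_nth[symmetric])

text \<open>Without the diagonal entry, the form on the span of the two axes has no quadratic term
  in the \<open>i\<close>-th coordinate, and an affine function bounded below is constant.\<close>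

lemma psd_zero_diag:
  assumes "psd M" "M $ i $ i = 0"
  shows "M $ i $ j = 0" "M $ j $ i = 0"
proof -
  show "M $ i $ j = 0"
  proof (cases "i = j")
    case False
    define m where "m = M $ i $ j"
    define r where "r = Re (M $ j $ j)"
    have "0 \<le> Re (cnj a * a * M $ i $ i + cnj a * 1 * M $ i $ j + cnj 1 * a * M $ j $ i + cnj 1 * 1 * M $ j $ j)"
      for a
      using assms(1) unfolding psd_def cdot_quadratic_pair[OF False, of a 1 M, symmetric] by blast
    then have "0 \<le> Re (cnj a * m + a * cnj m) + r" for a
      using assms psd_adj_nth[OF assms(1), of j i] by (simp add: m_def r_def)
    from this[of "- complex_of_real t * m" for t] have "0 \<le> - 2 * t * (cmod m)\<^sup>2 + r" for t
      unfolding cmod_power2 by (simp add: power2_eq_square algebra_simps)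
    from this[of "(r + 1) / (2 * (cmod m)\<^sup>2)"] have "m = 0"
      by (cases "m = 0") (simp_all add: field_simps)
    then show ?thesis
      by (simp add: m_def)
  qed (use assms in simp)
  then show "M $ j $ i = 0"
    using psd_adj_nth[OF assms(1), of j i] by simp
qed

lemma psd_trace:
  assumes "psd M"
  shows "trace M = complex_of_real (Re (trace M))" "0 \<le> Re (trace M)"
    and "Re (trace M) = 0 \<Longrightarrow> M = 0"
proof -
  show "trace M = complex_of_real (Re (trace M))" "0 \<le> Re (trace M)"
    using psd_diag[OF assms] by (auto simp: complex_eq_iff trace_def intro: sum_nonneg)
  assume "Re (trace M) = 0"
  then have "\<forall>i. Re (M $ i $ i) = 0"
    using psd_diag[OF assms] by (simp add: trace_def sum_nonneg_eq_0_iff)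
  then have "\<forall>i. M $ i $ i = 0"
    using psd_diag[OF assms] by (simp add: complex_eq_iff)
  then show "M = 0"
    unfolding vec_eq_iff using psd_zero_diag(1)[OF assms] by (metis zero_index)
qed

section \<open>Rank one matrices and rank one perturbations of the identity\<close>

definition outer :: "complex ^ 'm \<Rightarrow> complex ^ 'n \<Rightarrow> complex ^ 'n ^ 'm"
  where "outer v w = (\<chi> i j. v $ i * cnj (w $ j))"

lemma outer_nth [simp]: "outer v w $ i $ j = v $ i * cnj (w $ j)"
  by (simp add: outer_def)

lemma mult_outer: "A ** outer v w = outer (A *v v) w"
  and outer_mult: "outer v w ** B = outer v (B\<^sup>\<dagger> *v w)"
  by (simp_all add: vec_eq_iff matrix_mult_nth matrix_vector_mult_def sum_distrib_right mult.assoc)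
     (simp add: sum_distrib_left mult_ac)

lemma outer_mult_outer: "outer v w ** outer x y = cmat_scale (cdot w x) (outer v y)"
  by (simp add: outer_mult) (simp add: vec_eq_iff matrix_vector_mult_def cdot_def sum_distrib_left mult_ac)

lemma adj_outer [simp]: "(outer v w)\<^sup>\<dagger> = outer w v"
  by (simp add: vec_eq_iff)

lemma outer_mult_vec: "outer v w *v x = cdot w x *s v"
  by (simp add: vec_eq_iff matrix_vector_mult_def cdot_def sum_distrib_left mult_ac)

lemma trace_outer: "trace (outer v w) = cdot w v"
  by (simp add: trace_def cdot_def mult.commute)

lemma trace_mult_outer: "trace (A ** outer v w) = cdot w (A *v v)"
  by (simp add: mult_outer trace_outer)

text \<open>A complex Householder matrix: the identity on the orthogonal complement of
  \<open>v\<close>, and multiplication by \<open>- cnj c / c\<close> on \<open>v\<close>. Only the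
  real part of \<open>c\<close> is prescribed; the freedom in the imaginary part is exploited
  later.\<close>

lemma rank_one_perturbation_unitary:
  assumes c: "c \<noteq> 0" and norm: "(norm v)\<^sup>2 = 2 * Re c"
  shows "unitary_matrix (mat 1 - cmat_scale (1 / c) (outer v v))"
proof (rule unitaryI)
  define P where "P = outer v v"
  have "(mat 1 - cmat_scale (1 / c) P)\<^sup>\<dagger> = mat 1 - cmat_scale (1 / cnj c) P"
    by (simp add: P_def vec_eq_iff mat_def)
  moreover have PP: "P ** P = cmat_scale (c + cnj c) P"
    using norm by (simp add: P_def outer_mult_outer cdot_self complex_add_cnj)
  have "(mat 1 - cmat_scale a P) ** (mat 1 - cmat_scale b P) =
      mat 1 + cmat_scale (a * b * (c + cnj c) - a - b) P" for a b
  proof -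
    have "(mat 1 + cmat_scale (-a) P) ** (mat 1 + cmat_scale (-b) P) =
        mat 1 + cmat_scale (a * b * (c + cnj c) - a - b) P"
      by (simp add: matrix_mult_add_left matrix_mult_add_right PP)
         (simp add: vec_eq_iff algebra_simps)
    moreover have "mat 1 + cmat_scale (-a) P = mat 1 - cmat_scale a P" for a
      by (simp add: vec_eq_iff)
    ultimately show ?thesis by simp
  qed
  moreover have "1 / cnj c * (1 / c) * (c + cnj c) - 1 / cnj c - 1 / c = 0"
    using c by (simp add: field_simps)
  ultimately show "(mat 1 - cmat_scale (1 / c) (outer v v))\<^sup>\<dagger> ** (mat 1 - cmat_scale (1 / c) (outer v v)) = mat 1"
    unfolding P_def[symmetric] by simp
qed

text \<open>It suffices to vary \<open>Q\<close> over the rank one perturbations of the identity in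
  \<open>rank_one_perturbation_unitary\<close>.\<close>

lemma psd_if_trace_maximal:
  fixes M :: "complex ^ 'n ^ 'n"
  assumes max: "\<And>Q. unitary_matrix Q \<Longrightarrow> Re (trace (M ** Q)) \<le> Re (trace M)"
  shows "psd M"
  unfolding psd_def
proof
  fix v :: "complex ^ 'n"
  show "Im (cdot v (M *v v)) = 0 \<and> 0 \<le> Re (cdot v (M *v v))"
  proof (cases "v = 0")
    case False
    define q where "q = cdot v (M *v v)"
    define s where "s = (norm v)\<^sup>2 / 2"
    have s: "0 < s"
      using False by (simp add: s_def)
    have *: "0 \<le> Re ((1 / c) * q)" if "c \<noteq> 0" "Re c = s" for c
    proof -
      have "trace (M ** (mat 1 - cmat_scale (1 / c) (outer v v))) = trace M - (1 / c) * q"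
      proof -
        have *: "mat 1 - cmat_scale (1 / c) (outer v v) = mat 1 + cmat_scale (- (1 / c)) (outer v v)"
          by (simp add: vec_eq_iff)
        show ?thesis
          unfolding * by (simp add: matrix_mult_add_right trace_add trace_scale trace_mult_outer q_def)
      qed
      moreover have "unitary_matrix (mat 1 - cmat_scale (1 / c) (outer v v))"
        using that by (intro rank_one_perturbation_unitary) (auto simp: s_def)
      ultimately show ?thesis
        using max by fastforce
    qed
    \<comment> \<open>The imaginary part \<open>t\<close> of \<open>c\<close> is free, so this
      affine inequality holds for every \<open>t\<close> and forces \<open>Im q = 0\<close>.\<close>
    have **: "0 \<le> Re q * s + t * Im q" for t
    proof -
      have c0: "Complex s t \<noteq> 0"
        using s by (simp add: complex_eq_iff)
      have "Re ((1 / Complex s t) * q) = (Re q * s + t * Im q) / (s\<^sup>2 + t\<^sup>2)"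
        by (simp add: Re_divide field_simps)
      moreover have "0 < s\<^sup>2 + t\<^sup>2"
        using s by (simp add: sum_power2_gt_zero_iff)
      ultimately show ?thesis
        using *[OF c0] by (simp add: zero_le_divide_iff)
    qed
    have "0 \<le> Re q"
      using **[of 0] s by (simp add: zero_le_mult_iff)
    moreover have "Im q = 0"
      using **[of "- (Re q * s + 1) / Im q"] by (cases "Im q = 0") auto
    ultimately show ?thesis
      by (simp add: q_def)
  qed simp
qed

subsection \<open>Singular value decomposition\<close>

definition cdiag :: "('n \<Rightarrow> complex) \<Rightarrow> complex ^ 'n ^ 'n"
  where "cdiag d = (\<chi> i j. if i = j then d i else 0)"

abbreviation rdiag :: "('n \<Rightarrow> real) \<Rightarrow> complex ^ 'n ^ 'n"
  where "rdiag s \<equiv> cdiag (\<lambda>i. complex_of_real (s i))"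

lemma cdiag_nth: "cdiag d $ i $ j = (if i = j then d i else 0)"
  by (simp add: cdiag_def)

lemma cdiag_mult_nth [simp]: "(cdiag d ** A) $ i $ j = d i * A $ i $ j"
  and mult_cdiag_nth [simp]: "(A ** cdiag d) $ i $ j = A $ i $ j * d j"
  by (simp_all add: matrix_mult_nth cdiag_nth if_distrib [of "\<lambda>x. x * _"]
      if_distrib [of "\<lambda>x. _ * x"] cong: if_cong)

lemma cdiag_mult_cdiag [simp]: "cdiag d ** cdiag e = cdiag (\<lambda>i. d i * e i)"
  and adj_cdiag [simp]: "(cdiag d)\<^sup>\<dagger> = cdiag (\<lambda>i. cnj (d i))"
  and cdiag_one: "cdiag (\<lambda>i. 1) = mat 1"
  by (simp_all add: vec_eq_iff cdiag_nth mat_def)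

lemma cdiag_mult_vec [simp]: "(cdiag d *v v) $ i = d i * v $ i"
  by (simp add: matrix_vector_mult_def cdiag_nth if_distrib [of "\<lambda>x. x * _"] cong: if_cong)

lemma unitary_cdiag: "(\<And>i. cmod (d i) = 1) \<Longrightarrow> unitary_matrix (cdiag d)"
  by (rule unitaryI) (simp add: complex_norm_square[symmetric] mult.commute cdiag_one[symmetric])

lemma tendsto_matrix_mult:
  fixes A :: "'b \<Rightarrow> complex ^ 'm ^ 'n" and B :: "'b \<Rightarrow> complex ^ 'k ^ 'm"
  assumes "(A \<longlongrightarrow> a) F" "(B \<longlongrightarrow> b) F"
  shows "((\<lambda>x. A x ** B x) \<longlongrightarrow> a ** b) F"
  unfolding matrix_matrix_mult_def
  by (intro tendsto_vec_lambda tendsto_sum tendsto_mult tendsto_vec_nth assms)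

lemma tendsto_adj:
  fixes a :: "complex ^ 'm ^ 'n"
  assumes "(A \<longlongrightarrow> a) F"
  shows "((\<lambda>x. (A x)\<^sup>\<dagger>) \<longlongrightarrow> a\<^sup>\<dagger>) F"
proof -
  have "B\<^sup>\<dagger> = (\<chi> i j. cnj (B $ j $ i))" for B :: "complex ^ 'm ^ 'n"
    by (simp add: vec_eq_iff)
  then show ?thesis
    by (auto intro!: tendsto_vec_lambda tendsto_vec_nth tendsto_cnj assms)
qed

lemma unitary_norm_matrix:
  fixes U :: "complex ^ 'n ^ 'n"
  assumes "unitary_matrix U"
  shows "norm U = sqrt (CARD('n))"
  using assms by (simp add: norm_eq_sqrt_inner inner_matrix unitary_left trace_I)

lemma compact_unitary: "compact {U :: complex ^ 'n ^ 'n. unitary_matrix U}"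
  unfolding compact_eq_bounded_closed
proof
  show "bounded {U :: complex ^ 'n ^ 'n. unitary_matrix U}"
    by (rule boundedI[of _ "sqrt (CARD('n))"]) (simp add: unitary_norm_matrix)
  have "unitary_matrix l" if "\<And>n. unitary_matrix (f n)" "f \<longlonglongrightarrow> l" for f and l :: "complex ^ 'n ^ 'n"
  proof (rule unitaryI)
    have "(\<lambda>n. (f n)\<^sup>\<dagger> ** f n) \<longlonglongrightarrow> l\<^sup>\<dagger> ** l"
      by (intro tendsto_matrix_mult tendsto_adj that)
    moreover have "(\<lambda>n. (f n)\<^sup>\<dagger> ** f n) = (\<lambda>n. mat 1)"
      using that(1) by (simp add: unitary_left)
    ultimately show "l\<^sup>\<dagger> ** l = mat 1"
      by (simp add: LIMSEQ_const_iff)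
  qed
  then show "closed {U :: complex ^ 'n ^ 'n. unitary_matrix U}"
    unfolding closed_sequential_limits by blast
qed

text \<open>Hermitian symmetry of the two products gives two linear relations between
  \<open>B $ i $ j\<close> and \<open>B $ j $ i\<close>. Eliminating one entry multiplies the other
  by the difference of the squared weights, which is nonzero for distinct positive weights.\<close>

lemma diagonal_if_commute_psd:
  assumes inj: "inj w" and pos: "\<And>i. 0 < w i"
    and psd: "psd (rdiag w ** B)" "psd (B ** rdiag w)"
  obtains s where "\<And>i. 0 \<le> s i" "B = rdiag s"
proof -
  have off: "B $ i $ j = 0" if "i \<noteq> j" for i j
  proof -
    have 1: "w j * B $ j $ i = cnj (B $ i $ j) * w i"
      using psd_adj_nth[OF psd(1), of j i] by simp
    have 2: "B $ j $ i * w i = cnj (B $ i $ j) * w j"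
      using psd_adj_nth[OF psd(2), of j i] by simp
    have "w j * (B $ j $ i * w i) = (w j * B $ j $ i) * w i"
      by simp
    then have "cnj (B $ i $ j) * ((w j)\<^sup>2 - (w i)\<^sup>2) = 0"
      unfolding 1 2 by (simp add: power2_eq_square algebra_simps)
    moreover have "(w j)\<^sup>2 \<noteq> (w i)\<^sup>2"
      using pos[of i] pos[of j] inj that by (auto simp: inj_def)
    then have "(complex_of_real (w j))\<^sup>2 - (complex_of_real (w i))\<^sup>2 \<noteq> 0"
      by (metis eq_iff_diff_eq_0 of_real_eq_iff of_real_power)
    ultimately show ?thesis
      by simp
  qed
  show thesis
  proof (rule that)
    fix i
    have "0 \<le> w i * Re (B $ i $ i)" "w i * Im (B $ i $ i) = 0"
      using psd_diag[OF psd(1), of i] by simp_all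
    then show "0 \<le> Re (B $ i $ i)"
      using pos[of i] by (simp add: zero_le_mult_iff)
    show "B = rdiag (\<lambda>i. Re (B $ i $ i))"
    proof -
      have "Im (B $ i $ i) = 0" for i
        using psd_diag(1)[OF psd(1), of i] pos[of i] by simp
      then show ?thesis
        using off by (simp add: vec_eq_iff cdiag_nth complex_eq_iff)
    qed
  qed
qed

text \<open>If \<open>(U, V)\<close> maximises \<open>Re (trace (D ** U ** X ** V))\<close> over all unitary pairs, for a diagonal \<open>D\<close>
  with distinct positive entries, then the previous lemma applies to \<open>U ** X ** V\<close>.\<close>

lemma singular_value_decomposition:
  fixes X :: "complex ^ 'n ^ 'n"
  obtains U V s where "unitary_matrix U" "unitary_matrix V" "\<And>i. 0 \<le> s i" "X = U ** rdiag s ** V"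
proof -
  obtain f :: "'n \<Rightarrow> nat" where f: "inj f"
    using finite_imp_inj_to_nat_seg[OF finite_class.finite_UNIV] by blast
  \<comment> \<open>Any distinct positive weights serve; equal weights would leave blocks of
    \<open>B\<close> that need not be diagonal.\<close>
  define w where "w i = real (f i) + 1" for i
  have w: "inj w" "\<And>i. 0 < w i"
    using f by (auto simp: w_def inj_def)
  define K where "K = {U :: complex ^ 'n ^ 'n. unitary_matrix U}"
  define g where "g = (\<lambda>p. Re (trace (rdiag w ** (fst p ** X ** snd p))))"
  have "compact (K \<times> K)"
    unfolding K_def by (intro compact_Times compact_unitary)
  moreover have "K \<times> K \<noteq> {}"
    using unitary_one[where 'a='n] unfolding K_def by blast
  moreover have "continuous_on (K \<times> K) g"
    unfolding continuous_on_def g_def trace_def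
    by (intro ballI tendsto_Re tendsto_sum tendsto_vec_nth tendsto_matrix_mult tendsto_intros)
  ultimately obtain p where p: "p \<in> K \<times> K" "\<And>q. q \<in> K \<times> K \<Longrightarrow> g q \<le> g p"
    using continuous_attains_sup[of "K \<times> K" g] by blast
  obtain U V where UV: "p = (U, V)" "unitary_matrix U" "unitary_matrix V"
    using p(1) by (auto simp: K_def)
  have max: "Re (trace (rdiag w ** (U' ** X ** V'))) \<le> Re (trace (rdiag w ** (U ** X ** V)))"
    if "unitary_matrix U'" "unitary_matrix V'" for U' V'
    using p(2)[of "(U', V')"] that by (simp add: g_def UV(1) K_def)
  define B where "B = U ** X ** V"
  have "psd (rdiag w ** B)"
  proof (rule psd_if_trace_maximal)
    fix Q :: "complex ^ 'n ^ 'n" assume "unitary_matrix Q"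
    then have "unitary_matrix (V ** Q)"
      using UV by simp
    from max[OF UV(2) this] show "Re (trace (rdiag w ** B ** Q)) \<le> Re (trace (rdiag w ** B))"
      by (simp add: B_def matrix_mul_assoc)
  qed
  moreover have "psd (B ** rdiag w)"
  proof (rule psd_if_trace_maximal)
    fix Q :: "complex ^ 'n ^ 'n" assume "unitary_matrix Q"
    then have "unitary_matrix (Q ** U)"
      using UV by simp
    from max[OF this UV(3)] have "Re (trace (rdiag w ** (Q ** B))) \<le> Re (trace (rdiag w ** B))"
      by (simp add: B_def matrix_mul_assoc)
    moreover have "trace (rdiag w ** (Q ** B)) = trace (B ** rdiag w ** Q)"
      by (metis matrix_mul_assoc trace_mul_sym)
    moreover have "trace (rdiag w ** B) = trace (B ** rdiag w)"
      by (rule trace_mul_sym)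
    ultimately show "Re (trace (B ** rdiag w ** Q)) \<le> Re (trace (B ** rdiag w))"
      by simp
  qed
  ultimately obtain s where s: "\<And>i. 0 \<le> s i" "B = rdiag s"
    using diagonal_if_commute_psd[OF w] by metis
  have "X = U\<^sup>\<dagger> ** rdiag s ** V\<^sup>\<dagger>"
    using UV(2,3) by (simp add: s(2)[symmetric] B_def unitary_conj_inverse)
  then show thesis
    using that[of "U\<^sup>\<dagger>" "V\<^sup>\<dagger>" s] s UV by simp
qed

subsection \<open>The Ky Fan norm in terms of a singular value decomposition\<close>

text \<open>\<open>P\<close> embeds constant matrices multiplicatively into polynomial matrices,
  where the indeterminate times the identity is central, so the conjugation takes place inside the
  determinant.\<close>

lemma charpoly_unitary_similar:
  fixes A :: "complex ^ 'n ^ 'n"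
  assumes V: "unitary_matrix V"
  shows "charpoly (V\<^sup>\<dagger> ** A ** V) = charpoly A"
proof -
  define P where "P = (map_matrix (\<lambda>a. [:a:]) :: complex ^ 'n ^ 'n \<Rightarrow> _)"
  define X :: "complex poly ^ 'n ^ 'n" where "X = mat [:0, 1:]"
  have P_mult: "P (A ** B) = P A ** P B" for A B :: "complex ^ 'n ^ 'n"
  proof -
    have "[:\<Sum>i\<in>I. f i:] = (\<Sum>i\<in>I. [:f i:])" for f :: "'n \<Rightarrow> complex" and I
      by (simp add: poly_eq_iff coeff_sum coeff_pCons split: nat.split)
    then show ?thesis
      by (simp add: vec_eq_iff P_def matrix_matrix_mult_def mult.commute)
  qed
  have P_one: "P (mat 1) = mat 1"
    by (simp add: vec_eq_iff P_def mat_def)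
  have X_comm: "X ** B = B ** X" for B
    by (simp add: vec_eq_iff X_def matrix_matrix_mult_def mat_def mult.commute
        if_distrib [of "\<lambda>x. x * _"] if_distrib [of "\<lambda>x. _ * x"] cong: if_cong)
  have PV: "P (V\<^sup>\<dagger>) ** P V = mat 1"
    using V by (simp add: P_mult[symmetric] P_one unitary_left)
  have sub: "A ** (B - C) = A ** B - A ** C" "(B - C) ** A = B ** A - C ** A"
    for A B C :: "complex poly ^ 'n ^ 'n"
    by (simp_all add: vec_eq_iff matrix_matrix_mult_def algebra_simps sum_subtractf)
  have "P (V\<^sup>\<dagger>) ** (X - P A) ** P V = P (V\<^sup>\<dagger>) ** X ** P V - P (V\<^sup>\<dagger> ** A ** V)"
    by (simp add: sub P_mult)
  also have "P (V\<^sup>\<dagger>) ** X ** P V = X"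
    by (metis PV X_comm matrix_mul_assoc matrix_mul_rid)
  finally have *: "P (V\<^sup>\<dagger>) ** (X - P A) ** P V = X - P (V\<^sup>\<dagger> ** A ** V)" .
  have "charpoly (V\<^sup>\<dagger> ** A ** V) = det (P (V\<^sup>\<dagger>)) * det (P V) * det (X - P A)"
    unfolding charpoly_def P_def[symmetric] X_def[symmetric] *[symmetric] by (simp add: det_mul)
  also have "det (P (V\<^sup>\<dagger>)) * det (P V) = 1"
    unfolding det_mul[symmetric] PV by (rule det_I)
  finally show ?thesis
    by (simp add: charpoly_def P_def X_def)
qed

lemma charpoly_cdiag: "charpoly (cdiag d) = (\<Prod>i\<in>UNIV. [:- d i, 1:])"
  unfolding charpoly_def
  by (subst det_diagonal) (auto simp: cdiag_nth mat_def intro!: prod.cong)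

lemma singular_values_svd:
  fixes U :: "complex ^ 'n ^ 'n"
  assumes "unitary_matrix U" "unitary_matrix V" "\<And>i. 0 \<le> s i"
  shows "singular_values (U ** rdiag s ** V) =
    rev (sorted_list_of_multiset (image_mset s (mset_set UNIV)))"
proof -
  define X where "X = U ** rdiag s ** V"
  have "X\<^sup>\<dagger> ** X = V\<^sup>\<dagger> ** (rdiag s ** ((U\<^sup>\<dagger> ** (U ** rdiag s)))) ** V"
    by (simp add: X_def matrix_mul_assoc)
  also have "\<dots> = V\<^sup>\<dagger> ** rdiag (\<lambda>i. (s i)\<^sup>2) ** V"
    using assms(1) by (simp add: unitary_cancel power2_eq_square)
  finally have "charpoly (X\<^sup>\<dagger> ** X) = (\<Prod>i\<in>UNIV. [:- complex_of_real ((s i)\<^sup>2), 1:])"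
    by (simp add: charpoly_unitary_similar assms(2) charpoly_cdiag)
  then have "proots (charpoly (X\<^sup>\<dagger> ** X)) = (\<Sum>i\<in>UNIV. {#complex_of_real ((s i)\<^sup>2)#})"
    by (simp add: proots_prod)
  also have "\<dots> = image_mset (\<lambda>i. complex_of_real ((s i)\<^sup>2)) (mset_set UNIV)"
    by (simp add: sum_unfold_sum_mset)
  finally show ?thesis
    using assms(3) unfolding singular_values_def X_def[symmetric]
    by (simp add: multiset.map_comp comp_def)
qed

text \<open>An index set \<open>S\<close> replaces the sorted list of values because partial
  isometries are built from index sets. With repeated singular values such a set is not
  unique.\<close>

lemma ky_fan_norm_svd:
  fixes U :: "complex ^ 'n ^ 'n"
  assumes UV: "unitary_matrix U" "unitary_matrix V" and s: "\<And>i. 0 \<le> s i" and k: "k \<le> CARD('n)"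
  obtains S where "card S = k" "\<And>i j. i \<in> S \<Longrightarrow> j \<notin> S \<Longrightarrow> s j \<le> s i"
    "ky_fan_norm k (U ** rdiag s ** V) = sum s S"
proof -
  obtain xs :: "'n list" where xs: "set xs = UNIV" "distinct xs"
    using finite_distinct_list[OF finite_class.finite_UNIV] by blast
  \<comment> \<open>Sorting the indices by \<open>s\<close>, rather than the values, records which
    indices carry the largest ones.\<close>
  define ys where "ys = rev (sort_key s xs)"
  have ys: "set ys = UNIV" "distinct ys" "length ys = CARD('n)"
    using xs distinct_card[OF xs(2)] by (auto simp: ys_def)
  have "sort (map s xs) = map s (sort_key s xs)"
    by (rule properties_for_sort) simp_all
  moreover have "mset_set UNIV = mset xs"
    using xs by (metis mset_set_set)
  ultimately have sv: "singular_values (U ** rdiag s ** V) = map s ys"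
    using singular_values_svd[OF UV s] by (simp add: ys_def rev_map flip: mset_map)
  define S where "S = set (take k ys)"
  have "card S = k"
    using ys k by (simp add: S_def distinct_card)
  moreover have "s j \<le> s i" if "i \<in> S" "j \<notin> S" for i j
  proof -
    have "j \<in> set (drop k ys)"
      using that ys(1) by (metis S_def UNIV_I Un_iff append_take_drop_id set_append)
    moreover have "sorted_wrt (\<lambda>x y. s y \<le> s x) ys"
      unfolding ys_def sorted_wrt_rev using sorted_sort_key[of s xs] unfolding sorted_map .
    then have "sorted_wrt (\<lambda>x y. s y \<le> s x) (take k ys @ drop k ys)"
      by simp
    ultimately show ?thesis
      using that(1) unfolding sorted_wrt_append S_def by blast
  qed
  moreover have "ky_fan_norm k (U ** rdiag s ** V) = sum s S"
  proof -
    have "ky_fan_norm k (U ** rdiag s ** V) = (\<Sum>i<k. s (ys ! i))"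
      using k ys by (simp add: ky_fan_norm_def sv)
    also have "\<dots> = sum s ((!) ys ` {..<k})"
      using ys k by (subst sum.reindex) (auto intro!: inj_onI simp: nth_eq_iff_index_eq)
    also have "(!) ys ` {..<k} = S"
      using ys k nth_image[of k ys] by (simp add: S_def lessThan_atLeast0)
    finally show ?thesis .
  qed
  ultimately show thesis
    by (rule that)
qed

subsection \<open>Partial isometries and duality\<close>

definition proj :: "'n set \<Rightarrow> complex ^ 'n ^ 'n"
  where "proj S = cdiag (\<lambda>i. if i \<in> S then 1 else 0)"

text \<open>The rank is exactly \<open>k\<close>, even when a matrix of smaller rank is to be
  normed; such a matrix then has several norming \<open>F\<close>. In return all \<open>F\<close>
  have Frobenius norm \<open>sqrt k\<close>, so inner product \<open>k\<close> between two of them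
  means equality.\<close>

definition partial_isometries :: "nat \<Rightarrow> (complex ^ 'n ^ 'n) set"
  where "partial_isometries k =
    {U ** proj S ** V | U S V. unitary_matrix U \<and> unitary_matrix V \<and> card S = k}"

lemma proj_nth: "proj S $ i $ j = (if i = j \<and> i \<in> S then 1 else 0)"
  by (simp add: proj_def cdiag_nth)

lemma proj_mult_nth [simp]: "(proj S ** A) $ i $ j = (if i \<in> S then A $ i $ j else 0)"
  and mult_proj_nth [simp]: "(A ** proj S) $ i $ j = (if j \<in> S then A $ i $ j else 0)"
  and proj_mult_vec [simp]: "(proj S *v v) $ i = (if i \<in> S then v $ i else 0)"
  by (simp_all add: proj_def)

lemma adj_proj [simp]: "(proj S)\<^sup>\<dagger> = proj S"
  and proj_mult_proj [simp]: "proj S ** proj S = proj S"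
  by (simp_all add: vec_eq_iff proj_nth)

lemma permutation_unitary:
  fixes p :: "'n::finite \<Rightarrow> 'n"
  assumes "bij p"
  obtains P where "unitary_matrix P" "\<And>S. P ** proj S = proj (p ` S) ** P"
proof -
  define P :: "complex ^ 'n ^ 'n" where "P = (\<chi> i j. if i = p j then 1 else 0)"
  have inj: "p i = p j \<longleftrightarrow> i = j" for i j
    using assms by (auto simp: bij_def inj_def)
  show thesis
  proof (rule that[of P])
    show "unitary_matrix P"
      by (rule unitaryI) (simp add: vec_eq_iff matrix_mult_nth P_def mat_def inj
          if_distrib [of cnj] if_distrib [of "\<lambda>x. x * _"] cong: if_cong)
    show "P ** proj S = proj (p ` S) ** P" for S
      by (auto simp: vec_eq_iff P_def inj image_iff)
  qed
qed

text \<open>Index sets of equal size differ by a permutation matrix, which the unitary factors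
  absorb. Hence two partial isometries can be reduced to the same \<open>proj S\<close>.\<close>

lemma partial_isometryE:
  fixes F :: "complex ^ 'n ^ 'n"
  assumes "F \<in> partial_isometries k" "card S = k"
  obtains U V where "unitary_matrix U" "unitary_matrix V" "F = U ** proj S ** V"
proof -
  obtain U V S' where F: "unitary_matrix U" "unitary_matrix V" "F = U ** proj S' ** V" "card S' = k"
    using assms(1) by (auto simp: partial_isometries_def)
  obtain p where p: "bij p" "p ` S = S'"
  proof -
    obtain f where f: "bij_betw f S S'"
      using F(4) assms(2) by (metis finite_class.finite finite_same_card_bij)
    have "card (- S) = card (- S')"
      using F(4) assms(2) by (simp add: Compl_eq_Diff_UNIV card_Diff_subset)
    then obtain g where g: "bij_betw g (- S) (- S')"
      by (metis finite_class.finite finite_same_card_bij)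
    define p where "p i = (if i \<in> S then f i else g i)" for i
    have "bij_betw p (S \<union> - S) (S' \<union> - S')"
      unfolding p_def by (rule bij_betw_disjoint_Un[OF f g]) auto
    moreover have "p ` S = S'"
      using f by (auto simp: p_def bij_betw_def)
    ultimately show thesis
      using that by simp
  qed
  obtain P where P: "unitary_matrix P" "\<And>S. P ** proj S = proj (p ` S) ** P"
    by (rule permutation_unitary[OF p(1)]) blast
  have "F = (U ** P) ** proj S ** (P\<^sup>\<dagger> ** V)"
  proof -
    have "(U ** P) ** proj S ** (P\<^sup>\<dagger> ** V) = U ** (P ** proj S) ** P\<^sup>\<dagger> ** V"
      by (simp add: matrix_mul_assoc)
    also have "\<dots> = U ** ((proj S' ** P) ** P\<^sup>\<dagger>) ** V"
      by (simp only: P(2) p(2) matrix_mul_assoc)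
    also have "\<dots> = F"
      by (simp only: unitary_cancel(3)[OF P(1)] F(3))
    finally show ?thesis by simp
  qed
  then show thesis
    using that[of "U ** P" "P\<^sup>\<dagger> ** V"] F P by simp
qed

lemma proj_in_partial_isometries [simp]: "card S = k \<Longrightarrow> proj S \<in> partial_isometries k"
  unfolding partial_isometries_def
  by (rule CollectI, rule exI[of _ "mat 1"], rule exI[of _ S], rule exI[of _ "mat 1"]) simp

lemma partial_isometries_unitary:
  assumes "F \<in> partial_isometries k" "unitary_matrix U" "unitary_matrix V"
  shows "U ** F ** V \<in> partial_isometries k"
proof -
  obtain U' V' S where "unitary_matrix U'" "unitary_matrix V'" "F = U' ** proj S ** V'" "card S = k"
    using assms(1) by (auto simp: partial_isometries_def)
  then have "U ** F ** V = (U ** U') ** proj S ** (V' ** V)" "unitary_matrix (U ** U')"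
    "unitary_matrix (V' ** V)" "card S = k"
    using assms by (simp_all add: matrix_mul_assoc)
  then show ?thesis
    unfolding partial_isometries_def by blast
qed

lemma partial_isometries_adj:
  assumes "F \<in> partial_isometries k"
  shows "F\<^sup>\<dagger> \<in> partial_isometries k"
proof -
  obtain U V S where "unitary_matrix U" "unitary_matrix V" "F = U ** proj S ** V" "card S = k"
    using assms(1) by (auto simp: partial_isometries_def)
  then have "F\<^sup>\<dagger> = V\<^sup>\<dagger> ** proj S ** U\<^sup>\<dagger>" "unitary_matrix (U\<^sup>\<dagger>)" "unitary_matrix (V\<^sup>\<dagger>)" "card S = k"
    by (simp_all add: matrix_mul_assoc)
  then show ?thesis
    unfolding partial_isometries_def by blast
qed

lemma unitary_scale: "cmod c = 1 \<Longrightarrow> unitary_matrix U \<Longrightarrow> unitary_matrix (cmat_scale c U)"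
  by (rule unitaryI) (simp add: unitary_left complex_norm_square[symmetric] mult.commute)

lemma inner_proj_proj: "inner (proj S) (proj S) = real (card S)"
proof -
  have "trace (proj S) = of_nat (card S)"
    by (simp add: trace_def proj_nth sum.If_cases)
  then show ?thesis
    by (simp add: inner_matrix)
qed

lemma partial_isometry_inner_self:
  assumes "F \<in> partial_isometries k"
  shows "inner F F = real k"
proof -
  obtain U V S where F: "unitary_matrix U" "unitary_matrix V" "F = U ** proj S ** V" "card S = k"
    using assms(1) by (auto simp: partial_isometries_def)
  have "inner F F = inner (proj S) (U\<^sup>\<dagger> ** (U ** proj S ** V) ** V\<^sup>\<dagger>)"
    unfolding F(3) by (rule unitary_inner[OF F(1,2)])
  then show ?thesis
    using F by (simp add: unitary_conj_inverse inner_proj_proj)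
qed

lemma partial_isometry_norm: "F \<in> partial_isometries k \<Longrightarrow> norm F = sqrt k"
  by (simp add: norm_eq_sqrt_inner partial_isometry_inner_self)

lemma norm_proj_le: "norm (proj S *v v) \<le> norm v"
  unfolding norm_vec_def by (rule L2_set_mono) auto

lemma partial_isometry_contraction:
  assumes "F \<in> partial_isometries k"
  shows "norm (F *v v) \<le> norm v"
proof -
  obtain U V S where F: "unitary_matrix U" "unitary_matrix V" "F = U ** proj S ** V" "card S = k"
    using assms(1) by (auto simp: partial_isometries_def)
  have "norm (F *v v) = norm (proj S *v (V *v v))"
    using F by (simp add: unitary_norm flip: matrix_vector_mul_assoc)
  also have "\<dots> \<le> norm v"
    using norm_proj_le[of S "V *v v"] F by (simp add: unitary_norm)
  finally show ?thesis .
qed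

lemma unitary_row_sum:
  assumes "unitary_matrix U"
  shows "(\<Sum>j\<in>UNIV. (cmod (U $ i $ j))\<^sup>2) = 1"
proof -
  have "(U ** U\<^sup>\<dagger>) $ i $ i = 1"
    using assms by (simp add: unitary_right mat_def)
  then have "complex_of_real (\<Sum>j\<in>UNIV. (cmod (U $ i $ j))\<^sup>2) = 1"
    by (simp only: of_real_sum complex_norm_square) (simp add: matrix_mult_nth)
  then show ?thesis
    by (simp only: of_real_eq_1_iff)
qed

lemma unitary_column_sum:
  assumes "unitary_matrix U"
  shows "(\<Sum>i\<in>UNIV. (cmod (U $ i $ j))\<^sup>2) = 1"
  using unitary_row_sum[of "U\<^sup>\<dagger>" j] assms by simp

text \<open>Each product \<open>U $ i $ j * V $ j $ i\<close> is at most the mean of the two squared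
  moduli. Rows and columns of unitary matrices have length one, so summing over \<open>j\<close>
  gives the first bound and summing over \<open>i\<close> first gives \<open>card S\<close>.\<close>

lemma partial_isometry_diag:
  assumes "F \<in> partial_isometries k"
  shows "cmod (F $ i $ i) \<le> 1" "(\<Sum>i\<in>UNIV. cmod (F $ i $ i)) \<le> k"
proof -
  obtain U V S where F: "unitary_matrix U" "unitary_matrix V" "F = U ** proj S ** V" "card S = k"
    using assms(1) by (auto simp: partial_isometries_def)
  have bound: "cmod (F $ i $ i) \<le> (\<Sum>j\<in>S. ((cmod (U $ i $ j))\<^sup>2 + (cmod (V $ j $ i))\<^sup>2) / 2)" for i
  proof -
    have "F $ i $ i = (\<Sum>j\<in>UNIV. (if j \<in> S then U $ i $ j * V $ j $ i else 0))"
      unfolding F(3) matrix_mult_nth[of "U ** proj S"] by (rule sum.cong) auto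
    also have "\<dots> = (\<Sum>j\<in>S. U $ i $ j * V $ j $ i)"
      by (simp add: sum.If_cases)
    also have "cmod \<dots> \<le> (\<Sum>j\<in>S. ((cmod (U $ i $ j))\<^sup>2 + (cmod (V $ j $ i))\<^sup>2) / 2)"
    proof (rule sum_norm_le)
      fix j
      have "0 \<le> (cmod (U $ i $ j) - cmod (V $ j $ i))\<^sup>2"
        by simp
      then show "cmod (U $ i $ j * V $ j $ i) \<le> ((cmod (U $ i $ j))\<^sup>2 + (cmod (V $ j $ i))\<^sup>2) / 2"
        by (simp add: norm_mult power2_diff)
    qed
    finally show ?thesis .
  qed
  have "(\<Sum>j\<in>S. ((cmod (U $ i $ j))\<^sup>2 + (cmod (V $ j $ i))\<^sup>2) / 2) \<le>
      (\<Sum>j\<in>UNIV. ((cmod (U $ i $ j))\<^sup>2 + (cmod (V $ j $ i))\<^sup>2) / 2)"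
    by (rule sum_mono2) auto
  also have "\<dots> = 1"
    using F by (simp add: sum.distrib unitary_row_sum unitary_column_sum flip: sum_divide_distrib)
  finally show "cmod (F $ i $ i) \<le> 1"
    using bound[of i] by simp
  have "(\<Sum>i\<in>UNIV. cmod (F $ i $ i)) \<le>
      (\<Sum>i\<in>UNIV. \<Sum>j\<in>S. ((cmod (U $ i $ j))\<^sup>2 + (cmod (V $ j $ i))\<^sup>2) / 2)"
    by (rule sum_mono) (rule bound)
  also have "\<dots> = (\<Sum>j\<in>S. \<Sum>i\<in>UNIV. ((cmod (U $ i $ j))\<^sup>2 + (cmod (V $ j $ i))\<^sup>2) / 2)"
    by (rule sum.swap)
  also have "\<dots> = k"
    using F by (simp add: sum.distrib unitary_row_sum unitary_column_sum flip: sum_divide_distrib)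
  finally show "(\<Sum>i\<in>UNIV. cmod (F $ i $ i)) \<le> k" .
qed

lemma inner_rdiag: "inner F (rdiag s) = (\<Sum>i\<in>UNIV. s i * Re (F $ i $ i))"
  by (simp add: inner_matrix trace_def mult.commute)

text \<open>Meant for weights \<open>g\<close> in \<open>[0, 1]\<close> of sum at most
  \<open>k\<close> and a \<open>t \<ge> 0\<close> separating the values on \<open>S\<close> from the
  others. Every term on the right is then nonnegative, which proves an inequality and, in the case
  of equality, makes each term vanish.\<close>

lemma sum_split_threshold:
  fixes s g :: "'n::finite \<Rightarrow> real"
  assumes "card S = k"
  shows "sum s S - (\<Sum>i\<in>UNIV. s i * g i) =
    (\<Sum>i\<in>UNIV. if i \<in> S then (s i - t) * (1 - g i) else (t - s i) * g i) + t * (k - sum g UNIV)"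
proof -
  have *: "(\<Sum>i\<in>UNIV. if i \<in> S then 1 else 0) = real k" "(\<Sum>i\<in>UNIV. if i \<in> S then s i else 0) = sum s S"
    using assms by (simp_all add: sum.If_cases)
  have "(if i \<in> S then (s i - t) * (1 - g i) else (t - s i) * g i) =
      (if i \<in> S then s i else 0) - t * (if i \<in> S then 1 else 0) - s i * g i + t * g i" for i
    by (simp add: algebra_simps)
  then have "(\<Sum>i\<in>UNIV. if i \<in> S then (s i - t) * (1 - g i) else (t - s i) * g i) =
      sum s S - t * k - (\<Sum>i\<in>UNIV. s i * g i) + t * sum g UNIV"
    by (simp only: sum.distrib sum_subtractf sum_distrib_left[symmetric] *)
  then show ?thesis
    by (simp add: algebra_simps)
qed

lemma threshold_exists:
  fixes s :: "'n::finite \<Rightarrow> real"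
  assumes "S \<noteq> {}" "\<And>i j. i \<in> S \<Longrightarrow> j \<notin> S \<Longrightarrow> s j \<le> s i"
  obtains t where "t \<in> s ` S" "\<And>i. i \<in> S \<Longrightarrow> t \<le> s i" "\<And>j. j \<notin> S \<Longrightarrow> s j \<le> t"
proof (rule that[of "Min (s ` S)"])
  show "Min (s ` S) \<in> s ` S"
    using assms(1) by (intro Min_in) auto
  then show "\<And>j. j \<notin> S \<Longrightarrow> s j \<le> Min (s ` S)"
    using assms(2) by auto
qed simp

text \<open>The parameter \<open>index_type\<close> only pins down the type \<open>'n\<close>.\<close>

locale ky_fan =
  fixes k :: nat and index_type :: "'n::finite itself"
  assumes k_gt_1: "1 < k" and k_le: "k \<le> CARD('n)"
begin

abbreviation N :: "complex ^ 'n ^ 'n \<Rightarrow> real"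
  where "N \<equiv> ky_fan_norm k"

definition normed_by :: "complex ^ 'n ^ 'n \<Rightarrow> complex ^ 'n ^ 'n \<Rightarrow> bool"
  where "normed_by F X \<longleftrightarrow> F \<in> partial_isometries k \<and> inner F X = N X"

lemma svd_top:
  fixes X :: "complex ^ 'n ^ 'n"
  obtains U V s S t where "unitary_matrix U" "unitary_matrix V" "\<And>i. 0 \<le> s i"
    "X = U ** rdiag s ** V" "card S = k" "N X = sum s S" "0 \<le> t" "t \<in> s ` S"
    "\<And>i. i \<in> S \<Longrightarrow> t \<le> s i" "\<And>j. j \<notin> S \<Longrightarrow> s j \<le> t"
proof -
  obtain U V s where X: "unitary_matrix U" "unitary_matrix V" "\<And>i. 0 \<le> s i" "X = U ** rdiag s ** V"
    by (rule singular_value_decomposition[of X]) blast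
  obtain S where S: "card S = k" "\<And>i j. i \<in> S \<Longrightarrow> j \<notin> S \<Longrightarrow> s j \<le> s i" "N X = sum s S"
    by (rule ky_fan_norm_svd[where s=s, OF X(1,2,3) k_le, folded X(4)]) blast
  have "S \<noteq> {}"
    using S(1) k_gt_1 by auto
  then obtain t where t: "t \<in> s ` S" "\<And>i. i \<in> S \<Longrightarrow> t \<le> s i" "\<And>j. j \<notin> S \<Longrightarrow> s j \<le> t"
    using threshold_exists[of S s thesis] S(2) by blast
  moreover have "0 \<le> t"
    using t(1) X(3) by auto
  ultimately show thesis
    using that[OF X S(1,3)] by simp
qed

lemma inner_unitary_rdiag:
  assumes "F \<in> partial_isometries k" "unitary_matrix U" "unitary_matrix V"
  shows "U\<^sup>\<dagger> ** F ** V\<^sup>\<dagger> \<in> partial_isometries k"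
    and "inner F (U ** X ** V) = inner (U\<^sup>\<dagger> ** F ** V\<^sup>\<dagger>) X"
  using assms unitary_inner[OF assms(2,3), of X F]
  by (simp_all add: partial_isometries_unitary inner_commute)

text \<open>After rotation to a diagonal matrix only the diagonal of \<open>G\<close> counts. Its
  moduli lie in \<open>[0, 1]\<close> with sum at most \<open>k\<close>, so nothing beats full
  weight on the \<open>k\<close> largest singular values.\<close>

lemma inner_le_N:
  assumes F: "F \<in> partial_isometries k"
  shows "inner F X \<le> N X"
proof -
  obtain U V s S t where X: "unitary_matrix U" "unitary_matrix V" "\<And>i. 0 \<le> s i"
    "X = U ** rdiag s ** V" "card S = k" "N X = sum s S" "0 \<le> t" "t \<in> s ` S"
    "\<And>i. i \<in> S \<Longrightarrow> t \<le> s i" "\<And>j. j \<notin> S \<Longrightarrow> s j \<le> t"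
    by (rule svd_top[of X]) blast
  define G where "G = U\<^sup>\<dagger> ** F ** V\<^sup>\<dagger>"
  have G: "G \<in> partial_isometries k" "inner F X = inner G (rdiag s)"
    using inner_unitary_rdiag[OF F X(1,2)] by (simp_all add: G_def X(4))
  have "inner F X \<le> (\<Sum>i\<in>UNIV. s i * cmod (G $ i $ i))"
    unfolding G(2) inner_rdiag by (intro sum_mono mult_left_mono X(3) complex_Re_le_cmod)
  also have "\<dots> \<le> sum s S"
  proof -
    have "0 \<le> (\<Sum>i\<in>UNIV. if i \<in> S then (s i - t) * (1 - cmod (G $ i $ i)) else (t - s i) * cmod (G $ i $ i))"
      using X(9,10) partial_isometry_diag(1)[OF G(1)] by (intro sum_nonneg) simp
    moreover have "0 \<le> t * (k - (\<Sum>i\<in>UNIV. cmod (G $ i $ i)))"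
      using partial_isometry_diag(2)[OF G(1)] X(7) by simp
    ultimately show ?thesis
      using sum_split_threshold[OF X(5), of s "\<lambda>i. cmod (G $ i $ i)" t] by simp
  qed
  finally show ?thesis
    by (simp add: X(6))
qed

lemma ex_normed_by: "\<exists>F. normed_by F X"
proof -
  obtain U V s S t where X: "unitary_matrix U" "unitary_matrix V" "\<And>i. 0 \<le> s i"
    "X = U ** rdiag s ** V" "card S = k" "N X = sum s S" "0 \<le> t" "t \<in> s ` S"
    "\<And>i. i \<in> S \<Longrightarrow> t \<le> s i" "\<And>j. j \<notin> S \<Longrightarrow> s j \<le> t"
    by (rule svd_top[of X]) blast
  have "inner (U ** proj S ** V) X = inner (proj S) (rdiag s)"
    using X by (simp add: unitary_inner unitary_conj_inverse)
  also have "\<dots> = sum s S"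
    by (simp add: inner_rdiag proj_nth if_distrib [of Re] if_distrib [of "\<lambda>x. _ * x"] sum.If_cases cong: if_cong)
  finally have "normed_by (U ** proj S ** V) X"
    using X by (simp add: normed_by_def partial_isometries_unitary)
  then show ?thesis ..
qed

text \<open>If \<open>G\<close> norms a diagonal matrix whose \<open>k\<close>-th largest entry \<open>t\<close> is positive, then all
  inequalities in the proof of \<open>inner_le_N\<close> are equalities.\<close>

lemma normed_by_rdiag_trace:
  assumes "normed_by G (rdiag s)" and s: "\<And>i. 0 \<le> s i" and S: "card S = k" "N (rdiag s) = sum s S"
    and t: "0 < t" "\<And>i. i \<in> S \<Longrightarrow> t \<le> s i" "\<And>j. j \<notin> S \<Longrightarrow> s j \<le> t"
  shows "(\<Sum>i\<in>UNIV. Re (G $ i $ i)) = k" "\<And>j. s j < t \<Longrightarrow> G $ j $ j = 0"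
proof -
  have G: "G \<in> partial_isometries k" "(\<Sum>i\<in>UNIV. s i * Re (G $ i $ i)) = sum s S"
    using assms(1) by (simp_all add: normed_by_def inner_rdiag S(2))
  define g where "g i = cmod (G $ i $ i)" for i
  have g: "0 \<le> g i" "g i \<le> 1" "Re (G $ i $ i) \<le> g i" for i
    using partial_isometry_diag(1)[OF G(1)] by (simp_all add: g_def complex_Re_le_cmod)
  have gk: "sum g UNIV \<le> k"
    using partial_isometry_diag(2)[OF G(1)] by (simp add: g_def)
  define f where "f i = (if i \<in> S then (s i - t) * (1 - g i) else (t - s i) * g i)" for i
  have f: "0 \<le> f i" for i
    using g(1,2)[of i] t(2,3)[of i] by (simp add: f_def)
  have le: "(\<Sum>i\<in>UNIV. s i * Re (G $ i $ i)) \<le> (\<Sum>i\<in>UNIV. s i * g i)"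
    by (intro sum_mono mult_left_mono s g)
  have split: "sum s S - (\<Sum>i\<in>UNIV. s i * g i) = sum f UNIV + t * (k - sum g UNIV)"
    unfolding f_def by (rule sum_split_threshold[OF S(1)])
  have "0 \<le> sum f UNIV" "0 \<le> t * (k - sum g UNIV)"
    using f gk t(1) by (simp_all add: sum_nonneg)
  then have eq: "sum f UNIV = 0" "t * (k - sum g UNIV) = 0"
    "(\<Sum>i\<in>UNIV. s i * Re (G $ i $ i)) = (\<Sum>i\<in>UNIV. s i * g i)"
    using split le G(2) by linarith+
  have f0: "f i = 0" for i
    using eq(1) f by (simp add: sum_nonneg_eq_0_iff)
  show small: "G $ j $ j = 0" if "s j < t" for j
    using f0[of j] that t(2)[of j] by (auto simp: f_def g_def split: if_splits)
  have "Re (G $ i $ i) = g i" for i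
  proof (cases "s i < t")
    case True
    then show ?thesis
      using small[of i] by (simp add: g_def)
  next
    case False
    have "(\<Sum>i\<in>UNIV. s i * (g i - Re (G $ i $ i))) = 0"
      using eq(3) by (simp add: algebra_simps sum_subtractf)
    then have "s i * (g i - Re (G $ i $ i)) = 0"
      using s g by (subst (asm) sum_nonneg_eq_0_iff) auto
    then show ?thesis
      using False t(1) by simp
  qed
  then show "(\<Sum>i\<in>UNIV. Re (G $ i $ i)) = k"
    using eq(2) t(1) by simp
qed

section \<open>The Ky Fan norm as a continuous, unitarily invariant norm\<close>

lemma N_eq: "normed_by F X \<Longrightarrow> inner F X = N X"
  and normed_by_in: "normed_by F X \<Longrightarrow> F \<in> partial_isometries k"
  by (simp_all add: normed_by_def)

lemma normed_by_add:
  assumes "normed_by F (A + B)"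
  shows "N (A + B) \<le> N A + N B" "N (A + B) = N A + N B \<Longrightarrow> normed_by F A \<and> normed_by F B"
proof -
  have F: "F \<in> partial_isometries k" "inner F A + inner F B = N (A + B)"
    using assms by (simp_all add: normed_by_def inner_add_right)
  show "N (A + B) \<le> N A + N B" "N (A + B) = N A + N B \<Longrightarrow> normed_by F A \<and> normed_by F B"
    using F inner_le_N[OF F(1), of A] inner_le_N[OF F(1), of B] by (auto simp: normed_by_def)
qed

lemma N_triangle: "N (A + B) \<le> N A + N B"
  using ex_normed_by[of "A + B"] normed_by_add(1) by blast

lemma normed_by_sum:
  assumes "normed_by F A" "normed_by F B"
  shows "normed_by F (A + B)" "N (A + B) = N A + N B"
proof -
  have "inner F (A + B) = N A + N B" "inner F (A + B) \<le> N (A + B)"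
    using assms inner_le_N[OF normed_by_in[OF assms(1)], of "A + B"]
    by (simp_all add: normed_by_def inner_add_right)
  then show "normed_by F (A + B)" "N (A + B) = N A + N B"
    using N_triangle[of A B] normed_by_in[OF assms(1)] by (auto simp: normed_by_def)
qed

lemma N_unitary:
  assumes U: "unitary_matrix U" and V: "unitary_matrix V"
  shows "N (U ** X ** V) = N X"
proof -
  have le: "N X \<le> N (U ** X ** V)" if "unitary_matrix U" "unitary_matrix V" for U V X
  proof -
    obtain F where F: "normed_by F X"
      using ex_normed_by by blast
    have "N X = inner (U ** F ** V) (U ** X ** V)"
      using that F by (simp add: unitary_inner unitary_conj_inverse N_eq)
    also have "\<dots> \<le> N (U ** X ** V)"
      using normed_by_in[OF F] that by (intro inner_le_N partial_isometries_unitary)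
    finally show ?thesis .
  qed
  show ?thesis
    using le[OF U V, of X] le[of "U\<^sup>\<dagger>" "V\<^sup>\<dagger>" "U ** X ** V"] U V by (simp add: unitary_conj_inverse)
qed

lemma normed_by_unitary:
  assumes "normed_by F X" "unitary_matrix U" "unitary_matrix V"
  shows "normed_by (U ** F ** V) (U ** X ** V)"
  using assms by (simp add: normed_by_def partial_isometries_unitary N_unitary unitary_inner unitary_conj_inverse)

lemma N_rotate: "cmod c = 1 \<Longrightarrow> N (cmat_scale c X) = N X"
  using N_unitary[of "cmat_scale c (mat 1)" "mat 1" X] by (simp add: unitary_scale)

lemma N_scaleR: "0 \<le> r \<Longrightarrow> N (cmat_scale (complex_of_real r) X) = r * N X"
  and normed_by_scaleR: "0 \<le> r \<Longrightarrow> normed_by F X \<Longrightarrow> normed_by F (cmat_scale (complex_of_real r) X)"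
proof -
  assume r: "0 \<le> r"
  have 1: "r * N X \<le> N (cmat_scale (complex_of_real r) X)" if "normed_by F X" for F X
    using inner_le_N[of F "cmat_scale (complex_of_real r) X"] that
    by (simp add: normed_by_def flip: scaleR_matrix_eq)
  have 2: "N (cmat_scale (complex_of_real r) X) \<le> r * N X" for X
  proof -
    obtain F where "normed_by F (cmat_scale (complex_of_real r) X)"
      using ex_normed_by by blast
    then have "N (cmat_scale (complex_of_real r) X) = r * inner F X" "F \<in> partial_isometries k"
      by (auto simp: normed_by_def simp flip: scaleR_matrix_eq)
    then show ?thesis
      using inner_le_N r by (simp add: mult_left_mono)
  qed
  show eq: "N (cmat_scale (complex_of_real r) X) = r * N X"
    using 1 2 ex_normed_by by (metis order_antisym)
  show "normed_by F X \<Longrightarrow> normed_by F (cmat_scale (complex_of_real r) X)"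
    using eq by (simp add: normed_by_def flip: scaleR_matrix_eq)
qed

lemma N_scale: "N (cmat_scale c X) = cmod c * N X"
proof -
  have "c = complex_of_real (cmod c) * (if c = 0 then 1 else c / cmod c)"
    by simp
  then have "cmat_scale c X = cmat_scale (complex_of_real (cmod c)) (cmat_scale (if c = 0 then 1 else c / cmod c) X)"
    by (metis scale_scale)
  moreover have "cmod (if c = 0 then 1 else c / cmod c) = 1"
    by (simp add: norm_divide)
  ultimately show ?thesis
    by (metis N_scaleR N_rotate norm_ge_zero)
qed

lemma N_zero [simp]: "N 0 = 0"
  using N_scale[of 0 0] by simp

lemma N_nonneg: "0 \<le> N X"
  using N_triangle[of X "- X"] N_scale[of "-1" X] by (simp add: scale_minus_one)

lemma N_eq_0_iff [simp]: "N X = 0 \<longleftrightarrow> X = 0"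
proof
  assume *: "N X = 0"
  obtain U V s S t where X: "unitary_matrix U" "unitary_matrix V" "\<And>i. 0 \<le> s i"
    "X = U ** rdiag s ** V" "card S = k" "N X = sum s S" "0 \<le> t" "t \<in> s ` S"
    "\<And>i. i \<in> S \<Longrightarrow> t \<le> s i" "\<And>j. j \<notin> S \<Longrightarrow> s j \<le> t"
    by (rule svd_top[of X]) blast
  have S: "s i = 0" if "i \<in> S" for i
    using * X(3,6) that by (simp add: sum_nonneg_eq_0_iff)
  then have "s j = 0" for j
    using X(3)[of j] X(8) X(10)[of j] by fastforce
  then have "rdiag s = 0"
    by (simp add: vec_eq_iff cdiag_nth)
  then show "X = 0"
    by (simp add: X(4))
qed simp

lemma N_le_norm: "N X \<le> sqrt k * norm X"
proof -
  obtain F where "normed_by F X"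
    using ex_normed_by by blast
  then show ?thesis
    using norm_cauchy_schwarz[of F X] by (auto simp: normed_by_def partial_isometry_norm)
qed

lemma tendsto_N:
  assumes "(f \<longlongrightarrow> X) G"
  shows "((\<lambda>x. N (f x)) \<longlongrightarrow> N X) G"
proof (rule LIM_zero_cancel)
  have "N A - N B \<le> sqrt k * norm (A - B)" for A B
    using N_triangle[of "A - B" B] N_le_norm[of "A - B"] by simp
  from this[of "f x" X for x] this[of X "f x" for x]
  have "norm (N (f x) - N X) \<le> sqrt k * norm (f x - X)" for x
    by (simp add: abs_le_iff norm_minus_commute)
  moreover have "((\<lambda>x. sqrt k * norm (f x - X)) \<longlongrightarrow> 0) G"
    using assms by (intro tendsto_mult_right_zero tendsto_norm_zero) (simp add: LIM_zero)
  ultimately show "((\<lambda>x. N (f x) - N X) \<longlongrightarrow> 0) G"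
    by (rule Lim_null_comparison[OF always_eventually[OF allI]])
qed

text \<open>Multiplying \<open>F\<close> by a unitary matrix on either side gives another partial
  isometry of rank \<open>k\<close>, so \<open>F\<close> is a maximiser among these and
  \<open>psd_if_trace_maximal\<close> applies on both sides.\<close>

lemma normed_by_psd:
  assumes "normed_by F X"
  shows "psd (F\<^sup>\<dagger> ** X)" "psd (X ** F\<^sup>\<dagger>)"
proof -
  have max: "inner (U ** F ** V) X \<le> inner F X" if "unitary_matrix U" "unitary_matrix V" for U V
    using assms that unfolding normed_by_def by (metis inner_le_N partial_isometries_unitary)
  show "psd (F\<^sup>\<dagger> ** X)"
  proof (rule psd_if_trace_maximal)
    fix Q :: "complex ^ 'n ^ 'n" assume Q: "unitary_matrix Q"
    have "inner (mat 1 ** F ** Q\<^sup>\<dagger>) X \<le> inner F X"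
      using Q by (intro max) auto
    moreover have "inner (mat 1 ** F ** Q\<^sup>\<dagger>) X = Re (trace (F\<^sup>\<dagger> ** X ** Q))"
      by (simp add: inner_mult_right matrix_mul_assoc) (simp add: inner_matrix matrix_mul_assoc)
    ultimately show "Re (trace (F\<^sup>\<dagger> ** X ** Q)) \<le> Re (trace (F\<^sup>\<dagger> ** X))"
      by (simp add: inner_matrix)
  qed
  show "psd (X ** F\<^sup>\<dagger>)"
  proof (rule psd_if_trace_maximal)
    fix Q :: "complex ^ 'n ^ 'n" assume Q: "unitary_matrix Q"
    have "inner (Q\<^sup>\<dagger> ** F ** mat 1) X \<le> inner F X"
      using Q by (intro max) auto
    moreover have "inner (Q\<^sup>\<dagger> ** F ** mat 1) X = Re (trace (F\<^sup>\<dagger> ** (Q ** X)))"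
      by (simp add: inner_mult_left) (simp add: inner_matrix)
    moreover have "trace (F\<^sup>\<dagger> ** (Q ** X)) = trace (X ** F\<^sup>\<dagger> ** Q)" "trace (X ** F\<^sup>\<dagger>) = trace (F\<^sup>\<dagger> ** X)"
      by (metis matrix_mul_assoc trace_mul_sym)+
    ultimately show "Re (trace (X ** F\<^sup>\<dagger> ** Q)) \<le> Re (trace (X ** F\<^sup>\<dagger>))"
      by (simp add: inner_matrix)
  qed
qed

lemma parallel_iff:
  "parallel_wrt N A B \<longleftrightarrow> (\<exists>c F. cmod c = 1 \<and> normed_by F A \<and> normed_by F (cmat_scale c B))"
proof
  assume "parallel_wrt N A B"
  then obtain c where c: "cmod c = 1" "N (A + cmat_scale c B) = N A + N (cmat_scale c B)"
    by (auto simp: parallel_wrt_def N_rotate)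
  obtain F where F: "normed_by F (A + cmat_scale c B)"
    using ex_normed_by by blast
  then show "\<exists>c F. cmod c = 1 \<and> normed_by F A \<and> normed_by F (cmat_scale c B)"
    using c normed_by_add(2)[OF F c(2)] by blast
next
  assume "\<exists>c F. cmod c = 1 \<and> normed_by F A \<and> normed_by F (cmat_scale c B)"
  then show "parallel_wrt N A B"
    unfolding parallel_wrt_def using normed_by_sum(2) N_rotate by metis
qed

section \<open>Matrices with a unique norming partial isometry\<close>

definition smooth :: "complex ^ 'n ^ 'n \<Rightarrow> bool"
  where "smooth X \<longleftrightarrow> (\<forall>F G. normed_by F X \<longrightarrow> normed_by G X \<longrightarrow> F = G)"

text \<open>Distinct values make the threshold strict, so a norming \<open>G\<close> has zero
  diagonal off \<open>S\<close> and trace \<open>k\<close>. Its inner product with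
  \<open>proj S\<close> is therefore \<open>k\<close>, the equality case of Cauchy-Schwarz.\<close>

lemma smooth_if_distinct:
  assumes "unitary_matrix U" "unitary_matrix V" and s: "inj s" "\<And>i. 0 < s i"
  shows "smooth (U ** rdiag s ** V)"
proof -
  have s0: "0 \<le> s i" for i
    using s(2)[of i] by simp
  obtain S where S: "card S = k" "\<And>i j. i \<in> S \<Longrightarrow> j \<notin> S \<Longrightarrow> s j \<le> s i" "N (rdiag s) = sum s S"
    by (rule ky_fan_norm_svd[where s=s, OF unitary_one unitary_one s0 k_le, unfolded matrix_mul_lid matrix_mul_rid]) blast
  have "S \<noteq> {}"
    using S(1) k_gt_1 by auto
  then obtain t where t: "t \<in> s ` S" "\<And>i. i \<in> S \<Longrightarrow> t \<le> s i" "\<And>j. j \<notin> S \<Longrightarrow> s j \<le> t"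
    using threshold_exists[of S s thesis] S(2) by blast
  then obtain i0 where i0: "i0 \<in> S" "t = s i0"
    by auto
  have tpos: "0 < t"
    using i0 s(2) by simp
  have *: "G = proj S" if "normed_by G (rdiag s)" for G
  proof -
    have G: "G \<in> partial_isometries k"
      using that by (rule normed_by_in)
    have "G $ j $ j = 0" if "j \<notin> S" for j
    proof (rule normed_by_rdiag_trace(2)[where s=s and S=S and t=t, OF \<open>normed_by G (rdiag s)\<close> s0 S(1,3) tpos t(2,3)])
      \<comment> \<open>\<open>t\<close> is the value at some index of \<open>S\<close>, hence not
        at \<open>j\<close>, and injectivity excludes equality.\<close>
      show "s j < t"
        using t(3)[OF that] i0 that s(1) by (metis injD order_le_less)
    qed auto
    then have "inner (proj S) G = (\<Sum>i\<in>UNIV. Re (G $ i $ i))"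
      by (auto simp: inner_matrix trace_def intro: sum.cong)
    also have "\<dots> = k"
      by (rule normed_by_rdiag_trace(1)[where s=s and S=S and t=t, OF that s0 S(1,3) tpos t(2,3)]) auto
    finally have "inner (G - proj S) (G - proj S) = 0"
      using partial_isometry_inner_self[OF G] S(1)
      by (simp add: inner_diff_left inner_diff_right inner_commute[of G "proj S"] inner_proj_proj)
    then show ?thesis
      by simp
  qed
  show ?thesis
    unfolding smooth_def
  proof (intro allI impI)
    fix F G assume FG: "normed_by F (U ** rdiag s ** V)" "normed_by G (U ** rdiag s ** V)"
    have "H = U ** proj S ** V" if "normed_by H (U ** rdiag s ** V)" for H
      using *[of "U\<^sup>\<dagger> ** H ** V\<^sup>\<dagger>"] normed_by_unitary[OF that, of "U\<^sup>\<dagger>" "V\<^sup>\<dagger>"] assms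
      by (metis unitary_adj unitary_conj_inverse)
    then show "F = G"
      using FG by metis
  qed
qed

lemma smooth_dense:
  assumes "0 < e"
  shows "\<exists>Z. smooth Z \<and> norm (Z - X) < e"
proof -
  obtain U V s where X: "unitary_matrix U" "unitary_matrix V" "\<And>i. 0 \<le> s i" "X = U ** rdiag s ** V"
    by (rule singular_value_decomposition[of X]) blast
  obtain f :: "'n \<Rightarrow> nat" where f: "inj f"
    using finite_imp_inj_to_nat_seg[OF finite_class.finite_UNIV] by blast
  define w where "w i = real (f i) + 1" for i
  have w: "inj w" "\<And>i. 0 < w i"
    using f by (auto simp: w_def inj_def)
  define C where "C = norm (U ** rdiag w ** V) + 1"
  have C: "0 < C"
    unfolding C_def using norm_ge_zero[of "U ** rdiag w ** V"] by linarith
  \<comment> \<open>The step sizes at which two perturbed singular values collide. The pairs with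
    \<open>i = j\<close> contribute \<open>0 / 0 = 0\<close>, which is harmless because
    \<open>d\<close> is positive.\<close>
  define bad where "bad = (\<lambda>(i, j). (s j - s i) / (w i - w j)) ` UNIV"
  have "infinite ({0<..<e / C} - bad)"
  proof (rule Diff_infinite_finite)
    show "finite bad"
      by (simp add: bad_def)
    show "infinite {0<..<e / C}"
      using C assms by (simp add: infinite_Ioo)
  qed
  then obtain d where d: "0 < d" "d < e / C" "d \<notin> bad"
    by (metis Diff_iff finite.emptyI ex_in_conv greaterThanLessThan_iff)
  define s' where "s' i = s i + d * w i" for i
  have "inj s'"
  proof (rule injI, rule ccontr)
    fix i j assume "s' i = s' j" "i \<noteq> j"
    then have "w i - w j \<noteq> 0" "d * (w i - w j) = s j - s i"
      using w(1) by (auto simp: s'_def inj_def algebra_simps)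
    then have "d = (s j - s i) / (w i - w j)"
      by (simp add: field_simps)
    then show False
      using d(3) by (auto simp: bad_def image_iff)
  qed
  moreover have "0 < s' i" for i
    using X(3)[of i] w(2)[of i] d(1) by (simp add: s'_def add_nonneg_pos)
  ultimately have "smooth (U ** rdiag s' ** V)"
    using X by (intro smooth_if_distinct)
  moreover have "norm (U ** rdiag s' ** V - X) < e"
  proof -
    have "rdiag s' = rdiag s + d *\<^sub>R rdiag w"
      by (simp add: vec_eq_iff cdiag_nth s'_def scaleR_matrix_eq)
    then have "U ** rdiag s' ** V - X = d *\<^sub>R (U ** rdiag w ** V)"
      by (simp add: X(4) matrix_mult_add_left matrix_mult_add_right scaleR_matrix_eq)
    then have "norm (U ** rdiag s' ** V - X) \<le> d * C"
      using d(1) by (simp add: C_def)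
    also have "\<dots> < e"
      using d(2) C by (simp add: field_simps)
    finally show ?thesis .
  qed
  ultimately show ?thesis
    by blast
qed

end

subsection \<open>Faces of the unit ball and their images\<close>

definition munit :: "'m \<Rightarrow> 'n \<Rightarrow> complex ^ 'n ^ 'm"
  where "munit p q = (\<chi> i j. if i = p \<and> j = q then 1 else 0)"

lemma munit_nth: "munit p q $ i $ j = (if i = p \<and> j = q then 1 else 0)"
  by (simp add: munit_def)

lemma munit_eq_outer: "munit p q = outer (axis p 1) (axis q 1)"
  by (auto simp: vec_eq_iff munit_nth axis_def)

text \<open>The premise \<open>X $ p $ q \<noteq> 0\<close> in the last case passes the zero pattern
  of \<open>X\<close> on to the matrix units, so the rule also serves subspaces defined by such a
  pattern.\<close>

lemma matrix_induct_munit [case_names zero add scale munit]: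
  fixes X :: "complex ^ 'n ^ 'm"
  assumes zero: "P 0"
    and add: "\<And>A B. P A \<Longrightarrow> P B \<Longrightarrow> P (A + B)"
    and scale: "\<And>c A. P A \<Longrightarrow> P (cmat_scale c A)"
    and munit: "\<And>p q. X $ p $ q \<noteq> 0 \<Longrightarrow> P (munit p q)"
  shows "P X"
proof -
  have sum: "(\<And>i. i \<in> I \<Longrightarrow> P (f i)) \<Longrightarrow> P (sum f I)" if "finite I" for I :: "'b::type set" and f
    using that by (induction I) (auto intro: add zero)
  have "P (\<Sum>p\<in>UNIV. \<Sum>q\<in>UNIV. cmat_scale (X $ p $ q) (munit p q))"
  proof (intro sum)
    fix p q
    show "P (cmat_scale (X $ p $ q) (munit p q))"
      using zero scale munit by (cases "X $ p $ q = 0") simp_all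
  qed simp_all
  also have "(\<Sum>p\<in>UNIV. \<Sum>q\<in>UNIV. cmat_scale (X $ p $ q) (munit p q)) = X"
  proof -
    have "(\<Sum>p\<in>UNIV. \<Sum>q\<in>UNIV. X $ p $ q * (if i = p \<and> j = q then 1 else 0)) = X $ i $ j" for i j
    proof -
      have "(\<Sum>q\<in>UNIV. X $ p $ q * (if i = p \<and> j = q then 1 else 0)) = (if p = i then X $ p $ j else 0)" for p
        by (cases "p = i") (simp_all add: if_distrib [of "\<lambda>x. _ * x"] cong: if_cong)
      then show ?thesis
        by simp
    qed
    then show ?thesis
      by (simp add: vec_eq_iff munit_nth)
  qed
  finally show ?thesis .
qed

definition block :: "'n set \<Rightarrow> complex ^ 'n ^ 'n \<Rightarrow> bool"
  where "block S B \<longleftrightarrow> (\<forall>i j. (i \<in> S) \<noteq> (j \<in> S) \<longrightarrow> B $ i $ j = 0)"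

text \<open>The generators are chosen to be normed by \<open>proj S\<close> when
  \<open>card S = k\<close>, so that such matrices span all block diagonal ones: polarisation yields
  the units inside \<open>S\<close>, a difference of two generators those outside.\<close>

lemma block_induct:
  fixes B :: "complex ^ 'n ^ 'n"
  assumes B: "block S B"
    and zero: "P 0"
    and add: "\<And>A B. P A \<Longrightarrow> P B \<Longrightarrow> P (A + B)"
    and scale: "\<And>c A. P A \<Longrightarrow> P (cmat_scale c A)"
    and outer: "\<And>v. (\<And>i. i \<notin> S \<Longrightarrow> v $ i = 0) \<Longrightarrow> P (outer v v)"
    and proj: "P (proj S)"
    and proj_munit: "\<And>p q. p \<notin> S \<Longrightarrow> q \<notin> S \<Longrightarrow> P (proj S + munit p q)"
  shows "P B"
proof (induction rule: matrix_induct_munit)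
  case (munit p q)
  then consider "p \<in> S" "q \<in> S" | "p \<notin> S" "q \<notin> S"
    using B unfolding block_def by blast
  then show ?case
  proof cases
    case 1
    define o' where "o' c = outer (axis p 1 + c *s axis q 1) (axis p 1 + c *s axis q 1)" for c
    have "P (o' c)" for c
      unfolding o'_def using 1 by (intro outer) (auto simp: axis_def)
    \<comment> \<open>Polarisation over the fourth roots of unity: weighting \<open>o' c\<close> by
      \<open>c / 4\<close> retains only the \<open>(p, q)\<close> term.\<close>
    then have "P (cmat_scale (1 / 4) (o' 1) + cmat_scale (\<i> / 4) (o' \<i>) +
        (cmat_scale (- 1 / 4) (o' (- 1)) + cmat_scale (- \<i> / 4) (o' (- \<i>))))"
      by (intro add scale)
    also have "cmat_scale (1 / 4) (o' 1) + cmat_scale (\<i> / 4) (o' \<i>) +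
        (cmat_scale (- 1 / 4) (o' (- 1)) + cmat_scale (- \<i> / 4) (o' (- \<i>))) = munit p q"
      by (simp add: vec_eq_iff o'_def munit_nth axis_def complex_eq_iff)
    finally show ?thesis .
  next
    case 2
    then have "P ((proj S + munit p q) + cmat_scale (- 1) (proj S))"
      by (intro add scale proj proj_munit)
    then show ?thesis
      by (simp add: scale_minus_one)
  qed
qed (use zero add scale in auto)

text \<open>The trace of the combination is real, so the imaginary parts of \<open>e\<close> and
  \<open>e'\<close> are opposite. If they are nonzero, comparison with the adjoint gives the claim;
  if they vanish, \<open>e' = - e\<close>, and a positive semidefinite matrix of trace zero is
  zero.\<close>

lemma psd_combination_eq:
  assumes A: "psd A" "psd A'" "trace A = trace A'" "trace A \<noteq> 0"
    and e: "cmod e = 1" "cmod e' = 1" "e \<noteq> e'"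
    and M: "psd (cmat_scale e A + cmat_scale e' A')"
  shows "A = A'"
proof -
  define \<rho> where "\<rho> = Re (trace A)"
  have \<rho>: "trace A = complex_of_real \<rho>" "\<rho> \<noteq> 0"
    using psd_trace(1)[OF A(1)] A(4) by (auto simp: \<rho>_def)
  have "trace (cmat_scale e A + cmat_scale e' A') = (e + e') * complex_of_real \<rho>"
    using A(3) \<rho>(1) by (simp add: trace_add trace_scale algebra_simps)
  then have tr: "Im (e + e') = 0"
    using psd_trace(1)[OF M] \<rho>(2) by (simp add: complex_eq_iff)
  show ?thesis
  proof (cases "Im e = 0")
    case False
    have "cmat_scale (cnj e) A + cmat_scale (cnj e') A' = cmat_scale e A + cmat_scale e' A'"
      using psd_adj[OF M] by (simp add: psd_adj A)
    then have "(cnj e - e) * A $ i $ j = - (cnj e' - e') * A' $ i $ j" for i j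
      by (auto simp: vec_eq_iff algebra_simps) 
    moreover have "- (cnj e' - e') = cnj e - e" "cnj e - e \<noteq> 0"
      using tr False by (simp_all add: complex_eq_iff)
    ultimately show ?thesis
      by (simp add: vec_eq_iff)
  next
    case True
    then have "e' = - e"
      using tr e by (auto simp: complex_eq_iff cmod_def)
    then have "trace (cmat_scale e A + cmat_scale e' A') = 0"
      using A(3) by (simp add: trace_add trace_scale)
    then have "cmat_scale e A + cmat_scale e' A' = 0"
      using psd_trace(3)[OF M] by simp
    then show ?thesis
      using e by (auto simp: \<open>e' = - e\<close> vec_eq_iff algebra_simps)
  qed
qed

section \<open>Matrices normed by a coordinate projection\<close>

context ky_fan
begin

text \<open>Each off-block entry of \<open>B\<close> survives in one of the two Hermitian products,
  at a place whose mirror image the projection erases.\<close>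

lemma normed_by_block:
  assumes "normed_by (proj S) B"
  shows "block S B" "psd (proj S ** B)"
proof -
  have psd: "psd (proj S ** B)" "psd (B ** proj S)"
    using normed_by_psd[OF assms] by simp_all
  show "psd (proj S ** B)"
    by (rule psd(1))
  show "block S B"
    unfolding block_def
  proof (intro allI impI)
    fix i j assume *: "(i \<in> S) \<noteq> (j \<in> S)"
    show "B $ i $ j = 0"
      using psd_adj_nth[OF psd(1), of i j] psd_adj_nth[OF psd(2), of i j] * by (auto split: if_splits)
  qed
qed

lemma trace_normed_by:
  assumes "normed_by (proj S) B"
  shows "trace (proj S ** B) = complex_of_real (N B)"
proof -
  have "Re (trace (proj S ** B)) = N B"
    using N_eq[OF assms] by (simp add: inner_matrix)
  then show ?thesis
    using psd_trace(1)[OF normed_by_block(2)[OF assms]] by simp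
qed

lemma normed_by_proj_iff:
  "card S = k \<Longrightarrow> normed_by (proj S) B \<longleftrightarrow> N B \<le> inner (proj S) B"
  using inner_le_N[of "proj S" B] by (auto simp: normed_by_def)

lemma normed_by_outer:
  assumes "card S = k" "\<And>i. i \<notin> S \<Longrightarrow> v $ i = 0"
  shows "normed_by (proj S) (outer v v)"
proof -
  have "proj S *v v = v"
    using assms(2) by (auto simp: vec_eq_iff)
  then have "inner (proj S) (outer v v) = (norm v)\<^sup>2"
    by (simp add: inner_matrix trace_mult_outer cdot_self)
  moreover have "N (outer v v) \<le> (norm v)\<^sup>2"
  proof -
    obtain F where F: "normed_by F (outer v v)"
      using ex_normed_by by blast
    have "N (outer v v) = inner v (F\<^sup>\<dagger> *v v)"
      using N_eq[OF F] by (simp add: inner_matrix trace_mult_outer Re_cdot)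
    also have "\<dots> \<le> norm v * norm (F\<^sup>\<dagger> *v v)"
      by (rule norm_cauchy_schwarz)
    also have "\<dots> \<le> norm v * norm v"
      using normed_by_in[OF F] by (intro mult_left_mono partial_isometry_contraction partial_isometries_adj) auto
    finally show ?thesis
      by (simp add: power2_eq_square)
  qed
  ultimately show ?thesis
    using assms(1) by (simp add: normed_by_proj_iff)
qed

lemma N_le_if_contraction:
  assumes B: "\<And>v. norm (B *v v) \<le> norm v"
  shows "N B \<le> k"
proof -
  obtain F where F: "normed_by F B"
    using ex_normed_by by blast
  obtain U V S where UV: "unitary_matrix U" "unitary_matrix V" "F = U ** proj S ** V" "card S = k"
    using normed_by_in[OF F] by (auto simp: partial_isometries_def)
  define C where "C = U\<^sup>\<dagger> ** B ** V\<^sup>\<dagger>"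
  have "N B = inner (proj S) C"
    using N_eq[OF F] UV by (simp add: unitary_inner C_def)
  also have "\<dots> = (\<Sum>i\<in>UNIV. Re (if i \<in> S then C $ i $ i else 0))"
    by (simp add: inner_matrix trace_def)
  also have "\<dots> \<le> (\<Sum>i\<in>UNIV. if i \<in> S then 1 else 0)"
  proof (rule sum_mono)
    fix i
    have "cmod (C $ i $ i) \<le> norm (C *v axis i 1)"
      using Finite_Cartesian_Product.norm_nth_le[of "C *v axis i 1" i] by simp
    also have "\<dots> = norm (B *v (V\<^sup>\<dagger> *v axis i 1))"
      using UV by (simp add: C_def unitary_norm flip: matrix_vector_mul_assoc)
    also have "\<dots> \<le> norm (V\<^sup>\<dagger> *v axis i (1 :: complex))"
      by (rule B)
    also have "\<dots> = 1"
      using UV by (simp add: unitary_norm)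
    finally show "Re (if i \<in> S then C $ i $ i else 0) \<le> (if i \<in> S then 1 else 0)"
      using complex_Re_le_cmod[of "C $ i $ i"] by auto
  qed
  also have "\<dots> = k"
    using UV(4) by (simp add: sum.If_cases)
  finally show ?thesis .
qed

text \<open>Adding a unit outside \<open>S\<close> keeps the matrix a contraction, so its norm is at
  most \<open>k\<close>, and \<open>proj S\<close> alone already pairs to \<open>k\<close>.\<close>

lemma normed_by_proj_munit:
  assumes S: "card S = k" and pq: "p \<notin> S" "q \<notin> S"
  shows "normed_by (proj S) (proj S + munit p q)"
proof -
  have "norm ((proj S + munit p q) *v v) \<le> norm v" for v :: "complex ^ 'n"
  proof -
    have nth: "((proj S + munit p q) *v v) $ i = (if i \<in> S then v $ i else if i = p then v $ q else 0)" for i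
      using pq(1) by (simp add: matrix_vector_mult_add_rdistrib munit_eq_outer outer_mult_vec cdot_axis_left)
        (simp add: axis_def)
    have "(norm ((proj S + munit p q) *v v))\<^sup>2 =
        (\<Sum>i\<in>UNIV. (if i \<in> S then (cmod (v $ i))\<^sup>2 else 0) + (if i = p then (cmod (v $ q))\<^sup>2 else 0))"
      unfolding norm_vec_def L2_set_def nth using pq(1)
      by (simp add: sum_nonneg) (rule sum.cong, auto)
    also have "\<dots> = (\<Sum>i\<in>S. (cmod (v $ i))\<^sup>2) + (cmod (v $ q))\<^sup>2"
      by (simp add: sum.distrib sum.If_cases)
    also have "\<dots> = (\<Sum>i\<in>insert q S. (cmod (v $ i))\<^sup>2)"
      using pq(2) by simp
    also have "\<dots> \<le> (\<Sum>i\<in>UNIV. (cmod (v $ i))\<^sup>2)"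
      by (rule sum_mono2) auto
    also have "\<dots> = (norm v)\<^sup>2"
      by (simp add: norm_vec_def L2_set_def sum_nonneg)
    finally show ?thesis
      by (simp add: power2_le_iff_abs_le)
  qed
  then have "N (proj S + munit p q) \<le> k"
    by (rule N_le_if_contraction)
  moreover have "inner (proj S) (proj S + munit p q) = k"
  proof -
    have "inner (proj S) (munit p q) = 0"
      using pq by (auto simp: inner_matrix trace_def munit_nth intro!: sum.neutral)
    then show ?thesis
      using S by (simp add: inner_add_right inner_proj_proj)
  qed
  ultimately show ?thesis
    using S by (simp add: normed_by_proj_iff)
qed

lemma normed_by_proj_proj:
  assumes "card S = k"
  shows "normed_by (proj S) (proj S)"
  using assms N_le_norm[of "proj S"] by (simp add: normed_by_proj_iff norm_eq_sqrt_inner inner_proj_proj)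

lemma block_induct_normed_by [consumes 2, case_names zero add scale normed]:
  fixes B :: "complex ^ 'n ^ 'n"
  assumes S: "card S = k" and B: "block S B"
    and zero: "P 0"
    and add: "\<And>A B. P A \<Longrightarrow> P B \<Longrightarrow> P (A + B)"
    and scale: "\<And>c A. P A \<Longrightarrow> P (cmat_scale c A)"
    and normed: "\<And>A. normed_by (proj S) A \<Longrightarrow> P A"
  shows "P B"
  using B zero add scale
proof (rule block_induct)
  show "P (outer v v)" if "\<And>i. i \<notin> S \<Longrightarrow> v $ i = 0" for v
    using normed_by_outer[OF S that] by (rule normed)
qed (use S normed normed_by_proj_proj normed_by_proj_munit in auto)

text \<open>The phases \<open>c\<close> are the same for all \<open>B\<close>: two different phases force the \<open>S\<close>-blocks of the
  images to be proportional, and then all images have proportional \<open>S\<close>-blocks, although \<open>f\<close> maps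
  the block diagonal matrices onto themselves.\<close>

lemma face_map_additive:
  fixes f :: "complex ^ 'n ^ 'n \<Rightarrow> complex ^ 'n ^ 'n"
  assumes f: "\<And>A B. f (A + B) = f A + f B" "\<And>c A. f (cmat_scale c A) = cmat_scale c (f A)" "inj f"
    and S: "card S = k"
    and face: "\<And>B. normed_by (proj S) B \<Longrightarrow> \<exists>c. cmod c = 1 \<and> normed_by (proj S) (cmat_scale c (f B))"
    and B: "normed_by (proj S) B1" "normed_by (proj S) B2"
  shows "N (f B1 + f B2) = N (f B1) + N (f B2)"
proof -
  let ?H = "\<lambda>B. proj S ** f B"
  obtain ph where ph: "\<And>B. normed_by (proj S) B \<Longrightarrow> cmod (ph B) = 1"
    "\<And>B. normed_by (proj S) B \<Longrightarrow> normed_by (proj S) (cmat_scale (ph B) (f B))"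
    using face by metis
  have H0: "?H B = 0 \<longleftrightarrow> f B = 0" if "normed_by (proj S) B" for B
  proof
    assume "?H B = 0"
    then have "N (cmat_scale (ph B) (f B)) = 0"
      using trace_normed_by[OF ph(2)[OF that]] by (simp add: trace_def)
    then show "f B = 0"
      using ph(1)[OF that] by (simp add: N_rotate)
  qed simp
  have key: "\<exists>\<alpha>. ?H B = cmat_scale \<alpha> (?H B')"
    if B: "normed_by (proj S) B" and B': "normed_by (proj S) B'" and ne: "ph B \<noteq> ph B'" "f B' \<noteq> 0" for B B'
  proof (cases "f B = 0")
    case True
    then show ?thesis
      by (intro exI[of _ 0]) simp
  next
    case False
    define r r' where "r = N (f B)" and "r' = N (f B')"
    have r: "0 < r" "0 < r'"
      using False ne(2) N_nonneg[of "f B"] N_nonneg[of "f B'"] N_eq_0_iff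
      by (metis r_def r'_def order_le_less)+
    \<comment> \<open>Cross multiplication by the norms gives \<open>A\<close> and \<open>A'\<close>
      the common trace \<open>r * r'\<close> that \<open>psd_combination_eq\<close> requires;
      \<open>Y\<close> is the matching combination before applying \<open>f\<close>.\<close>
    define A where "A = cmat_scale (complex_of_real r') (cmat_scale (ph B) (?H B))"
    define A' where "A' = cmat_scale (complex_of_real r) (cmat_scale (ph B') (?H B'))"
    define Y where "Y = cmat_scale (complex_of_real r') B + cmat_scale (complex_of_real r) B'"
    have Y: "normed_by (proj S) Y"
      unfolding Y_def using r B B' by (intro normed_by_sum normed_by_scaleR) auto
    have nA: "normed_by (proj S) (cmat_scale (complex_of_real r') (cmat_scale (ph B) (f B)))"
      "normed_by (proj S) (cmat_scale (complex_of_real r) (cmat_scale (ph B') (f B')))"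
      by (rule normed_by_scaleR[OF less_imp_le[OF r(2)] ph(2)[OF B]],
          rule normed_by_scaleR[OF less_imp_le[OF r(1)] ph(2)[OF B']])
    have psdA: "psd A" "psd A'"
      using normed_by_block(2)[OF nA(1)] normed_by_block(2)[OF nA(2)] by (simp_all add: A_def A'_def)
    have trA: "trace A = complex_of_real (r * r')" "trace A' = complex_of_real (r * r')"
      using trace_normed_by[OF nA(1)] trace_normed_by[OF nA(2)] r ph(1)[OF B] ph(1)[OF B']
      by (simp_all add: A_def A'_def N_scaleR N_rotate r_def r'_def mult.commute N_scale norm_mult)
    have inv: "cnj (ph B) * ph B = 1" "cnj (ph B') * ph B' = 1"
      using ph(1)[OF B] ph(1)[OF B'] by (metis complex_norm_square mult.commute of_real_1 one_power2)+
    have "?H Y = cmat_scale (cnj (ph B)) A + cmat_scale (cnj (ph B')) A'"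
      using inv by (simp add: Y_def A_def A'_def f matrix_mult_add_right mult.left_commute[of "cnj _"])
    then have "psd (cmat_scale (ph Y * cnj (ph B)) A + cmat_scale (ph Y * cnj (ph B')) A')"
      using normed_by_block(2)[OF ph(2)[OF Y]] by (simp add: scale_add)
    moreover have "cmod (ph Y * cnj (ph B)) = 1" "cmod (ph Y * cnj (ph B')) = 1"
      using ph(1) B B' Y by (simp_all add: norm_mult)
    moreover have "ph Y * cnj (ph B) \<noteq> ph Y * cnj (ph B')"
      using ne(1) ph(1)[OF Y] by auto
    ultimately have "A = A'"
      using psd_combination_eq[OF psdA] trA r by simp
    have "?H B = cmat_scale (cnj (ph B) / r') A"
      using r inv by (simp add: A_def field_simps)
    then show ?thesis
      unfolding \<open>A = A'\<close> A'_def by auto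
  qed
  show ?thesis
  proof (cases "f B1 = 0 \<or> f B2 = 0 \<or> ph B1 = ph B2")
    case True
    moreover have ?thesis if "ph B1 = ph B2"
    proof -
      have "N (f B1 + f B2) = N (cmat_scale (ph B1) (f B1) + cmat_scale (ph B2) (f B2))"
        using ph(1)[OF B(1)] that by (simp add: N_rotate flip: scale_add)
      also have "\<dots> = N (cmat_scale (ph B1) (f B1)) + N (cmat_scale (ph B2) (f B2))"
        using ph(2) B by (intro normed_by_sum)
      finally show ?thesis
        using ph(1) B by (simp add: N_rotate)
    qed
    ultimately show ?thesis
      by auto
  next
    case False
    have all: "\<exists>\<alpha>. ?H B = cmat_scale \<alpha> (?H B1)" if "normed_by (proj S) B" for B
    proof (cases "ph B = ph B1")
      case True
      \<comment> \<open>A matrix sharing the phase of \<open>B1\<close> differs in phase from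
        \<open>B2\<close>, so \<open>B2\<close> serves as intermediary.\<close>
      then have "\<exists>\<alpha>. ?H B = cmat_scale \<alpha> (?H B2)" "\<exists>\<beta>. ?H B2 = cmat_scale \<beta> (?H B1)"
        using key[OF that B(2)] key[OF B(2,1)] False by auto
      then show ?thesis
        by auto
    qed (use key that B False in blast)
    have f0: "f 0 = 0"
      using f(1)[of 0 0] by simp
    have prp: "block S (f B) \<and> (\<exists>\<alpha>. ?H B = cmat_scale \<alpha> (?H B1))" if "block S B" for B
      using S that
    proof (induction rule: block_induct_normed_by)
      case (normed A)
      then have "block S (cmat_scale (ph A) (f A))" "ph A \<noteq> 0"
        using normed_by_block(1) ph by fastforce+
      then have "block S (f A)"
        by (simp add: block_def)
      then show ?case
        using all[OF normed] by blast
    next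
      case (add A B)
      then obtain \<alpha> \<beta> where "?H A = cmat_scale \<alpha> (?H B1)" "?H B = cmat_scale \<beta> (?H B1)"
        by blast
      then have "?H (A + B) = cmat_scale (\<alpha> + \<beta>) (?H B1)"
        by (simp add: f matrix_mult_add_right scale_add_left)
      then show ?case
        using add by (auto simp: f block_def)
    next
      case (scale c A)
      then obtain \<alpha> where "?H A = cmat_scale \<alpha> (?H B1)"
        by blast
      then have "?H (cmat_scale c A) = cmat_scale (c * \<alpha>) (?H B1)"
        by (simp add: f)
      then show ?case
        using scale by (auto simp: f block_def)
    next
      case zero
      show ?case
        by (auto simp: f0 block_def intro: exI[of _ 0])
    qed
    \<comment> \<open>An injective linear map of a finite-dimensional space into itself is
      onto.\<close>
    have surj: "\<exists>B. block S B \<and> f B = X" if "block S X" for X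
    proof -
      let ?L = "{B. block S B}"
      have lin: "linear f"
        by (rule linearI) (simp_all add: f scaleR_matrix_eq)
      have sub: "subspace ?L"
        by (auto simp: subspace_def block_def)
      have "f ` ?L \<subseteq> ?L"
        using prp by blast
      moreover have "dim (f ` ?L) = dim ?L"
        using lin f(3) by (intro dim_image_eq) (auto intro: inj_on_subset)
      ultimately have "f ` ?L = ?L"
        by (intro subspace_dim_equal[OF linear_subspace_image[OF lin sub] sub]) simp_all
      with that have "X \<in> f ` ?L"
        by (simp only: mem_Collect_eq)
      then show ?thesis
        by auto
    qed
    \<comment> \<open>Here \<open>1 < k\<close> gives two diagonal units inside \<open>S\<close>;
      both lie in the image, yet they are not multiples of one matrix.\<close>
    obtain i j where ij: "i \<in> S" "j \<in> S" "i \<noteq> j"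
      using S k_gt_1 by (metis card_le_Suc0_iff_eq finite_class.finite linorder_not_less One_nat_def)
    have "block S (munit i i)" "block S (munit j j)"
      using ij by (auto simp: block_def munit_nth)
    then obtain P Q where PQ: "block S P" "f P = munit i i" "block S Q" "f Q = munit j j"
      using surj by metis
    obtain \<alpha> \<beta> where "proj S ** munit i i = cmat_scale \<alpha> (?H B1)" "proj S ** munit j j = cmat_scale \<beta> (?H B1)"
      using prp[OF PQ(1)] prp[OF PQ(3)] PQ(2,4) by metis
    then have "(proj S ** munit i i) $ i $ i = \<alpha> * ?H B1 $ i $ i"
      "(proj S ** munit j j) $ i $ i = \<beta> * ?H B1 $ i $ i"
      "(proj S ** munit j j) $ j $ j = \<beta> * ?H B1 $ j $ j"
      by (simp_all only: cmat_scale_nth)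
    then show ?thesis
      using ij by (auto simp: munit_nth)
  qed
qed

end

subsection \<open>Orthogonality and additivity of the norm\<close>

text \<open>The projection \<open>P\<close> onto the range of \<open>F\<close> satisfies
  \<open>P ** F = F\<close>, so its inner product with \<open>F\<close> is the real part of the
  trace. The value \<open>k\<close> is the equality case of Cauchy-Schwarz and gives
  \<open>F = P\<close>.\<close>

lemma partial_isometry_projection:
  fixes F :: "complex ^ 'n ^ 'n"
  assumes "F \<in> partial_isometries k" "Re (trace F) = k"
  shows "F\<^sup>\<dagger> = F" "F ** F = F"
proof -
  obtain U V S where F: "unitary_matrix U" "unitary_matrix V" "F = U ** proj S ** V" "card S = k"
    using assms(1) by (auto simp: partial_isometries_def)
  define P where "P = U ** proj S ** U\<^sup>\<dagger>"
  have P: "P \<in> partial_isometries k"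
    using F by (simp add: P_def partial_isometries_unitary)
  have PF: "P ** F = F"
  proof -
    have "P ** F = U ** (proj S ** (U\<^sup>\<dagger> ** (U ** (proj S ** V))))"
      by (simp add: P_def F(3) matrix_mul_assoc)
    also have "\<dots> = U ** (proj S ** proj S) ** V"
      using F(1) by (simp add: unitary_cancel matrix_mul_assoc del: proj_mult_proj)
    finally show ?thesis
      by (simp add: F(3))
  qed
  have Padj: "P\<^sup>\<dagger> = P"
    by (simp add: P_def matrix_mul_assoc)
  have "inner P F = k"
    by (simp add: inner_matrix Padj PF assms(2))
  then have "inner (P - F) (P - F) = 0"
    using partial_isometry_inner_self[OF assms(1)] partial_isometry_inner_self[OF P]
    by (simp add: inner_diff_left inner_diff_right inner_commute[of F P])
  then have "P = F"
    by simp
  then show "F\<^sup>\<dagger> = F" "F ** F = F"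
    using Padj PF by simp_all
qed

text \<open>A contraction that maps a unit vector to one with inner product \<open>1\<close> against
  it must fix it; the adjoint is a contraction too.\<close>

lemma partial_isometry_fixed_axis:
  assumes F: "F \<in> partial_isometries k" and 1: "Re (F $ i $ i) = 1"
  shows "F $ j $ i = (if j = i then 1 else 0)" "F $ i $ j = (if j = i then 1 else 0)"
proof -
  have fixed: "G *v axis i 1 = axis i 1" if G: "G \<in> partial_isometries k" and "Re (G $ i $ i) = 1"
    for G :: "complex ^ 'a ^ 'a"
  proof -
    have "inner (axis i 1) (G *v axis i 1) = 1"
      using that(2) by (simp add: cdot_axis_left flip: Re_cdot)
    then have "(norm (G *v axis i 1 - axis i 1))\<^sup>2 = (norm (G *v axis i 1))\<^sup>2 - 1"
      by (simp add: power2_norm_eq_inner inner_diff_left inner_diff_right inner_commute inner_axis_axis)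
    also have "\<dots> \<le> 0"
      using partial_isometry_contraction[OF G, of "axis i 1"] by (simp add: abs_square_le_1)
    finally show ?thesis
      by simp
  qed
  show "F $ j $ i = (if j = i then 1 else 0)"
    using arg_cong[OF fixed[OF F 1], of "\<lambda>v. v $ j", unfolded mult_axis_nth] by (simp add: axis_def)
  have "F\<^sup>\<dagger> *v axis i 1 = axis i 1"
    using partial_isometries_adj[OF F] 1 by (intro fixed) simp_all
  from arg_cong[OF this, of "\<lambda>v. cnj (v $ j)", unfolded mult_axis_nth]
  show "F $ i $ j = (if j = i then 1 else 0)"
    by (simp add: axis_def if_distrib cong: if_cong)
qed

text \<open>One nonzero column from each member gives an orthogonal set of nonzero vectors, which is
  finite in finite dimension.\<close>

lemma infinite_orthogonal_family_False:
  fixes H :: "real \<Rightarrow> complex ^ 'n ^ 'n"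
  assumes "infinite I" and nz: "\<And>x. x \<in> I \<Longrightarrow> H x \<noteq> 0"
    and orth: "\<And>x y. x \<in> I \<Longrightarrow> y \<in> I \<Longrightarrow> x \<noteq> y \<Longrightarrow> (H x)\<^sup>\<dagger> ** H y = 0"
  shows False
proof -
  have "\<forall>x. \<exists>j. x \<in> I \<longrightarrow> H x *v axis j 1 \<noteq> 0"
    using nz by (metis mult_axis_nth vec_eq_iff zero_index)
  then obtain j where j: "\<And>x. x \<in> I \<Longrightarrow> H x *v axis (j x) 1 \<noteq> 0"
    by metis
  define u where "u x = H x *v axis (j x) 1" for x
  have u: "inner (u x) (u y) = 0" if "x \<in> I" "y \<in> I" "x \<noteq> y" for x y
    using orth[OF that] by (simp add: u_def flip: Re_cdot adj_mult_cdot)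
  have "inj_on u I"
  proof (rule inj_onI, rule ccontr)
    fix x y assume "x \<in> I" "y \<in> I" "u x = u y" "x \<noteq> y"
    then have "inner (u x) (u x) = 0"
      using u[of x y] by simp
    then show False
      using j[OF \<open>x \<in> I\<close>] by (simp add: u_def)
  qed
  moreover have "finite (u ` I)"
    using u by (intro pairwise_orthogonal_imp_finite) (auto simp: pairwise_def orthogonal_def)
  ultimately show False
    using assms(1) finite_imageD by blast
qed

context ky_fan
begin

text \<open>\<open>M1\<close> and \<open>M2\<close> are Hermitian, \<open>G\<close> fixes
  \<open>M1\<close> from the left and \<open>M2\<close> from the right, and
  \<open>M1 ** G = G ** M2\<close>; taking adjoints identifies the two.\<close>

lemma normed_by_projection_block:
  assumes G: "normed_by G (cmat_scale z Y)" "G\<^sup>\<dagger> = G" "G ** G = G" and z: "cmod z = 1"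
  shows "G ** Y = Y ** G" "(cmat_scale z (Y ** G))\<^sup>\<dagger> = cmat_scale z (Y ** G)"
    and "Y \<noteq> 0 \<Longrightarrow> Y ** G \<noteq> 0"
proof -
  define M1 M2 where "M1 = cmat_scale z (G ** Y)" and "M2 = cmat_scale z (Y ** G)"
  have herm: "M1\<^sup>\<dagger> = M1" "M2\<^sup>\<dagger> = M2"
    using normed_by_psd[OF G(1)] by (simp_all add: psd_adj M1_def M2_def G(2) del: adj_scale adj_mult)
  have "M1 = (M1 ** G)\<^sup>\<dagger>"
    by (simp only: adj_mult herm G(2)) (simp add: M1_def G(3) matrix_mul_assoc)
  also have "M1 ** G = G ** M2"
    by (simp add: M1_def M2_def matrix_mul_assoc)
  also have "(G ** M2)\<^sup>\<dagger> = M2"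
    by (simp only: adj_mult herm G(2)) (simp add: M2_def G(3) flip: matrix_mul_assoc)
  finally have eq: "M1 = M2" .
  have "z \<noteq> 0"
    using z by auto
  then show "G ** Y = Y ** G"
    using eq by (simp add: M1_def M2_def vec_eq_iff)
  show "(cmat_scale z (Y ** G))\<^sup>\<dagger> = cmat_scale z (Y ** G)"
    using herm(2) by (simp only: M2_def)
  assume "Y \<noteq> 0"
  then have "Re (trace M1) \<noteq> 0"
    using N_eq[OF G(1)] z by (simp add: inner_matrix G(2) M1_def N_rotate)
  then have "M2 \<noteq> 0"
    using eq by (auto simp: trace_def)
  then show "Y ** G \<noteq> 0"
    by (auto simp: M2_def)
qed

text \<open>\<open>Y\<close> acts as \<open>cnj z\<close> times a positive operator on the range of \<open>G z\<close>, so these ranges are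
  orthogonal for different \<open>z\<close> on a short arc; there is no room for infinitely many of them.\<close>

lemma projections_norming_all_rotations:
  assumes G: "\<And>z. cmod z = 1 \<Longrightarrow> normed_by (G z) (cmat_scale z Y)"
    and proj: "\<And>z. cmod z = 1 \<Longrightarrow> (G z)\<^sup>\<dagger> = G z" "\<And>z. cmod z = 1 \<Longrightarrow> G z ** G z = G z"
  shows "Y = 0"
proof (rule ccontr)
  assume Y: "Y \<noteq> 0"
  define H where "H z = cmat_scale z (Y ** G z)" for z
  have H: "H z = cmat_scale z (G z ** Y)" "(H z)\<^sup>\<dagger> = H z" "H z \<noteq> 0" "G z ** H z = H z"
    "Y ** G z = cmat_scale (cnj z) (H z)" "Y\<^sup>\<dagger> ** G z = cmat_scale z (H z)" if z: "cmod z = 1" for z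
  proof -
    note * = normed_by_projection_block[OF G[OF z] proj[OF z] z]
    show 1: "H z = cmat_scale z (G z ** Y)"
      by (simp add: H_def *(1))
    show 2: "(H z)\<^sup>\<dagger> = H z"
      unfolding H_def by (rule *(2))
    have z1: "cnj z * z = 1" "z * cnj z = 1"
      using z by (metis complex_norm_square mult.commute of_real_1 one_power2)+
    show "H z \<noteq> 0"
      using *(3)[OF Y] z by (auto simp: H_def)
    show "G z ** H z = H z"
      unfolding 1 by (simp add: matrix_mul_assoc proj(2)[OF z])
    show "Y ** G z = cmat_scale (cnj z) (H z)"
      by (simp add: H_def z1)
    have "H z = cmat_scale (cnj z) (Y\<^sup>\<dagger> ** G z)"
      using 2 unfolding 1 by (simp add: proj(1)[OF z])
    then show "Y\<^sup>\<dagger> ** G z = cmat_scale z (H z)"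
      using z1 by simp
  qed
  have orth: "(H z')\<^sup>\<dagger> ** H z = 0" if z: "cmod z = 1" and z': "cmod z' = 1" and ne: "cnj z' * z \<noteq> z' * cnj z" for z z'
  proof -
    have "Y\<^sup>\<dagger> ** (Y ** G z) = cmat_scale (cnj z) (Y\<^sup>\<dagger> ** (G z ** H z))"
      by (simp add: H(4,5)[OF z])
    also have "\<dots> = H z ** H z"
      using z by (simp add: matrix_mul_assoc H(6)[OF z] mult.commute[of "cnj z"] complex_norm_square[symmetric])
    finally have a: "Y\<^sup>\<dagger> ** (Y ** G z) = H z ** H z" .
    have "Y ** (Y\<^sup>\<dagger> ** G z) = cmat_scale z (Y ** (G z ** H z))"
      by (simp add: H(4,6)[OF z])
    also have "\<dots> = H z ** H z"
      using z by (simp add: matrix_mul_assoc H(5)[OF z] complex_norm_square[symmetric])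
    finally have b: "Y ** (Y\<^sup>\<dagger> ** G z) = H z ** H z" .
    have Hz': "H z' = cmat_scale (cnj z') (G z' ** Y\<^sup>\<dagger>)"
      using H(2)[OF z'] by (simp add: H_def proj(1)[OF z'])
    have Hz: "H z = cmat_scale (cnj z) (Y\<^sup>\<dagger> ** G z)"
      using H(6)[OF z] z by (simp add: mult.commute[of "cnj z"] complex_norm_square[symmetric])
    \<comment> \<open>The same product is evaluated through \<open>Y\<^sup>\<dagger> ** Y\<close>
      and through \<open>Y ** Y\<^sup>\<dagger>\<close>, which agree on the range of
      \<open>G z\<close>. The two results carry different scalars, so the product vanishes.\<close>
    have "H z' ** H z = cmat_scale (cnj z' * z) (G z' ** (Y\<^sup>\<dagger> ** (Y ** G z)))"
      unfolding Hz' H_def[of z] by (simp add: matrix_mul_assoc mult.commute)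
    then have 1: "H z' ** H z = cmat_scale (cnj z' * z) (G z' ** (H z ** H z))"
      by (simp only: a)
    have "H z' ** H z = cmat_scale (z' * cnj z) (G z' ** (Y ** (Y\<^sup>\<dagger> ** G z)))"
      unfolding H(1)[OF z'] Hz by (simp add: matrix_mul_assoc mult.commute)
    then have 2: "H z' ** H z = cmat_scale (z' * cnj z) (G z' ** (H z ** H z))"
      by (simp only: b)
    have "(cnj z' * z - z' * cnj z) * (G z' ** (H z ** H z)) $ i $ j = 0" for i j
    proof -
      have "cmat_scale (cnj z' * z) (G z' ** (H z ** H z)) = cmat_scale (z' * cnj z) (G z' ** (H z ** H z))"
        using 1 2 by metis
      from arg_cong[OF this, of "\<lambda>M. M $ i $ j"] show ?thesis
        by (simp add: algebra_simps)
    qed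
    then have "G z' ** (H z ** H z) = 0"
      using ne by (simp add: vec_eq_iff)
    then show ?thesis
      using 1 H(2)[OF z'] by simp
  qed
  show False
  proof (rule infinite_orthogonal_family_False)
    \<comment> \<open>Two points of this arc are never antipodal, and \<open>orth\<close> fails only
      for equal or antipodal points.\<close>
    show "infinite {0<..<1 :: real}"
      by (simp add: infinite_Ioo)
    show "H (cis x) \<noteq> 0" for x
      by (rule H(3)) simp
    show "(H (cis x))\<^sup>\<dagger> ** H (cis y) = 0" if "x \<in> {0<..<1}" "y \<in> {0<..<1}" "x \<noteq> y" for x y
    proof (rule orth)
      show "cnj (cis x) * cis y \<noteq> cis x * cnj (cis y)"
      proof
        assume "cnj (cis x) * cis y = cis x * cnj (cis y)"
        then have "Im (cis (y - x)) = Im (cis (x - y))"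
          by (simp add: cis_cnj cis_mult)
        then have "sin (x - y) = 0"
          using sin_minus[of "x - y"] by simp
        moreover have "\<bar>x - y\<bar> < pi"
          using that pi_gt3 by auto
        ultimately show False
          using that(3) sin_gt_zero[of "x - y"] sin_gt_zero[of "y - x"] sin_minus[of "x - y"]
          by (cases "x < y") auto
      qed
    qed simp_all
  qed
qed

text \<open>The dichotomy is whether \<open>rdiag d\<close> has rank at least \<open>k\<close>, that
  is, whether its \<open>k\<close>-th largest entry \<open>t\<close> is positive. If so, each
  norming partial isometry has trace \<open>k\<close> and is a projection, which leaves only
  \<open>Y = 0\<close>. Otherwise it is only forced to fix the axes with
  \<open>d i \<noteq> 0\<close>, and positivity then clears these rows and columns of
  \<open>Y\<close>.\<close>

lemma diag_orthogonal_if_norm_additive: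
  assumes d: "\<And>i. 0 \<le> d i"
    and add: "\<And>z. cmod z = 1 \<Longrightarrow> N (rdiag d + cmat_scale z Y) = N (rdiag d) + N Y"
    and i: "d i \<noteq> 0"
  shows "Y $ i $ j = 0" "Y $ j $ i = 0"
proof -
  have "\<exists>G. normed_by G (rdiag d) \<and> normed_by G (cmat_scale z Y)" if "cmod z = 1" for z
    using ex_normed_by normed_by_add(2) add[OF that] N_rotate[OF that] by metis
  then obtain G where G: "\<And>z. cmod z = 1 \<Longrightarrow> normed_by (G z) (rdiag d)"
    "\<And>z. cmod z = 1 \<Longrightarrow> normed_by (G z) (cmat_scale z Y)"
    by metis
  obtain S where S: "card S = k" "\<And>i j. i \<in> S \<Longrightarrow> j \<notin> S \<Longrightarrow> d j \<le> d i" "N (rdiag d) = sum d S"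
    by (rule ky_fan_norm_svd[where s=d, OF unitary_one unitary_one d k_le, unfolded matrix_mul_lid matrix_mul_rid]) blast
  have "S \<noteq> {}"
    using S(1) k_gt_1 by auto
  then obtain t where t: "t \<in> d ` S" "\<And>i. i \<in> S \<Longrightarrow> t \<le> d i" "\<And>j. j \<notin> S \<Longrightarrow> d j \<le> t"
    using threshold_exists[of S d thesis] S(2) by blast
  have "Y $ i $ j = 0 \<and> Y $ j $ i = 0"
  proof (cases "t = 0")
    case False
    then have tpos: "0 < t"
      using t(1) d by (auto simp: order_less_le)
    have "(G z)\<^sup>\<dagger> = G z \<and> G z ** G z = G z" if z: "cmod z = 1" for z
    proof -
      have "(\<Sum>i\<in>UNIV. Re (G z $ i $ i)) = k"
        by (rule normed_by_rdiag_trace(1)[where s=d and S=S and t=t, OF G(1)[OF z] d S(1,3) tpos t(2,3)]) auto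
      then show ?thesis
        using partial_isometry_projection[OF normed_by_in[OF G(1)[OF z]]] by (simp add: trace_def)
    qed
    then have "Y = 0"
      using G(2) by (intro projections_norming_all_rotations[of G Y]) auto
    then show ?thesis
      by simp
  next
    case True
    have "d j = 0" if "j \<notin> S" for j
      using t(3)[OF that] d[of j] True by simp
    then have sumS: "sum d S = sum d UNIV"
      by (intro sum.mono_neutral_left) auto
    have one: "Re (G z $ i $ i) = 1" if z: "cmod z = 1" for z
    proof -
      have le: "Re (G z $ l $ l) \<le> 1" for l
        using partial_isometry_diag(1)[OF normed_by_in[OF G(1)[OF z]], of l]
          complex_Re_le_cmod[of "G z $ l $ l"] by simp
      have "(\<Sum>l\<in>UNIV. d l * (1 - Re (G z $ l $ l))) = 0"
        using N_eq[OF G(1)[OF z]] S(3) sumS by (simp add: inner_rdiag algebra_simps sum_subtractf)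
      then have "d i * (1 - Re (G z $ i $ i)) = 0"
        using d le by (subst (asm) sum_nonneg_eq_0_iff) auto
      then show ?thesis
        using i by simp
    qed
    have fixed: "G z $ l $ i = (if l = i then 1 else 0)" "G z $ i $ l = (if l = i then 1 else 0)"
      if z: "cmod z = 1" for z l
      using partial_isometry_fixed_axis[OF normed_by_in[OF G(1)[OF z]] one[OF z]] .
    have row: "((G z)\<^sup>\<dagger> ** cmat_scale z Y) $ i $ l = z * Y $ i $ l"
      and col: "(cmat_scale z Y ** (G z)\<^sup>\<dagger>) $ l $ i = z * Y $ l $ i" if z: "cmod z = 1" for z l
      by (simp_all add: matrix_mult_nth fixed[OF z] if_distrib [of cnj] if_distrib [of "\<lambda>x. x * _"]
          if_distrib [of "\<lambda>x. _ * x"] cong: if_cong)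
    have psd: "psd ((G z)\<^sup>\<dagger> ** cmat_scale z Y)" "psd (cmat_scale z Y ** (G z)\<^sup>\<dagger>)" if "cmod z = 1" for z
      using normed_by_psd[OF G(2)[OF that]] by simp_all
    have *: "Im (z * Y $ i $ i) = 0" "0 \<le> Re (z * Y $ i $ i)" if z: "cmod z = 1" for z
      using psd_diag[OF psd(1)[OF z], of i] unfolding row[OF z] .
    \<comment> \<open>Opposite rotations make both the entry and its negative nonnegative.\<close>
    have "Y $ i $ i = 0"
      using *[of 1] *[of "-1"] by (simp add: complex_eq_iff)
    then show ?thesis
      using psd_zero_diag(1)[OF psd(1)[of 1], of i j] psd_zero_diag(2)[OF psd(2)[of 1], of i j]
      unfolding row[OF norm_one] col[OF norm_one] by simp
  qed
  then show "Y $ i $ j = 0" "Y $ j $ i = 0"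
    by simp_all
qed

lemma orthogonal_if_norm_additive:
  assumes add: "\<And>z. cmod z = 1 \<Longrightarrow> N (Z + cmat_scale z Y) = N Z + N Y"
  shows "Z\<^sup>\<dagger> ** Y = 0" "Z ** Y\<^sup>\<dagger> = 0"
proof -
  obtain U V d where Z: "unitary_matrix U" "unitary_matrix V" "\<And>i. 0 \<le> d i" "Z = U ** rdiag d ** V"
    by (rule singular_value_decomposition[of Z]) blast
  define Y' where "Y' = U\<^sup>\<dagger> ** Y ** V\<^sup>\<dagger>"
  have Y: "Y = U ** Y' ** V"
    using Z(1,2) by (simp add: Y'_def unitary_conj_inverse)
  have "N (rdiag d + cmat_scale z Y') = N (rdiag d) + N Y'" if "cmod z = 1" for z
  proof -
    have "Z + cmat_scale z Y = U ** (rdiag d + cmat_scale z Y') ** V"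
      by (simp add: Z(4) Y matrix_mult_add_left matrix_mult_add_right)
    then show ?thesis
      using add[OF that] Z(1,2) by (simp add: Z(4) Y N_unitary)
  qed
  note * = diag_orthogonal_if_norm_additive[OF Z(3) this]
  have "rdiag d ** Y' = 0"
    using * by (auto simp: vec_eq_iff)
  moreover have "Z\<^sup>\<dagger> ** Y = V\<^sup>\<dagger> ** (rdiag d ** (U\<^sup>\<dagger> ** (U ** Y'))) ** V"
    by (simp add: Z(4) Y matrix_mul_assoc)
  ultimately show "Z\<^sup>\<dagger> ** Y = 0"
    using Z(1) by (simp add: unitary_cancel)
  have "rdiag d ** Y'\<^sup>\<dagger> = 0"
    using * by (auto simp: vec_eq_iff)
  moreover have "Z ** Y\<^sup>\<dagger> = U ** (rdiag d ** (V ** (V\<^sup>\<dagger> ** Y'\<^sup>\<dagger>))) ** U\<^sup>\<dagger>"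
    by (simp add: Z(4) Y matrix_mul_assoc)
  ultimately show "Z ** Y\<^sup>\<dagger> = 0"
    using Z(2) by (simp add: unitary_cancel)
qed

text \<open>Produces matrices of rank at most one normed by \<open>F\<close> through a formula
  continuous in \<open>F\<close>, so they follow when norming partial isometries converge.\<close>

lemma normed_by_rank_one:
  assumes "F \<in> partial_isometries k"
  shows "normed_by F (F ** F\<^sup>\<dagger> ** outer w w ** F)"
proof -
  obtain U V S where F: "unitary_matrix U" "unitary_matrix V" "F = U ** proj S ** V" "card S = k"
    using assms by (auto simp: partial_isometries_def)
  define b where "b = proj S *v (U\<^sup>\<dagger> *v w)"
  have "F ** F\<^sup>\<dagger> = U ** (proj S ** (V ** (V\<^sup>\<dagger> ** (proj S ** U\<^sup>\<dagger>))))"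
    by (simp add: F(3) matrix_mul_assoc)
  also have "\<dots> = U ** (proj S ** proj S) ** U\<^sup>\<dagger>"
    using F by (simp add: unitary_cancel matrix_mul_assoc del: proj_mult_proj)
  finally have FF: "F ** F\<^sup>\<dagger> = U ** proj S ** U\<^sup>\<dagger>"
    by simp
  have "F ** F\<^sup>\<dagger> ** outer w w ** F = outer (U *v b) (V\<^sup>\<dagger> *v b)"
    unfolding FF by (simp add: mult_outer outer_mult F(3) b_def matrix_vector_mul_assoc matrix_mul_assoc)
  also have "\<dots> = U ** outer b b ** V"
    by (simp add: mult_outer outer_mult)
  finally have *: "F ** F\<^sup>\<dagger> ** outer w w ** F = U ** outer b b ** V" .
  have "normed_by (proj S) (outer b b)"
    by (rule normed_by_outer[OF F(4)]) (simp add: b_def)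
  then show ?thesis
    using normed_by_unitary[OF _ F(1,2), of "proj S" "outer b b"] by (simp only: * F(3)[symmetric])
qed

text \<open>\<open>inner (G m) F\<close> tends to \<open>k\<close>, and for partial isometries of rank \<open>k\<close> the inner product
  determines the distance.\<close>

lemma normed_by_tendsto:
  assumes A: "A \<longlonglongrightarrow> F" and F: "F \<in> partial_isometries k" "N F = k" and G: "\<And>m. normed_by (G m) (A m)"
  shows "G \<longlonglongrightarrow> F"
proof -
  have PI: "G m \<in> partial_isometries k" for m
    using G by (rule normed_by_in)
  have A0: "(\<lambda>m. A m - F) \<longlonglongrightarrow> 0"
    using A by (rule LIM_zero)
  have "norm (inner (G m) (A m - F)) \<le> sqrt k * norm (A m - F)" for m
    using Cauchy_Schwarz_ineq2[of "G m" "A m - F"] by (simp add: partial_isometry_norm[OF PI])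
  then have "(\<lambda>m. inner (G m) (A m - F)) \<longlonglongrightarrow> 0"
    by (rule Lim_null_comparison[OF always_eventually[OF allI]])
      (rule tendsto_mult_right_zero[OF tendsto_norm_zero[OF A0]])
  then have "(\<lambda>m. N (A m) - inner (G m) (A m - F)) \<longlonglongrightarrow> N F - 0"
    by (intro tendsto_diff tendsto_N A)
  moreover have "N (A m) - inner (G m) (A m - F) = inner (G m) F" for m
    using N_eq[OF G[of m]] by (simp add: inner_diff_right)
  ultimately have "(\<lambda>m. inner (G m) F) \<longlonglongrightarrow> k"
    by (simp add: F(2))
  then have "(\<lambda>m. 2 * (real k - inner (G m) F)) \<longlonglongrightarrow> 2 * (real k - real k)"
    by (intro tendsto_intros)
  moreover have "(norm (G m - F))\<^sup>2 = 2 * (real k - inner (G m) F)" for m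
    using partial_isometry_inner_self[OF PI[of m]] partial_isometry_inner_self[OF F(1)]
    by (simp add: power2_norm_eq_inner inner_diff_left inner_diff_right inner_commute[of F "G m"])
  ultimately have "(\<lambda>m. (norm (G m - F))\<^sup>2) \<longlonglongrightarrow> 0"
    by simp
  then have "(\<lambda>m. sqrt ((norm (G m - F))\<^sup>2)) \<longlonglongrightarrow> sqrt 0"
    by (rule tendsto_real_sqrt)
  then have "(\<lambda>m. norm (G m - F)) \<longlonglongrightarrow> 0"
    by simp
  then show ?thesis
    by (rule LIM_zero_cancel[OF tendsto_norm_zero_cancel])
qed

end

section \<open>Images of faces and of orthogonal rank one matrices\<close>

locale parallel_preserver = ky_fan k index_type
  for k :: nat and index_type :: "'n::finite itself" +
  fixes T :: "complex ^ 'n ^ 'n \<Rightarrow> complex ^ 'n ^ 'n"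
  assumes bij: "bij T"
    and T_add: "T (A + B) = T A + T B"
    and T_scale: "T (cmat_scale c A) = cmat_scale c (T A)"
    and T_parallel: "parallel_wrt (ky_fan_norm k) A B \<Longrightarrow> parallel_wrt (ky_fan_norm k) (T A) (T B)"
begin

lemma linear_T: "linear T"
  by (rule linearI) (simp_all add: T_add T_scale scaleR_matrix_eq)

lemma additive_on_face:
  assumes A: "normed_by F A" "smooth (T A)" and B: "normed_by F B1" "normed_by F B2"
  shows "N (T B1 + T B2) = N (T B1) + N (T B2)"
proof -
  obtain U V S where F: "unitary_matrix U" "unitary_matrix V" "F = U ** proj S ** V" "card S = k"
    using normed_by_in[OF A(1)] by (auto simp: partial_isometries_def)
  obtain F' where F': "normed_by F' (T A)"
    using ex_normed_by by blast
  obtain U' V' where F'_eq: "unitary_matrix U'" "unitary_matrix V'" "F' = U' ** proj S ** V'"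
    by (rule partial_isometryE[OF normed_by_in[OF F'] F(4)])
  define f where "f X = U'\<^sup>\<dagger> ** T (U ** X ** V) ** V'\<^sup>\<dagger>" for X
  have Tf: "T B = U' ** f (U\<^sup>\<dagger> ** B ** V\<^sup>\<dagger>) ** V'" for B
    using F(1,2) F'_eq(1,2) by (simp add: f_def unitary_conj_inverse)
  have "N (f (U\<^sup>\<dagger> ** B1 ** V\<^sup>\<dagger>) + f (U\<^sup>\<dagger> ** B2 ** V\<^sup>\<dagger>)) =
      N (f (U\<^sup>\<dagger> ** B1 ** V\<^sup>\<dagger>)) + N (f (U\<^sup>\<dagger> ** B2 ** V\<^sup>\<dagger>))"
  proof (rule face_map_additive[where f=f, OF _ _ _ F(4)])
    show "f (A + B) = f A + f B" for A B
      by (simp add: f_def matrix_mult_add_left matrix_mult_add_right T_add)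
    show "f (cmat_scale c A) = cmat_scale c (f A)" for c A
      by (simp add: f_def T_scale)
    show "inj f"
    proof (rule injI)
      fix X Y assume "f X = f Y"
      then have "T (U ** X ** V) = T (U ** Y ** V)"
        unfolding f_def using F'_eq(1,2) by (metis unitary_conj_inverse(2))
      then have "U ** X ** V = U ** Y ** V"
        using bij by (metis bij_is_inj injD)
      then show "X = Y"
        using F(1,2) by (metis unitary_conj_inverse(1))
    qed
    show "\<exists>c. cmod c = 1 \<and> normed_by (proj S) (cmat_scale c (f B))" if "normed_by (proj S) B" for B
    proof -
      have "normed_by F (cmat_scale 1 (U ** B ** V))"
        using normed_by_unitary[OF that F(1,2)] by (simp add: F(3))
      then have "parallel_wrt N A (U ** B ** V)"
        unfolding parallel_iff using A(1) by (metis norm_one)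
      then obtain c G where c: "cmod c = 1" "normed_by G (T A)" "normed_by G (cmat_scale c (T (U ** B ** V)))"
        using T_parallel unfolding parallel_iff by blast
      \<comment> \<open>Parallelism supplies only some common norming partial isometry of the two
        images; smoothness of \<open>T A\<close> identifies it.\<close>
      then have "G = F'"
        using A(2) F' unfolding smooth_def by blast
      then have "normed_by (U'\<^sup>\<dagger> ** F' ** V'\<^sup>\<dagger>) (U'\<^sup>\<dagger> ** cmat_scale c (T (U ** B ** V)) ** V'\<^sup>\<dagger>)"
        using c(3) F'_eq(1,2) by (intro normed_by_unitary) auto
      then have "normed_by (proj S) (cmat_scale c (f B))"
        using F'_eq by (simp add: f_def unitary_conj_inverse)
      then show ?thesis
        using c(1) by blast
    qed
    have "normed_by (U\<^sup>\<dagger> ** F ** V\<^sup>\<dagger>) (U\<^sup>\<dagger> ** B ** V\<^sup>\<dagger>)" if "normed_by F B" for B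
      using that F by (intro normed_by_unitary) auto
    then show "normed_by (proj S) (U\<^sup>\<dagger> ** B1 ** V\<^sup>\<dagger>)" "normed_by (proj S) (U\<^sup>\<dagger> ** B2 ** V\<^sup>\<dagger>)"
      using B F by (simp_all add: unitary_conj_inverse)
  qed
  then show ?thesis
    using F'_eq(1,2) unfolding Tf by (simp add: N_unitary flip: matrix_mult_add_left matrix_mult_add_right)
qed

text \<open>Smoothness is needed on the image side, so the approximants are chosen near
  \<open>T B\<close> and pulled back by \<open>inv T\<close>, which is continuous as a linear map in
  finite dimension.\<close>

lemma smooth_image_approximation:
  obtains A where "A \<longlonglongrightarrow> B" "\<And>m. smooth (T (A m))"
proof -
  have "\<exists>Z. smooth Z \<and> norm (Z - T B) < inverse (real (Suc m))" for m
    by (rule smooth_dense) simp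
  then obtain Z where Z: "\<And>m. smooth (Z m)" "\<And>m. norm (Z m - T B) < inverse (real (Suc m))"
    by metis
  have "(\<lambda>m. Z m - T B) \<longlonglongrightarrow> 0"
    by (rule Lim_null_comparison[OF always_eventually LIMSEQ_inverse_real_of_nat])
      (use Z(2) less_imp_le in blast)
  then have lim: "Z \<longlonglongrightarrow> T B"
    by (rule LIM_zero_cancel)
  have inj: "inj T" and T_inv: "T (inv T X) = X" for X
    using bij by (auto simp: bij_def surj_f_inv_f)
  have "linear (inv T)"
  proof (rule linearI)
    show "inv T (X + Y) = inv T X + inv T Y" for X Y
      by (rule injD[OF inj]) (simp add: T_inv T_add)
    show "inv T (r *\<^sub>R X) = r *\<^sub>R inv T X" for r X
      by (rule injD[OF inj]) (simp add: T_inv T_scale scaleR_matrix_eq)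
  qed
  then have "bounded_linear (inv T)"
    by (simp add: linear_conv_bounded_linear)
  then have "(\<lambda>m. inv T (Z m)) \<longlonglongrightarrow> inv T (T B)"
    using lim by (rule bounded_linear.tendsto)
  then show thesis
    using that[of "\<lambda>m. inv T (Z m)"] Z(1) inj by (simp add: T_inv)
qed

lemma additive_on_orthogonal:
  assumes U: "unitary_matrix U" and V: "unitary_matrix V" and ij: "i \<noteq> j"
  shows "N (T (U ** munit i i ** V) + T (U ** munit j j ** V)) =
    N (T (U ** munit i i ** V)) + N (T (U ** munit j j ** V))"
proof -
  have "card {i, j} = 2"
    using ij by simp
  then obtain S where S: "{i, j} \<subseteq> S" "card S = k"
    using exists_subset_between[of "{i, j}" k "UNIV :: 'n set"] k_gt_1 k_le by auto
  define F where "F = U ** proj S ** V"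
  have F: "F \<in> partial_isometries k"
    using U V S by (simp add: F_def partial_isometries_unitary)
  have NF: "N F = k"
    using normed_by_proj_proj[OF S(2)] U V S(2)
    by (simp add: F_def N_unitary normed_by_def inner_proj_proj)
  obtain A where A: "A \<longlonglongrightarrow> F" "\<And>m. smooth (T (A m))"
    by (rule smooth_image_approximation) blast
  have "\<forall>m. \<exists>F. normed_by F (A m)"
    using ex_normed_by by blast
  then obtain G where G: "\<And>m. normed_by (G m) (A m)"
    by metis
  have lim: "G \<longlonglongrightarrow> F"
    using A(1) F NF G by (rule normed_by_tendsto)
  \<comment> \<open>At \<open>F\<close> this recovers \<open>U ** munit l l ** V\<close> for
    \<open>l \<in> S\<close>; at \<open>G m\<close> it is a matrix normed by \<open>G m\<close>, to
    which \<open>additive_on_face\<close> applies.\<close>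
  define R where "R F l = F ** F\<^sup>\<dagger> ** outer (U *v axis l 1) (U *v axis l 1) ** F" for F :: "complex ^ 'n ^ 'n" and l
  have R: "R F l = U ** munit l l ** V" if "l \<in> S" for l
  proof -
    have "proj S *v axis l 1 = axis l 1"
      using that by (auto simp: vec_eq_iff axis_def)
    then have 1: "F\<^sup>\<dagger> *v (U *v axis l 1) = V\<^sup>\<dagger> *v axis l 1"
      "F *v (V\<^sup>\<dagger> *v axis l 1) = U *v axis l 1"
      using unitary_cancel(5,6)[OF U] unitary_cancel(5,6)[OF V]
      by (simp_all add: F_def flip: matrix_vector_mul_assoc)
    have "R F l = outer (F *v (F\<^sup>\<dagger> *v (U *v axis l 1))) (F\<^sup>\<dagger> *v (U *v axis l 1))"
      by (simp add: R_def mult_outer outer_mult matrix_vector_mul_assoc matrix_mul_assoc)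
    also have "\<dots> = U ** munit l l ** V"
      unfolding 1 by (simp add: munit_eq_outer mult_outer outer_mult)
    finally show ?thesis .
  qed
  have "(\<lambda>m. R (G m) l) \<longlonglongrightarrow> R F l" for l
    unfolding R_def by (intro tendsto_matrix_mult tendsto_adj lim tendsto_const)
  moreover have "bounded_linear T"
    using linear_T by (simp add: linear_conv_bounded_linear)
  ultimately have TR: "(\<lambda>m. T (R (G m) l)) \<longlonglongrightarrow> T (R F l)" for l
    by (metis bounded_linear.tendsto)
  have "N (T (R (G m) i) + T (R (G m) j)) = N (T (R (G m) i)) + N (T (R (G m) j))" for m
    unfolding R_def by (intro additive_on_face[OF G[of m] A(2)[of m]] normed_by_rank_one normed_by_in[OF G])
  moreover have "(\<lambda>m. N (T (R (G m) i) + T (R (G m) j))) \<longlonglongrightarrow> N (T (R F i) + T (R F j))"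
    by (intro tendsto_N tendsto_add TR)
  moreover have "(\<lambda>m. N (T (R (G m) i)) + N (T (R (G m) j))) \<longlonglongrightarrow> N (T (R F i)) + N (T (R F j))"
    by (intro tendsto_N tendsto_add TR)
  ultimately have "N (T (R F i) + T (R F j)) = N (T (R F i)) + N (T (R F j))"
    using LIMSEQ_unique by simp
  then show ?thesis
    using S(1) by (simp add: R)
qed

lemma T_orthogonal:
  assumes U: "unitary_matrix U" and V: "unitary_matrix V" and ij: "i \<noteq> j"
  shows "(T (U ** munit i i ** V))\<^sup>\<dagger> ** T (U ** munit j j ** V) = 0"
    "T (U ** munit i i ** V) ** (T (U ** munit j j ** V))\<^sup>\<dagger> = 0"
proof -
  have add: "N (T (U ** munit i i ** V) + cmat_scale z (T (U ** munit j j ** V))) =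
      N (T (U ** munit i i ** V)) + N (T (U ** munit j j ** V))" if z: "cmod z = 1" for z
  proof -
    \<comment> \<open>The rotation \<open>z\<close> is absorbed into the unitary factor
      \<open>V\<close>, so additivity without rotation, known for all \<open>V\<close>, yields it
      for every \<open>z\<close>.\<close>
    define D where "D = cdiag (\<lambda>l. if l = j then z else 1)"
    have D: "unitary_matrix (D ** V)"
      unfolding D_def using z by (intro unitary_mult unitary_cdiag V) simp
    have "munit i i ** D = munit i i" "munit j j ** D = cmat_scale z (munit j j)"
      using ij by (auto simp: vec_eq_iff D_def munit_nth)
    then have "U ** munit i i ** (D ** V) = U ** munit i i ** V"
      "U ** munit j j ** (D ** V) = cmat_scale z (U ** munit j j ** V)"
      by (simp_all add: matrix_mul_assoc) (simp_all flip: matrix_mul_assoc)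
    then show ?thesis
      using additive_on_orthogonal[OF U D ij] z by (simp add: T_scale N_rotate)
  qed
  show "(T (U ** munit i i ** V))\<^sup>\<dagger> ** T (U ** munit j j ** V) = 0"
    "T (U ** munit i i ** V) ** (T (U ** munit j j ** V))\<^sup>\<dagger> = 0"
    by (rule orthogonal_if_norm_additive[OF add]; assumption)+
qed

end

subsection \<open>Linear maps preserving orthogonality of rank one matrices\<close>

text \<open>A complex \<open>c\<close> is what makes the Householder matrix map \<open>a\<close>
  exactly to \<open>b\<close> and not merely up to a phase.\<close>

lemma ex_unitary_reflection:
  fixes a b :: "complex ^ 'n"
  assumes "norm a = 1" "norm b = 1"
  obtains Q where "unitary_matrix Q" "Q *v a = b" "\<And>c. cdot a c = 0 \<Longrightarrow> cdot b c = 0 \<Longrightarrow> Q *v c = c"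
proof (cases "a = b")
  case True
  then show thesis
    using that[of "mat 1"] by simp
next
  case False
  define c where "c = cdot (a - b) a"
  have norm: "(norm (a - b))\<^sup>2 = 2 * Re c"
    using assms by (simp add: c_def cdot_diff_left Re_cdot power2_norm_eq_inner inner_diff_left
        inner_diff_right inner_commute norm_eq_1)
  then have c: "c \<noteq> 0"
    using False by auto
  define Q where "Q = mat 1 - cmat_scale (1 / c) (outer (a - b) (a - b))"
  have Q: "Q *v v = v - (cdot (a - b) v / c) *s (a - b)" for v
  proof -
    have "Q *v v = v - cmat_scale (1 / c) (outer (a - b) (a - b)) *v v"
      by (simp add: Q_def matrix_vector_mult_diff_rdistrib)
    also have "cmat_scale (1 / c) (outer (a - b) (a - b)) = outer ((1 / c) *s (a - b)) (a - b)"
      by (simp add: vec_eq_iff flip: diff_divide_distrib)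
    finally show ?thesis
      by (simp add: outer_mult_vec)
  qed
  show thesis
  proof (rule that)
    show "unitary_matrix Q"
      unfolding Q_def using c norm by (rule rank_one_perturbation_unitary)
    show "Q *v a = b"
      using c by (simp add: Q flip: c_def)
    show "Q *v v = v" if "cdot a v = 0" "cdot b v = 0" for v
      by (simp add: Q cdot_diff_left that)
  qed
qed

text \<open>The second reflection moves only vectors orthogonal to \<open>w\<close>, so it does not
  disturb the first column.\<close>

lemma ex_unitary_two_columns:
  fixes w w' :: "complex ^ 'n"
  assumes ij: "i \<noteq> j" and w: "norm w = 1" "norm w' = 1" "cdot w w' = 0"
  obtains U where "unitary_matrix U" "U *v axis i 1 = w" "U *v axis j 1 = w'"
proof -
  have "norm (axis i (1 :: complex)) = 1"
    by simp
  then obtain P where P: "unitary_matrix P" "P *v axis i 1 = w"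
    using w(1) by (rule ex_unitary_reflection) blast
  have "norm (P *v axis j 1) = 1"
    using P by (simp add: unitary_norm)
  then obtain Q where Q: "unitary_matrix Q" "Q *v (P *v axis j 1) = w'"
    "\<And>c. cdot (P *v axis j 1) c = 0 \<Longrightarrow> cdot w' c = 0 \<Longrightarrow> Q *v c = c"
    using w(2) by (rule ex_unitary_reflection) blast
  have "cdot (P *v axis j 1) w = 0"
    using ij unfolding P(2)[symmetric] unitary_cdot[OF P(1)] cdot_axis_left by (simp add: axis_def)
  moreover have "cdot w' w = 0"
    using w(3) cnj_cdot[of w w'] by simp
  ultimately have "Q *v w = w"
    by (rule Q(3))
  then show thesis
    using that[of "Q ** P"] P Q by (simp flip: matrix_vector_mul_assoc)
qed

text \<open>What the classification retains of \<open>T\<close>; no norm appears any more.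
  Orthogonality of \<open>w, w'\<close> and of \<open>v, v'\<close> makes the two rank one matrices
  orthogonal on both sides.\<close>

definition orth_preserving :: "(complex ^ 'n ^ 'n \<Rightarrow> complex ^ 'n ^ 'n) \<Rightarrow> bool"
  where "orth_preserving f \<longleftrightarrow>
    (\<forall>A B. f (A + B) = f A + f B) \<and> (\<forall>c A. f (cmat_scale c A) = cmat_scale c (f A)) \<and> inj f \<and>
    (\<forall>w v w' v'. cdot w w' = 0 \<longrightarrow> cdot v v' = 0 \<longrightarrow>
      (f (outer w v))\<^sup>\<dagger> ** f (outer w' v') = 0 \<and> f (outer w v) ** (f (outer w' v'))\<^sup>\<dagger> = 0)"

lemma orth_preserving_add: "orth_preserving f \<Longrightarrow> f (A + B) = f A + f B"
  and orth_preserving_scale: "orth_preserving f \<Longrightarrow> f (cmat_scale c A) = cmat_scale c (f A)"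
  and orth_preserving_inj: "orth_preserving f \<Longrightarrow> inj f"
  and orth_preserving_orth:
    "orth_preserving f \<Longrightarrow> cdot w w' = 0 \<Longrightarrow> cdot v v' = 0 \<Longrightarrow> (f (outer w v))\<^sup>\<dagger> ** f (outer w' v') = 0"
    "orth_preserving f \<Longrightarrow> cdot w w' = 0 \<Longrightarrow> cdot v v' = 0 \<Longrightarrow> f (outer w v) ** (f (outer w' v'))\<^sup>\<dagger> = 0"
  by (simp_all add: orth_preserving_def)

lemma orth_preserving_eq_0_iff:
  assumes "orth_preserving f"
  shows "f A = 0 \<longleftrightarrow> A = 0"
proof -
  have "f 0 = 0"
    using orth_preserving_scale[OF assms, of 0 0] by simp
  then show ?thesis
    using orth_preserving_inj[OF assms] by (metis injD)
qed

lemma (in parallel_preserver) orth_preserving_T: "orth_preserving T"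
proof -
  have "(T (outer w v))\<^sup>\<dagger> ** T (outer w' v') = 0 \<and> T (outer w v) ** (T (outer w' v'))\<^sup>\<dagger> = 0"
    if orth: "cdot w w' = 0" "cdot v v' = 0" for w v w' v'
  proof (cases "w = 0 \<or> v = 0 \<or> w' = 0 \<or> v' = 0")
    case True
    moreover have "T 0 = 0"
      using T_scale[of 0 0] by simp
    moreover have "outer (0 :: complex ^ 'n) x = 0" "outer x (0 :: complex ^ 'n) = 0" for x :: "complex ^ 'n"
      by (simp_all add: vec_eq_iff)
    ultimately show ?thesis
      by auto
  next
    case False
    obtain i j :: 'n where ij: "i \<noteq> j"
      using k_gt_1 k_le by (metis card_le_Suc0_iff_eq finite_class.finite_UNIV UNIV_I One_nat_def
          linorder_not_less order_less_le_trans)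
    define n where "n x = complex_of_real (inverse (norm x)) *s x" for x :: "complex ^ 'n"
    have n: "x = complex_of_real (norm x) *s n x" "norm (n x) = 1" if "x \<noteq> 0" for x
    proof -
      have "n x = inverse (norm x) *\<^sub>R x"
        by (simp add: n_def vec_eq_iff scaleR_conv_of_real[where 'a = complex])
      then show "norm (n x) = 1"
        using that by simp
      show "x = complex_of_real (norm x) *s n x"
        using that by (simp add: n_def vec_eq_iff)
    qed
    have "cdot (n w) (n w') = 0" "cdot (n v) (n v') = 0"
      using orth by (simp_all add: n_def cdot_smult_left cdot_smult_right)
    then obtain U V where UV: "unitary_matrix U" "U *v axis i 1 = n w" "U *v axis j 1 = n w'"
      "unitary_matrix V" "V *v axis i 1 = n v" "V *v axis j 1 = n v'"
      using ex_unitary_two_columns[OF ij n(2) n(2)] False by metis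
    have "U ** munit l l ** V\<^sup>\<dagger> = outer (U *v axis l 1) (V *v axis l 1)" for l
      by (simp add: munit_eq_outer mult_outer outer_mult)
    note orth_n = T_orthogonal[OF UV(1) _ ij, of "V\<^sup>\<dagger>", unfolded this UV(2,3,5,6)]
    have outer: "outer x y = cmat_scale (complex_of_real (norm x * norm y)) (outer (n x) (n y))"
      if "x \<noteq> 0" "y \<noteq> 0" for x y
    proof -
      have "outer (a *s x) (b *s y) = cmat_scale (a * cnj b) (outer x y)" for a b and x y :: "complex ^ 'n"
        by (simp add: vec_eq_iff)
      then show ?thesis
        using n(1)[OF that(1)] n(1)[OF that(2)] by (metis complex_cnj_complex_of_real of_real_mult)
    qed
    obtain a b where ab: "outer w v = cmat_scale a (outer (n w) (n v))"
      "outer w' v' = cmat_scale b (outer (n w') (n v'))"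
      using outer False by blast
    have "T (outer w v) = cmat_scale a (T (outer (n w) (n v)))"
      "T (outer w' v') = cmat_scale b (T (outer (n w') (n v')))"
      unfolding ab T_scale by (rule refl)+
    then show ?thesis
      using orth_n UV(4) by simp
  qed
  then show ?thesis
    using T_add T_scale bij_is_inj[OF bij] by (simp add: orth_preserving_def)
qed

text \<open>There are as many matrices as dimensions, and their ranges are nonzero and pairwise
  orthogonal, so each range is a line. The same holds for the adjoints, and unit vectors on these
  lines form the two unitary matrices.\<close>

lemma orthogonal_family_normal_form:
  fixes Z :: "'n \<Rightarrow> complex ^ 'n ^ 'n"
  assumes Z: "\<And>i. Z i \<noteq> 0" "\<And>i j. i \<noteq> j \<Longrightarrow> (Z i)\<^sup>\<dagger> ** Z j = 0" "\<And>i j. i \<noteq> j \<Longrightarrow> Z i ** (Z j)\<^sup>\<dagger> = 0"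
  obtains U W l where "unitary_matrix U" "unitary_matrix W"
    "\<And>i. Z i = U ** cmat_scale (l i) (munit i i) ** W"
proof -
  have unit: "\<exists>x. norm (A *v x) = 1" if "A \<noteq> 0" for A :: "complex ^ 'n ^ 'n"
  proof -
    obtain j where j: "A *v axis j 1 \<noteq> 0"
      using \<open>A \<noteq> 0\<close> by (metis mult_axis_nth vec_eq_iff zero_index)
    have "A *v (inverse (norm (A *v axis j 1)) *\<^sub>R axis j 1) = inverse (norm (A *v axis j 1)) *\<^sub>R (A *v axis j 1)"
      by (simp add: matrix_vector_mult_def vec_eq_iff scaleR_sum_right)
    then show ?thesis
      using j by (intro exI[of _ "inverse (norm (A *v axis j 1)) *\<^sub>R axis j 1"]) simp
  qed
  have adj0: "A\<^sup>\<dagger> \<noteq> 0" if "A \<noteq> 0" for A :: "complex ^ 'n ^ 'n"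
    using that by (metis adj_adj adj_zero)
  obtain x y where xy: "\<And>i. norm (Z i *v x i) = 1" "\<And>i. norm ((Z i)\<^sup>\<dagger> *v y i) = 1"
    using unit[OF Z(1)] unit[OF adj0[OF Z(1)]] by metis
  define u v where "u i = Z i *v x i" and "v i = (Z i)\<^sup>\<dagger> *v y i" for i
  define U where "U = (\<chi> a b. u b $ a)"
  define W where "W = (\<chi> a b. v b $ a)"
  have axis: "U *v axis i 1 = u i" "W *v axis i 1 = v i" for i
    by (simp_all add: vec_eq_iff U_def W_def)
  have orth: "cdot (u i) (u j) = 0" "cdot (v i) (v j) = 0" if "i \<noteq> j" for i j
    using Z(2,3)[OF that[symmetric]] by (simp_all add: u_def v_def cdot_adj matrix_vector_mul_assoc)
  have "cdot (u i) (u i) = 1" "cdot (v i) (v i) = 1" for i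
    using xy by (simp_all add: u_def v_def cdot_self)
  then have UW: "unitary_matrix U" "unitary_matrix W"
    using orth by (auto intro!: unitaryI simp: vec_eq_iff adj_mult_cdot axis mat_def)
  have 0: "(U\<^sup>\<dagger> ** Z i ** W) $ a $ b = 0" if "a \<noteq> i \<or> b \<noteq> i" for i a b
  proof -
    have "(U\<^sup>\<dagger> ** Z i ** W) $ a $ b = cdot (u a) (Z i *v v b)"
      by (simp add: adj_mult_cdot axis flip: matrix_mul_assoc) (simp add: axis flip: matrix_vector_mul_assoc)
    also have "\<dots> = 0"
      using that
    proof
      assume "a \<noteq> i"
      then show ?thesis
        using Z(2)[of i a] by (simp add: u_def cdot_adj matrix_vector_mul_assoc)
    next
      assume "b \<noteq> i"
      then show ?thesis
        using Z(3)[of i b] by (simp add: v_def matrix_vector_mul_assoc)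
    qed
    finally show ?thesis .
  qed
  have "Z i = U ** cmat_scale ((U\<^sup>\<dagger> ** Z i ** W) $ i $ i) (munit i i) ** W\<^sup>\<dagger>" for i
  proof -
    have "cmat_scale ((U\<^sup>\<dagger> ** Z i ** W) $ i $ i) (munit i i) = U\<^sup>\<dagger> ** Z i ** W"
      using 0 by (auto simp: vec_eq_iff munit_nth)
    then show ?thesis
      using unitary_conj_inverse(2)[OF UW(1), of "W\<^sup>\<dagger>" "Z i"] UW by simp
  qed
  then show thesis
    using that[of U "W\<^sup>\<dagger>" "\<lambda>i. (U\<^sup>\<dagger> ** Z i ** W) $ i $ i"] UW by simp
qed

lemma orth_preserving_unitary:
  assumes f: "orth_preserving f" and U: "unitary_matrix U" and W: "unitary_matrix W"
  shows "orth_preserving (\<lambda>X. U ** f X ** W)"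
proof -
  have inj: "inj (\<lambda>X. U ** f X ** W)"
  proof (rule injI)
    fix X Y assume "U ** f X ** W = U ** f Y ** W"
    then have "f X = f Y"
      using unitary_conj_inverse(1)[OF U W] by metis
    then show "X = Y"
      using orth_preserving_inj[OF f] by (simp add: injD)
  qed
  have 1: "(U ** A ** W)\<^sup>\<dagger> ** (U ** B ** W) = W\<^sup>\<dagger> ** (A\<^sup>\<dagger> ** B) ** W" for A B
  proof -
    have "(U ** A ** W)\<^sup>\<dagger> ** (U ** B ** W) = W\<^sup>\<dagger> ** (A\<^sup>\<dagger> ** (U\<^sup>\<dagger> ** (U ** B))) ** W"
      by (simp add: matrix_mul_assoc)
    then show ?thesis
      by (simp add: unitary_cancel[OF U])
  qed
  have 2: "(U ** A ** W) ** (U ** B ** W)\<^sup>\<dagger> = U ** (A ** B\<^sup>\<dagger>) ** U\<^sup>\<dagger>" for A B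
  proof -
    have "(U ** A ** W) ** (U ** B ** W)\<^sup>\<dagger> = U ** (A ** (W ** (W\<^sup>\<dagger> ** B\<^sup>\<dagger>))) ** U\<^sup>\<dagger>"
      by (simp add: matrix_mul_assoc)
    then show ?thesis
      by (simp add: unitary_cancel[OF W])
  qed
  show ?thesis
    unfolding orth_preserving_def 1 2 using inj
    by (simp add: matrix_mult_add_left matrix_mult_add_right orth_preserving_add[OF f]
        orth_preserving_scale[OF f] orth_preserving_orth[OF f])
qed

lemma transpose_scale [simp]: "transpose (cmat_scale c A) = cmat_scale c (transpose A)"
  and transpose_add [simp]: "transpose (A + B) = transpose A + transpose (B :: complex ^ 'n ^ 'm)"
  and transpose_munit [simp]: "transpose (munit p q) = munit q p"
  by (auto simp: vec_eq_iff transpose_def munit_nth)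

lemma orth_preserving_transpose:
  assumes f: "orth_preserving f"
  shows "orth_preserving (\<lambda>X. f (transpose X))"
proof -
  define conj :: "complex ^ 'a \<Rightarrow> complex ^ 'a" where "conj v = (\<chi> i. cnj (v $ i))" for v
  have "transpose (outer w v) = outer (conj v) (conj w)" for w v :: "complex ^ 'a"
    by (simp add: vec_eq_iff transpose_def conj_def)
  moreover have "cdot (conj v) (conj w) = cnj (cdot v w)" for v w
    by (simp add: cdot_def conj_def)
  moreover have "inj (\<lambda>X. f (transpose X))"
  proof (rule injI)
    fix X Y assume "f (transpose X) = f (transpose Y)"
    then have "transpose X = transpose Y"
      by (rule injD[OF orth_preserving_inj[OF f]])
    then show "X = Y"
      by (metis transpose_transpose)
  qed
  ultimately show ?thesis
    using f by (simp add: orth_preserving_def)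
qed

section \<open>Images of rank one matrices and of matrix units\<close>

lemma orth_preserving_rank_one:
  fixes f :: "complex ^ 'n ^ 'n \<Rightarrow> complex ^ 'n ^ 'n"
  assumes f: "orth_preserving f" and U: "unitary_matrix U" and V: "unitary_matrix V"
  obtains W W' l where "unitary_matrix W" "unitary_matrix W'"
    "\<And>i. f (U ** munit i i ** V) = W ** cmat_scale (l i) (munit i i) ** W'"
proof (rule orthogonal_family_normal_form[of "\<lambda>i. f (U ** munit i i ** V)"])
  have outer: "U ** munit i i ** V = outer (U *v axis i 1) (V\<^sup>\<dagger> *v axis i 1)" for i
    by (simp add: munit_eq_outer mult_outer outer_mult)
  show "f (U ** munit i i ** V) \<noteq> 0" for i
  proof
    assume "f (U ** munit i i ** V) = 0"
    then have "U\<^sup>\<dagger> ** (U ** munit i i ** V) ** V\<^sup>\<dagger> = 0"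
      by (simp add: orth_preserving_eq_0_iff[OF f])
    then have "munit i i $ i $ i = (0 :: complex)"
      by (simp add: unitary_conj_inverse U V)
    then show False
      by (simp add: munit_nth)
  qed
  fix i j :: 'n assume "i \<noteq> j"
  then have "cdot (U *v axis i 1) (U *v axis j 1) = 0" "cdot (V\<^sup>\<dagger> *v axis i 1) (V\<^sup>\<dagger> *v axis j 1) = 0"
    using U V by (simp_all add: unitary_cdot cdot_axis_left) (simp_all add: axis_def)
  then show "(f (U ** munit i i ** V))\<^sup>\<dagger> ** f (U ** munit j j ** V) = 0"
    "f (U ** munit i i ** V) ** (f (U ** munit j j ** V))\<^sup>\<dagger> = 0"
    unfolding outer by (simp_all add: orth_preserving_orth[OF f])
qed blast

text \<open>Rank at most one is preserved because every rank one matrix is a multiple of a member of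
  a full orthogonal family. Vanishing of minors is the form that can be tested entry by
  entry.\<close>

lemma orth_preserving_minor:
  fixes f :: "complex ^ 'n ^ 'n \<Rightarrow> complex ^ 'n ^ 'n"
  assumes f: "orth_preserving f"
  shows "f (outer w v) $ a $ b * f (outer w v) $ c $ d = f (outer w v) $ a $ d * f (outer w v) $ c $ b"
proof (cases "w = 0 \<or> v = 0")
  case True
  then have "outer w v = 0"
    by (auto simp: vec_eq_iff)
  then show ?thesis
    using orth_preserving_eq_0_iff[OF f, of 0] by simp
next
  case False
  obtain i :: 'n where True
    by blast
  have unit: "\<exists>U t. unitary_matrix U \<and> x = t *s (U *v axis i 1)" if "x \<noteq> 0" for x :: "complex ^ 'n"
  proof -
    have "norm (axis i (1 :: complex)) = 1" "norm (inverse (norm x) *\<^sub>R x) = 1"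
      using that by simp_all
    then obtain U where U: "unitary_matrix U" "U *v axis i 1 = inverse (norm x) *\<^sub>R x"
      by (rule ex_unitary_reflection) blast
    have "x = complex_of_real (norm x) *s (U *v axis i 1)"
      unfolding U(2) using that by (simp add: vec_eq_iff scaleR_conv_of_real[where 'a = complex])
    then show ?thesis
      using U(1) by blast
  qed
  obtain U s V t where UV: "unitary_matrix U" "w = s *s (U *v axis i 1)"
    "unitary_matrix V" "v = t *s (V *v axis i 1)"
    using unit False by metis
  obtain W W' l where "\<And>i. f (U ** munit i i ** V\<^sup>\<dagger>) = W ** cmat_scale (l i) (munit i i) ** W'"
    using orth_preserving_rank_one[OF f UV(1), of "V\<^sup>\<dagger>"] UV(3) by (metis unitary_adj)
  then have 1: "f (U ** munit i i ** V\<^sup>\<dagger>) = outer (l i *s (W *v axis i 1)) (W'\<^sup>\<dagger> *v axis i 1)"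
    by (simp add: munit_eq_outer mult_outer outer_mult) (simp add: vec_eq_iff)
  have "outer w v = cmat_scale (s * cnj t) (U ** munit i i ** V\<^sup>\<dagger>)"
    unfolding UV(2,4) munit_eq_outer mult_outer outer_mult by (simp add: vec_eq_iff del: mult_axis_nth)
  then have "f (outer w v) = cmat_scale (s * cnj t) (outer (l i *s (W *v axis i 1)) (W'\<^sup>\<dagger> *v axis i 1))"
    by (simp add: orth_preserving_scale[OF f] 1)
  then show ?thesis
    by (simp add: mult_ac)
qed

text \<open>Orthogonality to the other diagonal units confines the image to the rows and columns \<open>i\<close> and \<open>j\<close>;
  the \<open>2 \<times> 2\<close> minors of the images of \<open>munit i j\<close>, \<open>munit i i + munit i j\<close> and
  \<open>munit j j + munit i j\<close> leave a single entry.\<close>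

lemma orth_preserving_munit:
  fixes f :: "complex ^ 'n ^ 'n \<Rightarrow> complex ^ 'n ^ 'n"
  assumes f: "orth_preserving f"
    and diag: "\<And>i. f (munit i i) = cmat_scale (l i) (munit i i)" and ij: "i \<noteq> j"
  shows "(\<exists>x. x \<noteq> 0 \<and> f (munit i j) = cmat_scale x (munit i j)) \<or>
    (\<exists>x. x \<noteq> 0 \<and> f (munit i j) = cmat_scale x (munit j i))"
proof -
  have "munit p q \<noteq> (0 :: complex ^ 'n ^ 'n)" for p q
    by (metis munit_nth zero_index zero_neq_one)
  then have nz: "f (munit p q) \<noteq> 0" for p q
    by (simp add: orth_preserving_eq_0_iff[OF f])
  have l: "l p \<noteq> 0" for p
    using nz[of p p] diag[of p] by auto
  define X where "X = f (munit i j)"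
  have 0: "X $ p $ a = 0" "X $ a $ p = 0" if p: "p \<noteq> i" "p \<noteq> j" for p a
  proof -
    have "cdot (axis i 1) (axis p 1) = 0" "cdot (axis j 1) (axis p 1) = 0"
      unfolding cdot_axis_left using p by (simp_all add: axis_def)
    then have "X\<^sup>\<dagger> ** f (munit p p) = 0" "X ** (f (munit p p))\<^sup>\<dagger> = 0"
      unfolding X_def munit_eq_outer by (simp_all add: orth_preserving_orth[OF f])
    then have "(X\<^sup>\<dagger> ** munit p p) $ a $ p = 0" "(X ** (munit p p)\<^sup>\<dagger>) $ a $ p = 0"
      using l[of p] by (simp_all add: diag)
    then show "X $ p $ a = 0" "X $ a $ p = 0"
      by (simp_all add: matrix_mult_nth munit_nth if_distrib [of cnj] if_distrib [of "\<lambda>x. _ * x"] cong: if_cong)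
  qed
  have "munit i j = outer (axis i 1) (axis j 1)"
    by (rule munit_eq_outer)
  then have m0: "X $ i $ i * X $ j $ j = X $ i $ j * X $ j $ i"
    unfolding X_def by (simp add: orth_preserving_minor[OF f])
  have "munit i i + munit i j = outer (axis i 1) (axis i 1 + axis j 1)"
    using ij by (auto simp: vec_eq_iff munit_nth axis_def)
  then have "f (outer (axis i 1) (axis i 1 + axis j 1)) = cmat_scale (l i) (munit i i) + X"
    by (metis X_def diag orth_preserving_add[OF f])
  from orth_preserving_minor[OF f, of "axis i 1" "axis i 1 + axis j 1" i i j j, unfolded this]
  have "(l i + X $ i $ i) * X $ j $ j = X $ i $ j * X $ j $ i"
    using ij by (simp add: munit_nth)
  then have jj: "X $ j $ j = 0"
    using m0 l[of i] by (simp add: distrib_right)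
  have "munit j j + munit i j = outer (axis i 1 + axis j 1) (axis j 1)"
    using ij by (auto simp: vec_eq_iff munit_nth axis_def)
  then have "f (outer (axis i 1 + axis j 1) (axis j 1)) = cmat_scale (l j) (munit j j) + X"
    by (metis X_def diag orth_preserving_add[OF f])
  from orth_preserving_minor[OF f, of "axis i 1 + axis j 1" "axis j 1" i i j j, unfolded this]
  have "X $ i $ i * (l j + X $ j $ j) = X $ i $ j * X $ j $ i"
    using ij by (simp add: munit_nth)
  then have ii: "X $ i $ i = 0"
    using m0 l[of j] by (simp add: distrib_left)
  have X: "X $ a $ b = cmat_scale (X $ i $ j) (munit i j) $ a $ b + cmat_scale (X $ j $ i) (munit j i) $ a $ b" for a b
    using 0[of a b] 0[of b a] ii jj ij by (auto simp: munit_nth)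
  have "X $ i $ j = 0 \<or> X $ j $ i = 0"
    using m0 ii by simp
  then show ?thesis
  proof
    assume 1: "X $ i $ j = 0"
    have "X $ a $ b = cmat_scale (X $ j $ i) (munit j i) $ a $ b" for a b
      using X[of a b] 1 by simp
    then have "X = cmat_scale (X $ j $ i) (munit j i)"
      unfolding vec_eq_iff by blast
    moreover from this have "X $ j $ i \<noteq> 0"
      using nz[of i j] X_def by auto
    ultimately show ?thesis
      unfolding X_def by blast
  next
    assume 1: "X $ j $ i = 0"
    have "X $ a $ b = cmat_scale (X $ i $ j) (munit i j) $ a $ b" for a b
      using X[of a b] 1 by simp
    then have "X = cmat_scale (X $ i $ j) (munit i j)"
      unfolding vec_eq_iff by blast
    moreover from this have "X $ i $ j \<noteq> 0"
      using nz[of i j] X_def by auto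
    ultimately show ?thesis
      unfolding X_def by blast
  qed
qed

text \<open>\<open>p i j\<close> says that the unit is kept rather than transposed. A kept and a
  transposed unit in one row or column would sum to a matrix of rank two, although the sum of the
  original units has rank one.\<close>

lemma orth_preserving_munit_uniform:
  fixes f :: "complex ^ 'n ^ 'n \<Rightarrow> complex ^ 'n ^ 'n"
  assumes f: "orth_preserving f"
    and diag: "\<And>i. f (munit i i) = cmat_scale (l i) (munit i i)"
  shows "(\<forall>i j. \<exists>x. f (munit i j) = cmat_scale x (munit i j)) \<or>
    (\<forall>i j. \<exists>x. f (munit i j) = cmat_scale x (munit j i))"
proof -
  define p where "p i j \<longleftrightarrow> f (munit i j) $ i $ j \<noteq> 0" for i j
  have p: "f (munit i j) = cmat_scale (f (munit i j) $ i $ j) (munit i j)" "f (munit i j) $ i $ j \<noteq> 0"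
    if "i \<noteq> j" "p i j" for i j
    using orth_preserving_munit[OF f diag that(1)] that by (auto simp: p_def munit_nth)
  have np: "f (munit i j) = cmat_scale (f (munit i j) $ j $ i) (munit j i)" "f (munit i j) $ j $ i \<noteq> 0"
    if "i \<noteq> j" "\<not> p i j" for i j
    using orth_preserving_munit[OF f diag that(1)] that by (auto simp: p_def munit_nth)
  have row: "p i b" if ij: "i \<noteq> j" and ib: "i \<noteq> b" and pij: "p i j" for i j b
  proof (rule ccontr)
    assume npib: "\<not> p i b"
    have jb: "j \<noteq> b"
      using pij npib by auto
    have "munit i j + munit i b = outer (axis i 1) (axis j 1 + axis b 1)"
      using jb by (auto simp: vec_eq_iff munit_nth axis_def)
    then have "f (outer (axis i 1) (axis j 1 + axis b 1)) = f (munit i j) + f (munit i b)"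
      by (metis orth_preserving_add[OF f])
    also have "\<dots> = cmat_scale (f (munit i j) $ i $ j) (munit i j) + cmat_scale (f (munit i b) $ b $ i) (munit b i)"
      using p(1)[OF ij pij] np(1)[OF ib npib] by metis
    finally have *: "f (outer (axis i 1) (axis j 1 + axis b 1)) = \<dots>" .
    show False
      using orth_preserving_minor[OF f, of "axis i 1" "axis j 1 + axis b 1" i j b i] ij ib jb
        p(2)[OF ij pij] np(2)[OF ib npib]
      unfolding * by (simp add: munit_nth)
  qed
  have col: "p a j" if ij: "i \<noteq> j" and aj: "a \<noteq> j" and pij: "p i j" for i j a
  proof (rule ccontr)
    assume npaj: "\<not> p a j"
    have ia: "i \<noteq> a"
      using pij npaj by auto
    have "munit i j + munit a j = outer (axis i 1 + axis a 1) (axis j 1)"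
      using ia by (auto simp: vec_eq_iff munit_nth axis_def)
    then have "f (outer (axis i 1 + axis a 1) (axis j 1)) = f (munit i j) + f (munit a j)"
      by (metis orth_preserving_add[OF f])
    also have "\<dots> = cmat_scale (f (munit i j) $ i $ j) (munit i j) + cmat_scale (f (munit a j) $ j $ a) (munit j a)"
      using p(1)[OF ij pij] np(1)[OF aj npaj] by metis
    finally have *: "f (outer (axis i 1 + axis a 1) (axis j 1)) = \<dots>" .
    show False
      using orth_preserving_minor[OF f, of "axis i 1 + axis a 1" "axis j 1" i j j a] ij aj ia
        p(2)[OF ij pij] np(2)[OF aj npaj]
      unfolding * by (simp add: munit_nth)
  qed
  have swap: "p j i" if ij: "i \<noteq> j" and pij: "p i j" for i j
  proof (rule ccontr)
    assume npji: "\<not> p j i"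
    have ji: "j \<noteq> i"
      using ij by simp
    \<comment> \<open>Otherwise both units go to multiples of \<open>munit i j\<close>; cross
      multiplying the coefficients contradicts injectivity.\<close>
    have "f (cmat_scale (f (munit j i) $ i $ j) (munit i j)) = f (cmat_scale (f (munit i j) $ i $ j) (munit j i))"
    proof -
      have "f (cmat_scale (f (munit j i) $ i $ j) (munit i j)) =
          cmat_scale (f (munit j i) $ i $ j) (cmat_scale (f (munit i j) $ i $ j) (munit i j))"
        using p(1)[OF ij pij] by (metis orth_preserving_scale[OF f])
      also have "\<dots> = cmat_scale (f (munit i j) $ i $ j) (cmat_scale (f (munit j i) $ i $ j) (munit i j))"
        by (simp add: mult.commute)
      also have "\<dots> = f (cmat_scale (f (munit i j) $ i $ j) (munit j i))"
        using np(1)[OF ji npji] by (metis orth_preserving_scale[OF f])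
      finally show ?thesis .
    qed
    then have "cmat_scale (f (munit j i) $ i $ j) (munit i j) = cmat_scale (f (munit i j) $ i $ j) (munit j i)"
      by (rule injD[OF orth_preserving_inj[OF f]])
    from arg_cong[OF this, of "\<lambda>M. M $ i $ j"] show False
      using np(2)[OF ji npji] ij by (simp add: munit_nth)
  qed
  show ?thesis
  proof (cases "\<exists>i j. i \<noteq> j \<and> p i j")
    case True
    then obtain i j where ij: "i \<noteq> j" "p i j"
      by blast
    \<comment> \<open>A row move followed by a column move reaches \<open>(a, b)\<close>, unless
      \<open>b = i\<close> would lead through the diagonal; then the start is
      \<open>(j, i)\<close>.\<close>
    have "p a b" if ab: "a \<noteq> b" for a b
    proof (cases "b = i")
      case False
      then have "p i b"
        using row[OF ij(1) _ ij(2)] by metis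
      then show ?thesis
        using col[of i b a] False ab by blast
    next
      case True
      have "p j i"
        by (rule swap[OF ij])
      then show ?thesis
        using col[of j i a] ij ab True by blast
    qed
    then have "\<exists>x. f (munit a b) = cmat_scale x (munit a b)" for a b
      using p(1)[of a b] diag by (cases "a = b") auto
    then show ?thesis
      by blast
  next
    case False
    then have "\<exists>x. f (munit a b) = cmat_scale x (munit b a)" for a b
      using np(1)[of a b] diag by (cases "a = b") auto
    then show ?thesis
      by blast
  qed
qed

text \<open>\<open>f\<close> is entrywise multiplication by \<open>x\<close>. The all-ones matrix
  shows that \<open>x\<close> has rank one, and orthogonality tested on sums and differences of two
  axes shows that its entries have equal modulus.\<close>

lemma orth_preserving_scaled_munit:
  fixes f :: "complex ^ 'n ^ 'n \<Rightarrow> complex ^ 'n ^ 'n"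
  assumes f: "orth_preserving f" and x: "\<And>i j. f (munit i j) = cmat_scale (x i j) (munit i j)"
  obtains \<gamma> U V where "\<gamma> > 0" "unitary_matrix U" "unitary_matrix V"
    "\<And>X. f X = cmat_scale (complex_of_real \<gamma>) (U ** X ** V)"
proof -
  have "munit p q \<noteq> (0 :: complex ^ 'n ^ 'n)" for p q
    by (metis munit_nth zero_index zero_neq_one)
  then have nz: "x p q \<noteq> 0" for p q
    using orth_preserving_eq_0_iff[OF f, of "munit p q"] by (simp add: x)
  have f_nth: "f X $ i $ j = x i j * X $ i $ j" for X i j
  proof (induction X rule: matrix_induct_munit)
    case zero
    then show ?case
      using orth_preserving_eq_0_iff[OF f, of 0] by simp
  qed (auto simp: orth_preserving_add[OF f] orth_preserving_scale[OF f] x munit_nth algebra_simps)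
  have minor: "x i j * x a b = x i b * x a j" for i j a b
    using orth_preserving_minor[OF f, of "\<chi> i. 1" "\<chi> i. 1" i j a b] by (simp add: f_nth)
  have abs: "cmod (x i i) = cmod (x j i)" "cmod (x i i) = cmod (x i j)" if ij: "i \<noteq> j" for i j
  proof -
    \<comment> \<open>The sum and the difference of two axes are orthogonal; the diagonal entries of
      the products of their images compare squared moduli of \<open>x\<close> within a column and
      within a row.\<close>
    define v where "v = axis i 1 + axis j (1 :: complex)"
    define w where "w = axis i 1 - axis j (1 :: complex)"
    have vw: "v $ l = (if l = i then 1 else if l = j then 1 else 0)"
      "w $ l = (if l = i then 1 else if l = j then - 1 else 0)" for l
      using ij by (auto simp: v_def w_def axis_def)
    have sum: "(\<Sum>l\<in>UNIV. if l = i then s else if l = j then t else 0) = s + t" for s t :: complex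
    proof -
      have "(\<Sum>l\<in>UNIV. if l = i then s else if l = j then t else 0) =
          (\<Sum>l\<in>UNIV. (if l = i then s else 0) + (if l = j then t else 0))"
        using ij by (intro sum.cong) auto
      then show ?thesis
        by (simp add: sum.distrib)
    qed
    have "cdot v w = (\<Sum>l\<in>UNIV. if l = i then 1 else if l = j then - 1 else 0)"
      unfolding cdot_def by (rule sum.cong) (auto simp: vw)
    then have orth: "cdot v w = 0"
      by (simp add: sum)
    have "((f (outer v v))\<^sup>\<dagger> ** f (outer w w)) $ i $ i = 0" "(f (outer v v) ** (f (outer w w))\<^sup>\<dagger>) $ i $ i = 0"
      using orth_preserving_orth[OF f orth orth] by simp_all
    moreover have "((f (outer v v))\<^sup>\<dagger> ** f (outer w w)) $ i $ i =
        (\<Sum>l\<in>UNIV. if l = i then cnj (x i i) * x i i else if l = j then - (cnj (x j i) * x j i) else 0)"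
      unfolding matrix_mult_nth by (rule sum.cong) (auto simp: f_nth vw)
    moreover have "(f (outer v v) ** (f (outer w w))\<^sup>\<dagger>) $ i $ i =
        (\<Sum>l\<in>UNIV. if l = i then x i i * cnj (x i i) else if l = j then - (x i j * cnj (x i j)) else 0)"
      unfolding matrix_mult_nth by (rule sum.cong) (auto simp: f_nth vw)
    ultimately have "x i i * cnj (x i i) = x j i * cnj (x j i)" "x i i * cnj (x i i) = x i j * cnj (x i j)"
      by (simp_all add: sum mult.commute)
    then have "(cmod (x i i))\<^sup>2 = (cmod (x j i))\<^sup>2" "(cmod (x i i))\<^sup>2 = (cmod (x i j))\<^sup>2"
      by (simp_all add: complex_norm_square[symmetric] of_real_eq_iff del: of_real_power)
    then show "cmod (x i i) = cmod (x j i)" "cmod (x i i) = cmod (x i j)"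
      by simp_all
  qed
  obtain o' :: 'n where True
    by blast
  define \<gamma> where "\<gamma> = cmod (x o' o')"
  have diag: "cmod (x i i) = \<gamma>" for i
    using abs(1)[of o' i] abs(2)[of i o'] by (cases "i = o'") (simp_all add: \<gamma>_def)
  have \<gamma>: "\<gamma> > 0" "cmod (x i j) = \<gamma>" for i j
  proof -
    show "\<gamma> > 0"
      using nz[of o' o'] by (simp add: \<gamma>_def)
    show "cmod (x i j) = \<gamma>"
      using abs(2)[of i j] diag[of i] by (cases "i = j") simp_all
  qed
  show thesis
  proof (rule that)
    show "unitary_matrix (cdiag (\<lambda>i. x i o' / \<gamma>))" "unitary_matrix (cdiag (\<lambda>j. x o' j / x o' o'))"
      using \<gamma> by (auto intro!: unitary_cdiag simp: norm_divide)
    fix X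
    \<comment> \<open>Rank one expresses \<open>x\<close> by its row and column through the base
      index \<open>o'\<close>; constant modulus makes both normalised factors unimodular.\<close>
    have x_eq: "x i j = \<gamma> * (x i o' / \<gamma> * (x o' j / x o' o'))" for i j
      using minor[of i j o' o'] nz[of o' o'] \<gamma>(1) by (simp add: field_simps)
    have "f X $ i $ j = cmat_scale (complex_of_real \<gamma>)
        (cdiag (\<lambda>i. x i o' / \<gamma>) ** X ** cdiag (\<lambda>j. x o' j / x o' o')) $ i $ j" for i j
    proof -
      have "f X $ i $ j = \<gamma> * (x i o' / \<gamma> * (x o' j / x o' o')) * X $ i $ j"
        unfolding f_nth by (subst x_eq) (rule refl)
      then show ?thesis
        by (simp only: cmat_scale_nth mult_cdiag_nth cdiag_mult_nth mult_ac)
    qed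
    then show "f X = cmat_scale (complex_of_real \<gamma>)
        (cdiag (\<lambda>i. x i o' / \<gamma>) ** X ** cdiag (\<lambda>j. x o' j / x o' o'))"
      unfolding vec_eq_iff by blast
  qed (rule \<gamma>(1))
qed

lemma orth_preserving_classification:
  fixes f :: "complex ^ 'n ^ 'n \<Rightarrow> complex ^ 'n ^ 'n"
  assumes f: "orth_preserving f"
  obtains \<gamma> U V where "\<gamma> > 0" "unitary_matrix U" "unitary_matrix V"
    "(\<forall>X. f X = cmat_scale (complex_of_real \<gamma>) (U ** X ** V)) \<or>
     (\<forall>X. f X = cmat_scale (complex_of_real \<gamma>) (U ** transpose X ** V))"
proof -
  obtain W W' l where W: "unitary_matrix W" "unitary_matrix W'"
    "\<And>i. f (mat 1 ** munit i i ** mat 1) = W ** cmat_scale (l i) (munit i i) ** W'"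
    by (rule orth_preserving_rank_one[OF f unitary_one unitary_one]) blast
  define g where "g X = W\<^sup>\<dagger> ** f X ** W'\<^sup>\<dagger>" for X
  have fg: "f X = W ** g X ** W'" for X
    using W(1,2) by (simp add: g_def unitary_conj_inverse)
  have g: "orth_preserving g"
    unfolding g_def using f W by (intro orth_preserving_unitary) simp_all
  have "g (munit i i) = cmat_scale (l i) (munit i i)" for i
    using unitary_conj_inverse(1)[OF W(1,2), of "cmat_scale (l i) (munit i i)"] W(3)[of i]
    by (simp add: g_def del: scale_mult_left scale_mult_right)
  from orth_preserving_munit_uniform[OF g this] show thesis
  proof
    assume "\<forall>i j. \<exists>x. g (munit i j) = cmat_scale x (munit i j)"
    then obtain x where "\<And>i j. g (munit i j) = cmat_scale (x i j) (munit i j)"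
      by metis
    with g obtain \<gamma> U V where 1: "\<gamma> > 0" "unitary_matrix U" "unitary_matrix V"
      "\<And>X. g X = cmat_scale (complex_of_real \<gamma>) (U ** X ** V)"
      by (rule orth_preserving_scaled_munit) blast
    then have "f X = cmat_scale (complex_of_real \<gamma>) ((W ** U) ** X ** (V ** W'))" for X
      by (simp add: fg matrix_mul_assoc)
    then show thesis
      using that[of \<gamma> "W ** U" "V ** W'"] 1 W by simp
  next
    assume "\<forall>i j. \<exists>x. g (munit i j) = cmat_scale x (munit j i)"
    then have "\<forall>i j. \<exists>x. g (transpose (munit i j)) = cmat_scale x (munit i j)"
      by simp
    then obtain x where "\<And>i j. g (transpose (munit i j)) = cmat_scale (x i j) (munit i j)"
      by metis
    with orth_preserving_transpose[OF g] obtain \<gamma> U V where 1: "\<gamma> > 0" "unitary_matrix U" "unitary_matrix V"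
      "\<And>X. g (transpose X) = cmat_scale (complex_of_real \<gamma>) (U ** X ** V)"
      by (rule orth_preserving_scaled_munit) blast
    have "f X = cmat_scale (complex_of_real \<gamma>) ((W ** U) ** transpose X ** (V ** W'))" for X
      using 1(4)[of "transpose X"] by (simp add: fg matrix_mul_assoc)
    then show thesis
      using that[of \<gamma> "W ** U" "V ** W'"] 1 W by simp
  qed
qed

section \<open>Isometry under transposition and the conclusion\<close>

lemma (in ky_fan) N_transpose: "N (transpose X) = N X"
proof -
  have le: "N X \<le> N (transpose X)" for X
  proof -
    obtain F where F: "normed_by F X"
      using ex_normed_by by blast
    obtain U V S where UV: "unitary_matrix U" "unitary_matrix V" "F = U ** proj S ** V" "card S = k"
      using normed_by_in[OF F] by (auto simp: partial_isometries_def)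
    have unitary: "unitary_matrix (transpose W)" if "unitary_matrix W" for W :: "complex ^ 'n ^ 'n"
    proof (rule unitaryI)
      have "(transpose W)\<^sup>\<dagger> ** transpose W = transpose (W ** W\<^sup>\<dagger>)"
        by (simp add: vec_eq_iff matrix_mult_nth transpose_def mult.commute)
      then show "(transpose W)\<^sup>\<dagger> ** transpose W = mat 1"
        using that by (simp add: unitary_right transpose_mat)
    qed
    have "transpose F = transpose V ** proj S ** transpose U"
    proof -
      have "transpose (proj S) = proj S"
        by (auto simp: vec_eq_iff transpose_def proj_nth)
      then show ?thesis
        by (simp add: UV(3) matrix_transpose_mul matrix_mul_assoc)
    qed
    then have "transpose F \<in> partial_isometries k"
      using UV unitary by (simp add: partial_isometries_unitary)
    moreover have "inner (transpose F) (transpose X) = inner F X"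
      unfolding inner_vec_def transpose_def by (simp, rule sum.swap)
    ultimately show ?thesis
      using inner_le_N N_eq[OF F] by metis
  qed
  show ?thesis
    using le[of X] le[of "transpose X"] by simp
qed

theorem theorem2p1:
  fixes k :: nat
    and T :: "complex ^ 'n ^ 'n \<Rightarrow> complex ^ 'n ^ 'n"
  assumes "1 < k" and "k \<le> CARD('n)"
    and "bij T"
    and "Vector_Spaces.linear cmat_scale cmat_scale T"
    and "\<And>A B. parallel_wrt (ky_fan_norm k) A B \<Longrightarrow> parallel_wrt (ky_fan_norm k) (T A) (T B)"
  shows "(\<exists>c S. Vector_Spaces.linear cmat_scale cmat_scale S \<and>
            (\<forall>X. ky_fan_norm k (S X) = ky_fan_norm k X) \<and>
            (\<forall>X. T X = cmat_scale c (S X))) \<and>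
         (\<exists>\<gamma> U V. \<gamma> > 0 \<and> unitary_matrix U \<and> unitary_matrix V \<and>
            ((\<forall>X. T X = cmat_scale (complex_of_real \<gamma>) (U ** X ** V)) \<or>
             (\<forall>X. T X = cmat_scale (complex_of_real \<gamma>) (U ** transpose X ** V))))"
proof -
  interpret T: Vector_Spaces.linear cmat_scale cmat_scale T
    by (rule assms(4))
  interpret parallel_preserver k "TYPE('n)" T
    using assms T.add T.scale by unfold_locales auto
  obtain \<gamma> U V where *: "\<gamma> > 0" "unitary_matrix U" "unitary_matrix V"
    "(\<forall>X. T X = cmat_scale (complex_of_real \<gamma>) (U ** X ** V)) \<or>
     (\<forall>X. T X = cmat_scale (complex_of_real \<gamma>) (U ** transpose X ** V))"
    by (rule orth_preserving_classification[OF orth_preserving_T]) blast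
  define S where "S X = cmat_scale (1 / complex_of_real \<gamma>) (T X)" for X
  have TS: "T X = cmat_scale (complex_of_real \<gamma>) (S X)" for X
    using *(1) by (simp add: S_def)
  have S: "(\<forall>X. S X = U ** X ** V) \<or> (\<forall>X. S X = U ** transpose X ** V)"
    using *(1,4) by (auto simp: S_def)
  have "Vector_Spaces.linear cmat_scale cmat_scale S"
    unfolding Vector_Spaces.linear_def module_hom_def module_hom_axioms_def
    using vector_space_cmat_scale
    by (auto simp: vector_space_def module_def S_def T_add T_scale scale_add mult.commute)
  moreover have "N (S X) = N X" for X
    using S *(2,3) by (auto simp: N_unitary N_transpose)
  ultimately show ?thesis
    using TS * by blast
qed

end
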